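(* Let $0<\beta<1$, $H\in(1/2,1)$ and $T>0$. For every $p,q\ge1$ and $h\in\mathcal{H}_H$, the derivative operator $$\partial_{1,h}:\mathcal{F}C_{b,H}^\infty\longrightarrow L^p(\mathbb{W}\times\mathbb{R}^+,\mathcal{F}^{X_{\beta,2H,T}},\mathbb{P}_H\otimes\mathbb{P}_{Y_\beta})$$ is closable in $L^q(\mathbb{W}\times\mathbb{R}^+,\mathcal{F}^{X_{\beta,2H,T}},\mathbb{P}_H\otimes\mathbb{P}_{Y_\beta})$; that is, if $(F_n)_{n\in\mathbb{N}}\subset\mathcal{F}C_{b,H}^\infty$ satisfies $F_n\to0$ in $L^q$ and $\partial_{1,h}F_n\to Z$ in $L^p$, then $Z=0$.
   Context: $\mathbb{R}^+=[0,\infty)$. $\mathbb{W}$ is the space of continuous $w:\mathbb{R}^+\to\mathbb{R}$ with $w(0)=0$, with the topology of locally uniform convergence. $\mathbb{P}_H$ is the unique probability measure on $\mathbb{W}$ under which the canonical process $w\mapsto w(t)$ is a fractional Brownian motion with Hurst index $H$, i.e. centered Gaussian with covariance $R_H(t,s)=\frac12(t^{2H}+s^{2H}-|t-s|^{2H})$. $\mathbb{P}_{Y_\beta}$ is the probability measure on $\mathbb{R}^+$ with density $M_\beta$ determined by $\int_0^\infty e^{-s\tau}M_\beta(\tau)\,d\tau=E_\beta(-s)$, $s\ge0$, with $E_\beta(z)=\sum_{n\ge0}z^n/\Gamma(\beta n+1)$. Put $\tau_H:=\tau^{1/(2H)}$, $X_{\beta,2H,T}(t)(w,\tau)=w(t\tau_H)$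 for $t\in[0,T]$, and $\mathcal{F}^{X_{\beta,2H,T}}=\sigma(X_{\beta,2H,T}(t),t\in[0,T])$. Elements of $L^p$ spaces are identified when equal $\mathbb{P}_H\otimes\mathbb{P}_{Y_\beta}$-a.s. The Cameron--Martin space $\mathcal{H}_H$ is the completion of $\mathrm{span}\{R_H(t,\cdot):t\ge0\}$ for the scalar product determined by $(R_H(t,\cdot),R_H(s,\cdot))_{\mathcal{H}_H}=R_H(t,s)$, realized as a space of functions on $\mathbb{R}^+$ (the reproducing kernel Hilbert space of $R_H$; its elements lie in $\mathbb{W}$). $\mathcal{F}C_{b,H}^\infty$ (depending on $T$) is the class of functions $F(w,\tau)=f(w(t_1\tau_H),\dots,w(t_n\tau_H))$ on $\mathbb{W}\times\mathbb{R}^+$ with $n\in\mathbb{N}$, $0<t_1<\dots<t_n\le T$ and $f\in C_b^\infty(\mathbb{R}^n)$, the set of $C^\infty$ real-valued functions bounded together with all their partial derivatives. For such $F$ and $h\in\mathcal{H}_H$, $(\partial_{1,h}F)(w,\tau)=\lim_{\varepsilon\to0}\varepsilon^{-1}(F(w+\varepsilon h,\tau)-F(w,\tau))=\sum_i\partial_if(w(t_1\tau_H),\dots,w(t_n\tau_H))h(t_i\tau_H)$. *)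

theory Defs
  imports "HOL-Probability.Probability"
begin

text \<open>
  The half line \<open>[0,\<infinity>)\<close> is the subset \<^term>\<open>{0::real..}\<close>. Functions on it are total functions
  \<^typ>\<open>real \<Rightarrow> real\<close> normalised to vanish on the negative half line (so that a function on the half
  line has exactly one representative, and sums and multiples of representatives are again
  representatives).
\<close>

definition paths :: "(real \<Rightarrow> real) set" where
  "paths = {w. continuous_on {0..} w \<and> w 0 = 0 \<and> (\<forall>t<0. w t = 0)}"

text \<open>Uniform balls over \<open>[0, r]\<close> form a base of the topology of locally uniform convergence.\<close>

definition path_topology :: "(real \<Rightarrow> real) topology" where
  "path_topology = topology_generated_by
     {{v \<in> paths. \<forall>t\<in>{0..r}. \<bar>v t - w t\<bar> < \<epsilon>} |w r \<epsilon>. w \<in> paths \<and> 0 \<le> r \<and> 0 < \<epsilon>}"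

definition path_borel :: "(real \<Rightarrow> real) measure" where
  "path_borel = sigma paths {U. openin path_topology U}"

subsection \<open>Fractional Brownian motion\<close>

definition fbm_cov :: "real \<Rightarrow> real \<Rightarrow> real \<Rightarrow> real" where
  "fbm_cov H t s = (t powr (2 * H) + s powr (2 * H) - \<bar>t - s\<bar> powr (2 * H)) / 2"

text \<open>Constants count as (degenerate) Gaussian variables.\<close>

definition gaussian_rv :: "'a measure \<Rightarrow> ('a \<Rightarrow> real) \<Rightarrow> bool" where
  "gaussian_rv M X \<longleftrightarrow>
     (\<exists>\<mu> \<sigma>. 0 < \<sigma> \<and> distributed M lborel X (\<lambda>x. ennreal (normal_density \<mu> \<sigma> x))) \<or>
     (X \<in> borel_measurable M \<and> (\<exists>\<mu>. AE \<omega> in M. X \<omega> = \<mu>))"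

definition gaussian_process :: "'a measure \<Rightarrow> 'i set \<Rightarrow> ('i \<Rightarrow> 'a \<Rightarrow> real) \<Rightarrow> bool" where
  "gaussian_process M I X \<longleftrightarrow>
     (\<forall>J a. finite J \<longrightarrow> J \<subseteq> I \<longrightarrow> gaussian_rv M (\<lambda>\<omega>. \<Sum>i\<in>J. a i * X i \<omega>))"

text \<open>
  \<open>fbm_law H P\<close> states that \<open>P\<close> is the law of fractional Brownian motion on the path space. For
  \<open>0 < H < 1\<close> exactly one measure satisfies it.
\<close>

definition fbm_law :: "real \<Rightarrow> (real \<Rightarrow> real) measure \<Rightarrow> bool" where
  "fbm_law H P \<longleftrightarrow>
     prob_space P \<and> sets P = sets path_borel \<and>
     gaussian_process P {0..} (\<lambda>t w. w t) \<and>
     (\<forall>t\<ge>0. (\<integral>w. w t \<partial>P) = 0) \<and>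
     (\<forall>t\<ge>0. \<forall>s\<ge>0. (\<integral>w. w t * w s \<partial>P) = fbm_cov H t s)"

subsection \<open>The random time\<close>

definition mittag_leffler :: "real \<Rightarrow> real \<Rightarrow> real" where
  "mittag_leffler \<beta> z = (\<Sum>n. z ^ n / Gamma (\<beta> * real n + 1))"

text \<open>
  The density is fixed, up to null sets, by its Laplace transform; the case \<open>s = 0\<close> says that its
  total mass is one. For \<open>0 < \<beta> < 1\<close> exactly one measure satisfies the predicate.
\<close>

definition time_law :: "real \<Rightarrow> real measure \<Rightarrow> bool" where
  "time_law \<beta> P \<longleftrightarrow>
     (\<exists>M :: real \<Rightarrow> real.
        (\<forall>\<tau>\<ge>0. 0 \<le> M \<tau>) \<and>
        (\<forall>s\<ge>0. has_bochner_integral (restrict_space lborel {0..})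
                  (\<lambda>\<tau>. exp (- s * \<tau>) * M \<tau>) (mittag_leffler \<beta> (- s))) \<and>
        P = density (restrict_space lborel {0..}) (\<lambda>\<tau>. ennreal (M \<tau>)))"

definition time_scale :: "real \<Rightarrow> real \<Rightarrow> real" where
  "time_scale H \<tau> = \<tau> powr (1 / (2 * H))"

definition ggbm :: "real \<Rightarrow> real \<Rightarrow> (real \<Rightarrow> real) \<times> real \<Rightarrow> real" where
  "ggbm H t = (\<lambda>(w, \<tau>). w (t * time_scale H \<tau>))"

definition ggbm_sigma :: "real \<Rightarrow> real \<Rightarrow> ((real \<Rightarrow> real) \<times> real) measure" where
  "ggbm_sigma H T = sigma (paths \<times> {0..})
     {ggbm H t -` B \<inter> (paths \<times> {0..}) |t B. t \<in> {0..T} \<and> B \<in> sets borel}"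

subsection \<open>The Cameron--Martin space\<close>

text \<open>
  A finitely supported coefficient family \<open>c\<close> stands for the element
  \<open>\<Sum>t. c t * R\<^sub>H(t, \<cdot>)\<close> of the span. The completion is realised as the set of pointwise limits of
  sequences in the span that are Cauchy for the norm given by the scalar product.
\<close>

definition fin_coeffs :: "(real \<Rightarrow> real) set" where
  "fin_coeffs = {c. finite {t. c t \<noteq> 0} \<and> {t. c t \<noteq> 0} \<subseteq> {0..}}"

definition span_fun :: "real \<Rightarrow> (real \<Rightarrow> real) \<Rightarrow> real \<Rightarrow> real" where
  "span_fun H c x = (if x < 0 then 0 else \<Sum>t | c t \<noteq> 0. c t * fbm_cov H t x)"

definition span_inner :: "real \<Rightarrow> (real \<Rightarrow> real) \<Rightarrow> (real \<Rightarrow> real) \<Rightarrow> real" where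
  "span_inner H c d = (\<Sum>t | c t \<noteq> 0. \<Sum>s | d s \<noteq> 0. c t * d s * fbm_cov H t s)"

definition span_norm :: "real \<Rightarrow> (real \<Rightarrow> real) \<Rightarrow> real" where
  "span_norm H c = sqrt (span_inner H c c)"

definition cameron_martin :: "real \<Rightarrow> (real \<Rightarrow> real) set" where
  "cameron_martin H = {h. \<exists>c :: nat \<Rightarrow> real \<Rightarrow> real.
     (\<forall>n. c n \<in> fin_coeffs) \<and>
     (\<forall>\<epsilon>>0. \<exists>N. \<forall>m\<ge>N. \<forall>n\<ge>N. span_norm H (\<lambda>t. c m t - c n t) < \<epsilon>) \<and>
     (\<forall>x. (\<lambda>n. span_fun H (c n) x) \<longlonglongrightarrow> h x)}"

subsection \<open>Smooth cylinder functions and the derivative\<close>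

text \<open>
  \<open>\<real>\<^sup>n\<close> for variable \<open>n\<close> is the carrier of \<^const>\<open>Euclidean_space\<close>, the sequences that vanish from
  index \<open>n\<close> on. The coordinates are thus numbered from \<open>0\<close> to \<open>n - 1\<close>.
\<close>

definition partial_deriv :: "nat \<Rightarrow> ((nat \<Rightarrow> real) \<Rightarrow> real) \<Rightarrow> (nat \<Rightarrow> real) \<Rightarrow> real" where
  "partial_deriv i f x = deriv (\<lambda>s. f (x(i := s))) (x i)"

definition Cb_infinity :: "nat \<Rightarrow> ((nat \<Rightarrow> real) \<Rightarrow> real) set" where
  "Cb_infinity n = {f. \<forall>is. set is \<subseteq> {..<n} \<longrightarrow>
     (let g = foldr partial_deriv is f in
        (\<forall>i<n. \<forall>x\<in>topspace (Euclidean_space n).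
           (\<lambda>s. g (x(i := s))) field_differentiable at (x i)) \<and>
        continuous_map (Euclidean_space n) euclideanreal g \<and>
        bounded (g ` topspace (Euclidean_space n)))}"

definition smooth_cylinder :: "real \<Rightarrow> real \<Rightarrow> ((real \<Rightarrow> real) \<times> real \<Rightarrow> real) set" where
  "smooth_cylinder H T = {F. \<exists>n t f.
     0 < n \<and> strict_mono_on {..<n} t \<and> (\<forall>i<n. 0 < t i \<and> t i \<le> T) \<and> f \<in> Cb_infinity n \<and>
     (\<forall>w\<in>paths. \<forall>\<tau>\<ge>0.
        F (w, \<tau>) = f (\<lambda>i. if i < n then w (t i * time_scale H \<tau>) else 0))}"

definition path_deriv ::
  "(real \<Rightarrow> real) \<Rightarrow> ((real \<Rightarrow> real) \<times> real \<Rightarrow> real) \<Rightarrow> (real \<Rightarrow> real) \<times> real \<Rightarrow> real" where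
  "path_deriv h F = (\<lambda>(w, \<tau>).
     Lim (at 0) (\<lambda>\<epsilon>. (F (\<lambda>t. w t + \<epsilon> * h t, \<tau>) - F (w, \<tau>)) / \<epsilon>))"

subsection \<open>Closability\<close>

text \<open>
  Since functions in \<open>L\<^sup>p\<close> are identified when they agree almost everywhere, a function belongs to
  \<open>L\<^sup>p\<close> over the sub-\<open>\<sigma>\<close>-algebra \<open>A\<close> of \<open>M\<close> as soon as it has an \<open>A\<close>-measurable version. (The
  derivative of a smooth cylinder function depends on the time variable also on exceptional paths, such
  as the zero path, where the process does not reveal it; so it need not be measurable for
  \<^const>\<open>ggbm_sigma\<close> itself.)
\<close>

definition Lp_space :: "'a measure \<Rightarrow> 'a measure \<Rightarrow> real \<Rightarrow> ('a \<Rightarrow> real) set" where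
  "Lp_space M A p = {Z. Z \<in> borel_measurable M \<and>
     (\<exists>Z'\<in>borel_measurable A. AE x in M. Z x = Z' x) \<and>
     integrable M (\<lambda>x. \<bar>Z x\<bar> powr p)}"

definition Lp_tendsto :: "'a measure \<Rightarrow> real \<Rightarrow> (nat \<Rightarrow> 'a \<Rightarrow> real) \<Rightarrow> ('a \<Rightarrow> real) \<Rightarrow> bool" where
  "Lp_tendsto M p F Z \<longleftrightarrow>
     (\<lambda>n. \<integral>\<^sup>+x. ennreal (\<bar>F n x - Z x\<bar> powr p) \<partial>M) \<longlonglongrightarrow> 0"

text \<open>
  \<open>D\<close> is an operator with domain \<open>\<D>\<close> inside \<open>L\<^sup>q\<close> and with values in \<open>L\<^sup>p\<close>, and it is closable.
\<close>

definition closable_Lq_Lp ::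
  "'a measure \<Rightarrow> 'a measure \<Rightarrow> real \<Rightarrow> real \<Rightarrow> ('a \<Rightarrow> real) set \<Rightarrow>
   (('a \<Rightarrow> real) \<Rightarrow> ('a \<Rightarrow> real)) \<Rightarrow> bool" where
  "closable_Lq_Lp M A q p \<D> D \<longleftrightarrow>
     \<D> \<subseteq> Lp_space M A q \<and> D ` \<D> \<subseteq> Lp_space M A p \<and>
     (\<forall>F Z. (\<forall>n::nat. F n \<in> \<D>) \<longrightarrow> Z \<in> Lp_space M A p \<longrightarrow>
        Lp_tendsto M q F (\<lambda>x. 0) \<longrightarrow> Lp_tendsto M p (\<lambda>n. D (F n)) Z \<longrightarrow>
        (AE x in M. Z x = 0))"

end

theory Submission
  imports Defs
begin

text \<open>
  Differentiation in the direction \<open>h\<close> leaves the random time alone, so the closability can be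
  examined for one value of the time after the other, under the law of fractional Brownian motion.
  There the derivative is a derivative along the lines \<open>w + x h\<close>, and the law is a mixture of
  Gaussian laws on such lines. Indeed, let \<open>\<xi>\<close> be the Gaussian variable that represents \<open>h\<close>, so
  that \<open>h t\<close> is the expectation of \<open>\<xi> w(t)\<close> (\<open>cameron_martin_representation\<close>), and let \<open>\<xi>\<close> have
  variance one. The path \<open>v = w - \<xi> h\<close> is uncorrelated with \<open>\<xi>\<close>, hence independent of it, and
  \<open>w = v + \<xi> h\<close>; therefore \<open>v + x h\<close> with a fresh standard normal \<open>x\<close> has the law of \<open>w\<close> again
  (\<open>nn_integral_resample\<close>).

  Now let \<open>F\<^sub>n\<close> tend to zero and the derivatives of \<open>F\<^sub>n\<close> to \<open>Z\<close>. Both convergences hold in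
  \<open>L\<^sup>1\<close>, and along a subsequence with summable distances they hold, for almost every time and almost
  every \<open>v\<close>, for the functions \<open>x \<mapsto> F\<^sub>n (v + x h)\<close> and their ordinary derivatives in \<open>L\<^sup>1\<close> of the
  standard normal law. On the real line, integration by parts shows that the limit of the
  derivatives vanishes (\<open>gaussian_derivative_closable\<close>). So \<open>Z (v + x h) = 0\<close> almost everywhere, and
  undoing the resampling gives \<open>Z = 0\<close>.

  It remains to see that the derivative, which contains the factors \<open>h (t \<tau>\<^sub>H)\<close>, lies in \<open>L\<^sup>p\<close> of
  the \<open>\<sigma>\<close>-algebra of the process. Its moments are finite because \<open>\<bar>h t\<bar>\<close> is at most a multiple of
  \<open>t\<^sup>H\<close> and the random time has moments of all orders (\<open>integrable_time_law_power\<close>). It has a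
  measurable version because the process almost surely reveals the time: the cosines of the
  rescaled values \<open>2\<^sup>n\<^sup>H X(T/2\<^sup>n)\<close> obey a law of large numbers whose limit is a strictly monotone
  function of the time (\<open>time_recoverable\<close>).
\<close>

section \<open>Moments of the random time\<close>

text \<open>
  Euler's integral restricted to \<open>[C, \<infinity>)\<close>, where \<open>t powr y\<close> is at least \<open>C powr y\<close>.
\<close>

lemma Gamma_lower_bound:
  fixes y C :: real
  assumes "0 \<le> y" "0 < C"
  shows "C powr y * exp (- C) \<le> Gamma (y + 1)"
proof -
  have "((\<lambda>t. exp (- 1 * t)) has_integral exp (- 1 * C) / 1) {C..}"
    by (rule has_integral_exp_minus_to_infinity) simp
  then have "((\<lambda>t. C powr y * exp (- t)) has_integral C powr y * exp (- C)) {C..}"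
    by (intro has_integral_mult_right) simp
  then have "((\<lambda>t. if t \<in> {C..} then C powr y * exp (- t) else 0) has_integral C powr y * exp (- C)) {0..}"
    by (subst has_integral_restrict) (use assms in auto)
  moreover have "((\<lambda>t. t powr (y + 1 - 1) / exp t) has_integral Gamma (y + 1)) {0..}"
    by (rule Gamma_integral_real) (use assms in auto)
  ultimately show ?thesis
  proof (rule has_integral_le)
    fix t :: real assume "t \<in> {0..}"
    then show "(if t \<in> {C..} then C powr y * exp (- t) else 0) \<le> t powr (y + 1 - 1) / exp t"
      using assms by (auto simp: exp_minus divide_inverse intro!: powr_mono2)
  qed
qed

text \<open>
  The free parameter of the lower bound for the Gamma function is chosen so that
  \<open>C powr \<beta> = 2 * \<bar>x\<bar> + 1\<close>; the terms are then dominated by a geometric series.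
\<close>

lemma summable_mittag_leffler:
  fixes x \<beta> :: real
  assumes "0 < \<beta>"
  shows "summable (\<lambda>n. x ^ n / Gamma (\<beta> * real n + 1))"
proof (rule summable_comparison_test)
  define C where "C = (2 * \<bar>x\<bar> + 1) powr (1 / \<beta>)"
  have C: "C > 0" by (simp add: C_def add_nonneg_pos pos_add_strict)
  show "summable (\<lambda>n. exp C * (1 / 2 :: real) ^ n)"
    by (intro summable_mult summable_geometric) simp
  show "\<exists>N. \<forall>n\<ge>N. norm (x ^ n / Gamma (\<beta> * real n + 1)) \<le> exp C * (1 / 2) ^ n"
  proof (intro exI allI impI)
    fix n :: nat
    have "C powr (\<beta> * real n) = (2 * \<bar>x\<bar> + 1) ^ n"
      using assms by (simp add: C_def powr_powr powr_realpow)
    then have G: "(2 * \<bar>x\<bar> + 1) ^ n * exp (- C) \<le> Gamma (\<beta> * real n + 1)"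
      using Gamma_lower_bound[of "\<beta> * real n" C] assms C by simp
    have pos: "0 < (2 * \<bar>x\<bar> + 1) ^ n * exp (- C)" by (simp add: add_nonneg_pos)
    have Gpos: "0 < Gamma (\<beta> * real n + 1)" by (rule less_le_trans[OF pos G])
    have "norm (x ^ n / Gamma (\<beta> * real n + 1)) = \<bar>x\<bar> ^ n / Gamma (\<beta> * real n + 1)"
      using Gpos by (simp add: power_abs abs_divide)
    also have "\<dots> \<le> \<bar>x\<bar> ^ n / ((2 * \<bar>x\<bar> + 1) ^ n * exp (- C))"
      by (rule divide_left_mono) (use G pos Gpos in \<open>auto intro!: mult_pos_pos\<close>)
    also have "\<dots> = exp C * (\<bar>x\<bar> / (2 * \<bar>x\<bar> + 1)) ^ n"
      by (simp add: power_divide exp_minus field_simps)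
    also have "\<dots> \<le> exp C * (1 / 2) ^ n"
      by (intro mult_left_mono power_mono) (auto simp: field_simps)
    finally show "norm (x ^ n / Gamma (\<beta> * real n + 1)) \<le> exp C * (1 / 2) ^ n" .
  qed
qed

text \<open>
  Up to the factor \<open>m!\<close>, the sum is the coefficient of order \<open>m\<close> of \<open>(1 - e\<^sup>X)\<^sup>n\<close>, and this power
  series is divisible by \<open>X\<^sup>n\<close>.
\<close>

lemma alternating_binomial_power_sum_eq_0:
  assumes "m < n"
  shows "(\<Sum>k\<le>n. (- 1) ^ k * real (n choose k) * real k ^ m) = 0"
proof -
  define g where "g = fps_shift 1 (1 - fps_exp (1::real))"
  have g: "1 - fps_exp (1::real) = fps_X * g"
    unfolding g_def by (intro fps_ext) (simp add: fps_X_mult_nth)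
  have "fps_nth ((1 - fps_exp (1::real)) ^ n) m = 0"
    using assms by (simp add: g power_mult_distrib fps_X_power_mult_nth)
  moreover have "(1 - fps_exp (1::real)) ^ n
      = (\<Sum>k\<le>n. of_nat (n choose k) * (- fps_exp 1) ^ k * 1 ^ (n - k))"
    using binomial_ring[of "- fps_exp (1::real)" 1 n] by simp
  moreover have "fps_nth (of_nat (n choose k) * (- fps_exp (1::real)) ^ k * 1 ^ (n - k)) m
       = (- 1) ^ k * real (n choose k) * real k ^ m / fact m" for k
  proof -
    have "of_nat c * f = fps_const (real c) * f" for c :: nat and f :: "real fps"
      by (simp add: fps_of_nat)
    then show ?thesis
      by (cases "even k") (simp_all add: fps_exp_power_mult)
  qed
  ultimately have "(\<Sum>k\<le>n. (- 1) ^ k * real (n choose k) * real k ^ m / fact m) = 0"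
    by (simp add: fps_sum_nth)
  then show ?thesis by (simp add: sum_divide_distrib[symmetric])
qed

text \<open>
  The sum is the finite difference of order \<open>n\<close> at the origin of the Laplace transform of the random
  time. On the power series it kills all terms of order below \<open>n\<close>, and in the others \<open>s \<le> 1\<close> allows
  to split off \<open>s\<^sup>n\<close>.
\<close>

lemma mittag_leffler_finite_difference:
  fixes \<beta> :: real
  assumes "0 < \<beta>"
  shows "\<exists>K. \<forall>s. 0 \<le> s \<longrightarrow> s \<le> 1 \<longrightarrow>
     (\<Sum>k\<le>n. (- 1) ^ k * real (n choose k) * mittag_leffler \<beta> (- (real k * s))) \<le> K * s ^ n"
proof -
  define G where "G m = Gamma (\<beta> * real m + 1)" for m
  have G: "G m > 0" for m using assms by (auto simp: G_def intro!: Gamma_real_pos add_nonneg_pos)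
  define b where "b m = 2 ^ n * (real n ^ m / G m)" for m
  have sb: "summable b"
    unfolding b_def G_def by (intro summable_mult summable_mittag_leffler assms)
  show ?thesis
  proof (intro exI allI impI)
    fix s :: real assume s: "0 \<le> s" "s \<le> 1"
    define D where "D m = (\<Sum>k\<le>n. (- 1) ^ k * real (n choose k) * real k ^ m)" for m
    have D0: "D m = 0" if "m < n" for m
      unfolding D_def by (rule alternating_binomial_power_sum_eq_0) fact
    have D: "\<bar>D m\<bar> \<le> 2 ^ n * real n ^ m" for m
    proof -
      have "\<bar>D m\<bar> \<le> (\<Sum>k\<le>n. \<bar>(- 1) ^ k * real (n choose k) * real k ^ m\<bar>)"
        unfolding D_def by (rule sum_abs)
      also have "\<dots> \<le> (\<Sum>k\<le>n. real (n choose k) * real n ^ m)"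
        by (intro sum_mono) (auto simp: abs_mult power_abs intro!: mult_left_mono power_mono)
      also have "\<dots> = 2 ^ n * real n ^ m"
        by (metis choose_row_sum of_nat_numeral of_nat_power of_nat_sum sum_distrib_right)
      finally show ?thesis .
    qed
    have "(\<Sum>k\<le>n. (- 1) ^ k * real (n choose k) * mittag_leffler \<beta> (- (real k * s)))
        = (\<Sum>k\<le>n. \<Sum>m. (- 1) ^ k * real (n choose k) * ((- (real k * s)) ^ m / G m))"
      unfolding mittag_leffler_def G_def
      by (intro sum.cong refl suminf_mult[symmetric] summable_mittag_leffler assms)
    also have "\<dots> = (\<Sum>m. \<Sum>k\<le>n. (- 1) ^ k * real (n choose k) * ((- (real k * s)) ^ m / G m))"
      unfolding G_def by (intro suminf_sum[symmetric] summable_mult summable_mittag_leffler assms)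
    also have "(\<lambda>m. \<Sum>k\<le>n. (- 1) ^ k * real (n choose k) * ((- (real k * s)) ^ m / G m))
        = (\<lambda>m. (- s) ^ m / G m * D m)"
      unfolding D_def sum_distrib_left
    proof (intro ext sum.cong refl)
      fix m k
      have "- (real k * s) = (- s) * real k" by simp
      then have "(- (real k * s)) ^ m = (- s) ^ m * real k ^ m"
        by (simp only: power_mult_distrib)
      then show "(- 1) ^ k * real (n choose k) * ((- (real k * s)) ^ m / G m)
          = (- s) ^ m / G m * ((- 1) ^ k * real (n choose k) * real k ^ m)"
        by simp
    qed
    also have "(\<Sum>m. (- s) ^ m / G m * D m) \<le> (\<Sum>m. s ^ n * b m)"
    proof -
      have le: "norm ((- s) ^ m / G m * D m) \<le> s ^ n * b m" for m
      proof (cases "m < n")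
        case True
        then show ?thesis using D0 s G[of m] by (simp add: b_def)
      next
        case False
        have "norm ((- s) ^ m / G m * D m) = s ^ m / G m * \<bar>D m\<bar>"
          using s G[of m] by (simp add: abs_mult power_abs)
        also have "\<dots> \<le> s ^ n / G m * (2 ^ n * real n ^ m)"
          using s G[of m] False D
          by (intro mult_mono divide_right_mono power_decreasing) (auto simp: less_imp_le)
        finally show ?thesis by (simp add: b_def)
      qed
      have "summable (\<lambda>m. (- s) ^ m / G m * D m)"
        by (rule summable_comparison_test[OF _ summable_mult[OF sb, of "s ^ n"]]) (use le in blast)
      moreover have "(- s) ^ m / G m * D m \<le> s ^ n * b m" for m
        using le[of m] unfolding real_norm_def by (rule order_trans[OF abs_ge_self])
      ultimately show ?thesis
        using summable_mult[OF sb] by (intro suminf_le)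
    qed
    finally show "(\<Sum>k\<le>n. (- 1) ^ k * real (n choose k) * mittag_leffler \<beta> (- (real k * s))) \<le> suminf b * s ^ n"
      unfolding suminf_mult[OF sb] by (simp only: mult.commute)
  qed
qed

lemma
  assumes "time_law \<beta> P"
  shows space_time_law: "space P = {0..}"
    and sets_time_law: "sets P = sets (restrict_space borel {0..})"
    and prob_space_time_law: "prob_space P"
proof -
  obtain M where M: "\<forall>\<tau>\<ge>0. 0 \<le> M \<tau>"
    "\<forall>s\<ge>0. has_bochner_integral (restrict_space lborel {0..})
                  (\<lambda>\<tau>. exp (- s * \<tau>) * M \<tau>) (mittag_leffler \<beta> (- s))"
    "P = density (restrict_space lborel {0..}) (\<lambda>\<tau>. ennreal (M \<tau>))"
    using assms unfolding time_law_def by blast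
  show "space P = {0..}" "sets P = sets (restrict_space borel {0..})"
    using M(3) by (simp_all add: space_restrict_space sets_restrict_space)
  have "mittag_leffler \<beta> 0 = 1"
    unfolding mittag_leffler_def by (subst suminf_finite[of "{0}"]) auto
  then have "has_bochner_integral (restrict_space lborel {0..}) M 1"
    using M(2)[rule_format, of 0] by simp
  then have i: "integrable (restrict_space lborel {0..}) M" "integral\<^sup>L (restrict_space lborel {0..}) M = 1"
    by (auto simp: has_bochner_integral_iff)
  have "emeasure P (space P) = (\<integral>\<^sup>+\<tau>. ennreal (M \<tau>) * indicator (space (restrict_space lborel {0..})) \<tau>
      \<partial>restrict_space lborel {0..})"
    unfolding M(3) space_density
    by (rule emeasure_density) (use i(1) in \<open>simp_all only: borel_measurable_integrable measurable_compose[OF _ measurable_ennreal] sets.top\<close>)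
  also have "\<dots> = (\<integral>\<^sup>+\<tau>. ennreal (M \<tau>) \<partial>restrict_space lborel {0..})"
    by (intro nn_integral_cong) simp
  also have "\<dots> = 1"
  proof -
    have "AE \<tau> in restrict_space lborel {0..}. 0 \<le> M \<tau>"
      using M(1) by (intro AE_I2) (simp add: space_restrict_space)
    from nn_integral_eq_integral[OF i(1) this] show ?thesis unfolding i(2) by simp
  qed
  finally show "prob_space P" by (rule prob_spaceI)
qed

lemma tendsto_difference_quotient_exp_power:
  "(\<lambda>j. ((1 - exp (- (1 / Suc j) * x)) / (1 / Suc j)) ^ n) \<longlonglongrightarrow> (x::real) ^ n"
proof (rule tendsto_power)
  have "((\<lambda>s. 1 - exp (- s * x)) has_real_derivative x) (at 0)"
    by (auto intro!: derivative_eq_intros)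
  then have "((\<lambda>s. (1 - exp (- s * x)) / s) \<longlongrightarrow> x) (at 0)"
    by (simp add: has_field_derivative_iff)
  moreover have "filterlim (\<lambda>j. 1 / real (Suc j)) (at 0) sequentially"
    unfolding filterlim_at using LIMSEQ_inverse_real_of_nat by (auto simp: inverse_eq_divide)
  ultimately show "(\<lambda>j. (1 - exp (- (1 / Suc j) * x)) / (1 / Suc j)) \<longlonglongrightarrow> x"
    by (rule filterlim_compose)
qed

text \<open>
  The finite difference of order \<open>n\<close> of the Laplace transform is the integral of
  \<open>(1 - exp (- s * \<tau>))\<^sup>n\<close>. Divided by \<open>s\<^sup>n\<close> it stays bounded as \<open>s\<close> tends to zero, and Fatou's lemma
  passes the bound on to the moment of order \<open>n\<close>.
\<close>

lemma integrable_time_law_power: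
  assumes "0 < \<beta>" "time_law \<beta> P"
  shows "integrable P (\<lambda>\<tau>. \<tau> ^ n)"
proof -
  let ?\<nu> = "restrict_space lborel {0::real..}"
  obtain M where M: "\<forall>\<tau>\<ge>0. 0 \<le> M \<tau>"
    "\<forall>s\<ge>0. has_bochner_integral ?\<nu>
                  (\<lambda>\<tau>. exp (- s * \<tau>) * M \<tau>) (mittag_leffler \<beta> (- s))"
    "P = density ?\<nu> (\<lambda>\<tau>. ennreal (M \<tau>))"
    using assms unfolding time_law_def by blast
  have Mm: "M \<in> borel_measurable ?\<nu>"
    using M(2)[rule_format, of 0] by (auto simp: has_bochner_integral_iff)
  have idm[measurable]: "(\<lambda>\<tau>. \<tau>) \<in> borel_measurable ?\<nu>"
    by (rule measurable_restrict_space1) simp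
  note [measurable] = Mm
  obtain K where K: "\<And>s. 0 \<le> s \<Longrightarrow> s \<le> 1 \<Longrightarrow>
     (\<Sum>k\<le>n. (- 1) ^ k * real (n choose k) * mittag_leffler \<beta> (- (real k * s))) \<le> K * s ^ n"
    using mittag_leffler_finite_difference[OF assms(1), of n] by blast
  define f where "f j \<tau> = ((1 - exp (- (1 / real (Suc j)) * \<tau>)) / (1 / real (Suc j))) ^ n * M \<tau>" for j \<tau>
  have bound: "(\<integral>\<^sup>+\<tau>. ennreal (f j \<tau>) \<partial>?\<nu>) \<le> ennreal K" for j
  proof -
    define s where "s = 1 / real (Suc j)"
    have s: "0 < s" "s \<le> 1" by (auto simp: s_def)
    have eq: "(1 - exp (- s * \<tau>)) ^ n * M \<tau>
       = (\<Sum>k\<le>n. (- 1) ^ k * real (n choose k) * (exp (- (real k * s) * \<tau>) * M \<tau>))" for \<tau>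
    proof -
      have "(1 - exp (- s * \<tau>)) ^ n = (\<Sum>k\<le>n. of_nat (n choose k) * (- exp (- s * \<tau>)) ^ k * 1 ^ (n - k))"
        using binomial_ring[of "- exp (- s * \<tau>)" 1 n] by simp
      also have "\<dots> = (\<Sum>k\<le>n. (- 1) ^ k * real (n choose k) * exp (- (real k * s) * \<tau>))"
        by (intro sum.cong refl) (subst power_minus, simp add: exp_of_nat_mult[symmetric] mult_ac)
      finally show ?thesis by (simp add: sum_distrib_right mult.assoc)
    qed
    have hb: "has_bochner_integral ?\<nu> (\<lambda>\<tau>. (1 - exp (- s * \<tau>)) ^ n * M \<tau>)
        (\<Sum>k\<le>n. (- 1) ^ k * real (n choose k) * mittag_leffler \<beta> (- (real k * s)))"
      unfolding eq using M(2) s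
      by (intro has_bochner_integral_sum has_bochner_integral_mult_right) auto
    have nn: "0 \<le> (1 - exp (- s * \<tau>)) ^ n * M \<tau>" if "\<tau> \<in> space ?\<nu>" for \<tau>
      using that M(1) s by (auto simp: space_restrict_space intro!: mult_nonneg_nonneg zero_le_power)
    have "(\<integral>\<^sup>+\<tau>. ennreal (f j \<tau>) \<partial>?\<nu>)
        = (\<integral>\<^sup>+\<tau>. ennreal (1 / s ^ n) * ennreal ((1 - exp (- s * \<tau>)) ^ n * M \<tau>) \<partial>?\<nu>)"
      unfolding f_def s_def[symmetric] using s nn
      by (intro nn_integral_cong) (simp add: ennreal_mult[symmetric] power_divide)
    also have "\<dots> = ennreal (1 / s ^ n) * (\<integral>\<^sup>+\<tau>. ennreal ((1 - exp (- s * \<tau>)) ^ n * M \<tau>) \<partial>?\<nu>)"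
      by (rule nn_integral_cmult) measurable
    also have "(\<integral>\<^sup>+\<tau>. ennreal ((1 - exp (- s * \<tau>)) ^ n * M \<tau>) \<partial>?\<nu>)
      = ennreal (\<Sum>k\<le>n. (- 1) ^ k * real (n choose k) * mittag_leffler \<beta> (- (real k * s)))"
      by (subst nn_integral_eq_integral[OF integrable.intros[OF hb] AE_I2[OF nn]])
         (simp_all only: has_bochner_integral_integral_eq[OF hb])
    also have "ennreal (1 / s ^ n) * \<dots> \<le> ennreal (1 / s ^ n) * ennreal (K * s ^ n)"
      using K[of s] s by (intro mult_left_mono ennreal_leI) auto
    also have "\<dots> = ennreal K"
      using s by (simp add: ennreal_mult'[symmetric])
    finally show ?thesis .
  qed
  have "(\<integral>\<^sup>+\<tau>. ennreal (norm (\<tau> ^ n)) \<partial>P) = (\<integral>\<^sup>+\<tau>. ennreal (\<tau> ^ n * M \<tau>) \<partial>?\<nu>)"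
    unfolding M(3)
  proof (subst nn_integral_density)
    show "(\<integral>\<^sup>+\<tau>. ennreal (M \<tau>) * ennreal (norm (\<tau> ^ n)) \<partial>?\<nu>) = (\<integral>\<^sup>+\<tau>. ennreal (\<tau> ^ n * M \<tau>) \<partial>?\<nu>)"
    proof (rule nn_integral_cong)
      fix \<tau> :: real assume "\<tau> \<in> space ?\<nu>"
      then have "0 \<le> \<tau>" by (simp add: space_restrict_space)
      then show "ennreal (M \<tau>) * ennreal (norm (\<tau> ^ n)) = ennreal (\<tau> ^ n * M \<tau>)"
        using M(1) by (simp add: ennreal_mult'[symmetric] mult.commute)
    qed
  qed measurable
  also have "\<dots> = (\<integral>\<^sup>+\<tau>. liminf (\<lambda>j. ennreal (f j \<tau>)) \<partial>?\<nu>)"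
  proof (intro nn_integral_cong lim_imp_Liminf[symmetric] tendsto_ennrealI)
    show "(\<lambda>j. f j \<tau>) \<longlonglongrightarrow> \<tau> ^ n * M \<tau>" for \<tau>
      unfolding f_def by (intro tendsto_mult_right tendsto_difference_quotient_exp_power)
  qed auto
  also have "\<dots> \<le> liminf (\<lambda>j. \<integral>\<^sup>+\<tau>. ennreal (f j \<tau>) \<partial>?\<nu>)"
    by (rule nn_integral_liminf) (unfold f_def, measurable)
  also have "\<dots> \<le> ennreal K"
    using Liminf_mono[of "\<lambda>j. \<integral>\<^sup>+\<tau>. ennreal (f j \<tau>) \<partial>?\<nu>" "\<lambda>_. ennreal K" sequentially] bound
    by (simp add: Liminf_const)
  finally have "(\<integral>\<^sup>+\<tau>. ennreal (norm (\<tau> ^ n)) \<partial>P) < \<infinity>"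
    by (rule le_less_trans) simp
  moreover have "(\<lambda>\<tau>. \<tau> ^ n) \<in> borel_measurable P"
    unfolding M(3) by measurable
  ultimately show ?thesis by (simp add: integrable_iff_bounded)
qed

section \<open>Joint laws are determined by cosine integrals\<close>

text \<open>
  A nonnegative weight of positive mass turns the integrals of functions of \<open>X\<close> into expectations
  under a law on the real line, to which theorems on characteristic functions apply.
\<close>

lemma weighted_distribution:
  fixes X f :: "'a \<Rightarrow> real"
  assumes [measurable]: "X \<in> borel_measurable M" "f \<in> borel_measurable M"
    and nonneg: "\<And>x. 0 \<le> f x" and int: "integrable M f" and c: "c = integral\<^sup>L M f" "0 < c"
  defines "\<mu> \<equiv> distr (density M (\<lambda>x. ennreal (f x / c))) borel X"
  shows "real_distribution \<mu>"
    and "\<phi> \<in> borel_measurable borel \<Longrightarrow> integral\<^sup>L \<mu> \<phi> = (\<integral>x. f x * \<phi> (X x) \<partial>M) / c"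
proof -
  have "emeasure (density M (\<lambda>x. ennreal (f x / c))) (space M) = (\<integral>\<^sup>+x. ennreal (f x / c) \<partial>M)"
    by (subst emeasure_density) (auto intro!: nn_integral_cong)
  also have "\<dots> = ennreal (integral\<^sup>L M f / c)"
    using nonneg int c(2) by (subst nn_integral_eq_integral) auto
  also have "\<dots> = 1" using c by simp
  finally interpret prob_space "density M (\<lambda>x. ennreal (f x / c))"
    by (intro prob_spaceI) simp
  show "real_distribution \<mu>"
    unfolding \<mu>_def by (rule real_distribution_distr) simp
  assume [measurable]: "\<phi> \<in> borel_measurable borel"
  have "integral\<^sup>L \<mu> \<phi> = (\<integral>x. \<phi> (X x) \<partial>density M (\<lambda>x. ennreal (f x / c)))"
    unfolding \<mu>_def by (rule integral_distr) auto
  also have "\<dots> = (\<integral>x. (f x / c) *\<^sub>R \<phi> (X x) \<partial>M)"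
    using nonneg c(2) by (intro integral_density) auto
  also have "\<dots> = (\<integral>x. (f x * \<phi> (X x)) / c \<partial>M)" by simp
  finally show "integral\<^sup>L \<mu> \<phi> = (\<integral>x. f x * \<phi> (X x) \<partial>M) / c" by simp
qed

lemma char_eq_cos_integrals:
  assumes "real_distribution \<mu>"
  shows "Re (char \<mu> a) = (\<integral>x. cos (a * x + 0) \<partial>\<mu>)"
    and "Im (char \<mu> a) = (\<integral>x. cos (a * x + (- pi / 2)) \<partial>\<mu>)"
proof -
  interpret real_distribution \<mu> by fact
  have "integrable \<mu> (\<lambda>x. iexp (a * x))" by (rule integrable_iexp) auto
  from integral_Re[OF this] integral_Im[OF this]
  show "Re (char \<mu> a) = (\<integral>x. cos (a * x + 0) \<partial>\<mu>)"
    and "Im (char \<mu> a) = (\<integral>x. cos (a * x + (- pi / 2)) \<partial>\<mu>)"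
    by (simp_all add: char_def Re_exp Im_exp cos_diff)
qed

text \<open>
  The cosines with all phases contain the real and the imaginary part of the characteristic function,
  so that this is Levy's uniqueness theorem for the weighted laws of \<open>X\<close> and \<open>Y\<close>. The weights
  are what allows to treat several coordinates one after the other.
\<close>

lemma integrals_eq_of_cos_integrals:
  fixes X f :: "'a \<Rightarrow> real" and Y g :: "'b \<Rightarrow> real"
  assumes M: "X \<in> borel_measurable M" "f \<in> borel_measurable M" "\<And>x. 0 \<le> f x" "integrable M f"
    and N: "Y \<in> borel_measurable N" "g \<in> borel_measurable N" "\<And>y. 0 \<le> g y" "integrable N g"
    and eq: "\<And>a \<theta>. (\<integral>x. f x * cos (a * X x + \<theta>) \<partial>M) = (\<integral>y. g y * cos (a * Y y + \<theta>) \<partial>N)"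
    and B: "B \<in> sets borel"
  shows "(\<integral>x. f x * indicator B (X x) \<partial>M) = (\<integral>y. g y * indicator B (Y y) \<partial>N)"
proof -
  define c where "c = integral\<^sup>L M f"
  have cN: "c = integral\<^sup>L N g" using eq[of 0 0] by (simp add: c_def)
  show ?thesis
  proof (cases "c = 0")
    case True
    have "AE x in M. f x = 0"
      using integral_nonneg_eq_0_iff_AE[OF M(4)] M(3) True by (simp add: c_def)
    then have "AE x in M. f x * indicator B (X x) = 0" by eventually_elim simp
    moreover have "AE y in N. g y = 0"
      using integral_nonneg_eq_0_iff_AE[OF N(4)] N(3) True by (simp add: cN)
    then have "AE y in N. g y * indicator B (Y y) = 0" by eventually_elim simp
    ultimately show ?thesis by (simp add: integral_eq_zero_AE)
  next
    case False
    then have c: "c > 0" using M(3) by (simp add: c_def less_le integral_nonneg_AE)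
    define \<mu> where "\<mu> = distr (density M (\<lambda>x. ennreal (f x / c))) borel X"
    define \<nu> where "\<nu> = distr (density N (\<lambda>x. ennreal (g x / c))) borel Y"
    note \<mu> = weighted_distribution[OF M(1,2,3,4) c_def c, folded \<mu>_def]
    note \<nu> = weighted_distribution[OF N(1,2,3,4) cN c, folded \<nu>_def]
    have "char \<mu> = char \<nu>"
      by (intro ext complex_eqI) (simp_all add: char_eq_cos_integrals[OF \<mu>(1)]
          char_eq_cos_integrals[OF \<nu>(1)] \<mu>(2) \<nu>(2) eq[of _ "- pi / 2", simplified] eq[of _ 0, simplified])
    then have "\<mu> = \<nu>" by (rule Levy_uniqueness[OF \<mu>(1) \<nu>(1)])
    moreover have "integral\<^sup>L \<mu> (indicator B) = (\<integral>x. f x * indicator B (X x) \<partial>M) / c"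
      by (rule \<mu>(2)) (use B in simp)
    moreover have "integral\<^sup>L \<nu> (indicator B) = (\<integral>x. g x * indicator B (Y x) \<partial>N) / c"
      by (rule \<nu>(2)) (use B in simp)
    ultimately show ?thesis using c by simp
  qed
qed

lemma sum_add_to_coefficient:
  fixes x :: "'i \<Rightarrow> real"
  assumes "finite I" "u \<in> I"
  shows "(\<Sum>i\<in>I. (s * a i + (if i = u then b else 0)) * x i) = s * (\<Sum>i\<in>I. a i * x i) + b * x u"
proof -
  have "(\<Sum>i\<in>I. (s * a i + (if i = u then b else 0)) * x i)
      = (\<Sum>i\<in>I. s * (a i * x i) + (if i = u then b * x u else 0))"
    by (intro sum.cong refl) (simp add: algebra_simps)
  then show ?thesis using assms by (simp add: sum.distrib sum_distrib_left)
qed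

lemma integrable_mult_bounded:
  fixes f \<phi> :: "'a \<Rightarrow> real"
  assumes f: "integrable M f" and [measurable]: "\<phi> \<in> borel_measurable M" and b: "\<And>x. \<bar>\<phi> x\<bar> \<le> B"
  shows "integrable M (\<lambda>x. f x * \<phi> x)"
proof (rule Bochner_Integration.integrable_bound[OF integrable_mult_right[OF f, of B]])
  show "AE x in M. norm (f x * \<phi> x) \<le> norm (B * f x)"
  proof (rule AE_I2)
    fix x
    have "\<bar>\<phi> x\<bar> \<le> \<bar>B\<bar>" using b[of x] by linarith
    then show "norm (f x * \<phi> x) \<le> norm (B * f x)"
      by (simp add: abs_mult mult.commute[of "\<bar>B\<bar>"] mult_left_mono)
  qed
qed (use f in measurable)

text \<open>
  A product of cosines is a sum of cosines of the sum and the difference of the phases, so that testing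
  with the nonnegative weight \<open>1 + cos\<close> leads back to integrals with a single cosine.
\<close>

lemma
  fixes P S U :: "'a \<Rightarrow> real"
  assumes P: "integrable M P" and [measurable]: "S \<in> borel_measurable M" "U \<in> borel_measurable M"
  shows integrable_weight_1_plus_cos: "integrable M (\<lambda>x. P x * (1 + cos (S x + \<theta>)))"
    and integral_1_plus_cos_mult_cos:
      "(\<integral>x. P x * (1 + cos (S x + \<theta>)) * cos (b * U x + \<phi>) \<partial>M)
        = (\<integral>x. P x * cos (0 * S x + b * U x + \<phi>) \<partial>M)
          + (\<integral>x. P x * cos (1 * S x + b * U x + (\<theta> + \<phi>)) \<partial>M) / 2
          + (\<integral>x. P x * cos ((- 1) * S x + b * U x + (\<phi> - \<theta>)) \<partial>M) / 2"
    and integral_1_plus_cos_mult_indicator: "B \<in> sets borel \<Longrightarrow>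
      (\<integral>x. P x * (1 + cos (S x + \<theta>)) * indicator B (U x) \<partial>M)
        = (\<integral>x. P x * indicator B (U x) \<partial>M) + (\<integral>x. P x * (indicator B (U x) * cos (S x + \<theta>)) \<partial>M)"
proof -
  have i: "integrable M (\<lambda>x. P x * \<phi> x)" if "\<phi> \<in> borel_measurable M" "\<And>x. \<bar>\<phi> x\<bar> \<le> 1" for \<phi>
    using integrable_mult_bounded[OF P that] .
  show "integrable M (\<lambda>x. P x * (1 + cos (S x + \<theta>)))"
    using i[of "\<lambda>_. 1"] i[of "\<lambda>x. cos (S x + \<theta>)"] by (simp add: distrib_left)
  have prod: "(1 + cos (s + \<theta>)) * cos (b * r + \<phi>) = cos (0 * s + b * r + \<phi>)
      + cos (1 * s + b * r + (\<theta> + \<phi>)) / 2 + cos ((- 1) * s + b * r + (\<phi> - \<theta>)) / 2" for s r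
  proof -
    have "cos (s + \<theta>) * cos (b * r + \<phi>)
        = (cos ((s + \<theta>) - (b * r + \<phi>)) + cos ((s + \<theta>) + (b * r + \<phi>))) / 2"
      by (rule cos_times_cos)
    moreover have "cos ((s + \<theta>) - (b * r + \<phi>)) = cos ((- 1) * s + b * r + (\<phi> - \<theta>))"
      using cos_minus[of "(s + \<theta>) - (b * r + \<phi>)"] by (simp add: algebra_simps)
    ultimately show ?thesis by (simp add: algebra_simps add_divide_distrib)
  qed
  have "(\<integral>x. P x * (1 + cos (S x + \<theta>)) * cos (b * U x + \<phi>) \<partial>M)
      = (\<integral>x. P x * cos (0 * S x + b * U x + \<phi>) + P x * cos (1 * S x + b * U x + (\<theta> + \<phi>)) / 2
          + P x * cos ((- 1) * S x + b * U x + (\<phi> - \<theta>)) / 2 \<partial>M)"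
    unfolding mult.assoc prod by (simp add: distrib_left)
  also have "\<dots> = (\<integral>x. P x * cos (0 * S x + b * U x + \<phi>) \<partial>M)
          + (\<integral>x. P x * cos (1 * S x + b * U x + (\<theta> + \<phi>)) \<partial>M) / 2
          + (\<integral>x. P x * cos ((- 1) * S x + b * U x + (\<phi> - \<theta>)) \<partial>M) / 2"
    by (subst Bochner_Integration.integral_add Bochner_Integration.integral_add,
         auto intro!: i Bochner_Integration.integrable_add integrable_divide)+
  finally show "(\<integral>x. P x * (1 + cos (S x + \<theta>)) * cos (b * U x + \<phi>) \<partial>M) = \<dots>" .
  assume [measurable]: "B \<in> sets borel"
  show "(\<integral>x. P x * (1 + cos (S x + \<theta>)) * indicator B (U x) \<partial>M)
      = (\<integral>x. P x * indicator B (U x) \<partial>M) + (\<integral>x. P x * (indicator B (U x) * cos (S x + \<theta>)) \<partial>M)"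
  proof (subst Bochner_Integration.integral_add[symmetric])
    show "integrable M (\<lambda>x. P x * indicator B (U x))"
      "integrable M (\<lambda>x. P x * (indicator B (U x) * cos (S x + \<theta>)))"
      by (rule i; auto simp: indicator_def)+
  qed (simp add: algebra_simps)
qed

text \<open>
  By induction on \<open>J\<close>, one coordinate after the other is taken out of the phase and put into an
  indicator. Uniqueness in dimension one requires nonnegative weights; therefore the new coordinate is
  tested against the weight \<open>1 + cos\<close>, and the contribution of the summand \<open>1\<close> is removed afterwards.
\<close>

lemma joint_law_eq_of_cos_integrals:
  fixes X :: "'i \<Rightarrow> 'a \<Rightarrow> real" and Y :: "'i \<Rightarrow> 'b \<Rightarrow> real"
  assumes "prob_space M" "prob_space N"
    and X: "\<And>i. X i \<in> borel_measurable M" and Y: "\<And>i. Y i \<in> borel_measurable N"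
    and fin: "finite I"
    and eq: "\<And>a \<theta>. (\<integral>x. cos ((\<Sum>i\<in>I. a i * X i x) + \<theta>) \<partial>M) = (\<integral>y. cos ((\<Sum>i\<in>I. a i * Y i y) + \<theta>) \<partial>N)"
    and B: "\<And>i. B i \<in> sets borel"
    and "J \<subseteq> I"
  shows "(\<integral>x. (\<Prod>j\<in>J. indicator (B j) (X j x)) * cos ((\<Sum>i\<in>I. a i * X i x) + \<theta>) \<partial>M)
       = (\<integral>y. (\<Prod>j\<in>J. indicator (B j) (Y j y)) * cos ((\<Sum>i\<in>I. a i * Y i y) + \<theta>) \<partial>N)"
proof -
  interpret M: prob_space M by fact
  interpret N: prob_space N by fact
  note [measurable] = X Y B
  have "finite J" using fin \<open>J \<subseteq> I\<close> by (rule finite_subset[rotated])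
  then show ?thesis using \<open>J \<subseteq> I\<close>
  proof (induction J arbitrary: a \<theta> rule: finite_induct)
    case empty
    then show ?case using eq by simp
  next
    case (insert u J)
    define PX where "PX x = (\<Prod>j\<in>J. indicator (B j) (X j x) :: real)" for x
    define PY where "PY y = (\<Prod>j\<in>J. indicator (B j) (Y j y) :: real)" for y
    define SX where "SX a x = (\<Sum>i\<in>I. a i * X i x)" for a x
    define SY where "SY a y = (\<Sum>i\<in>I. a i * Y i y)" for a y
    have m[measurable]: "PX \<in> borel_measurable M" "PY \<in> borel_measurable N"
      "\<And>a. SX a \<in> borel_measurable M" "\<And>a. SY a \<in> borel_measurable N"
      unfolding PX_def[abs_def] PY_def[abs_def] SX_def[abs_def] SY_def[abs_def] by measurable
    have P01: "0 \<le> PX x" "PX x \<le> 1" "0 \<le> PY y" "PY y \<le> 1" for x y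
      unfolding PX_def PY_def by (auto intro!: prod_nonneg prod_le_1)
    have i: "integrable M PX" "integrable N PY"
      using P01 by (auto intro!: M.integrable_const_bound[where B = 1] N.integrable_const_bound[where B = 1])
    have IH: "(\<integral>x. PX x * cos (SX a x + \<theta>) \<partial>M) = (\<integral>y. PY y * cos (SY a y + \<theta>) \<partial>N)" for a \<theta>
      using insert by (simp add: PX_def PY_def SX_def SY_def)
    have u: "u \<in> I" using insert by simp
    \<comment> \<open>adding a multiple of the new coordinate to the phase stays in the class\<close>
    have IH': "(\<integral>x. PX x * cos (s * SX a x + b * X u x + \<theta>) \<partial>M)
        = (\<integral>y. PY y * cos (s * SY a y + b * Y u y + \<theta>) \<partial>N)" for s a b \<theta>
      using IH[of "\<lambda>i. s * a i + (if i = u then b else 0)" \<theta>]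
      by (simp only: SX_def SY_def sum_add_to_coefficient[OF fin u])
    have step: "(\<integral>x. PX x * (1 + cos (SX a x + \<theta>)) * indicator (B u) (X u x) \<partial>M)
        = (\<integral>y. PY y * (1 + cos (SY a y + \<theta>)) * indicator (B u) (Y u y) \<partial>N)" for a \<theta>
    proof (rule integrals_eq_of_cos_integrals)
      have nn: "0 \<le> 1 + cos r" for r :: real using cos_ge_minus_one[of r] by linarith
      show "0 \<le> PX x * (1 + cos (SX a x + \<theta>))" for x using P01 nn by simp
      show "0 \<le> PY y * (1 + cos (SY a y + \<theta>))" for y using P01 nn by simp
      show "integrable M (\<lambda>x. PX x * (1 + cos (SX a x + \<theta>)))"
        "integrable N (\<lambda>y. PY y * (1 + cos (SY a y + \<theta>)))"
        using integrable_weight_1_plus_cos[OF i(1) m(3) m(3)] integrable_weight_1_plus_cos[OF i(2) m(4) m(4)] .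
      show "(\<integral>x. PX x * (1 + cos (SX a x + \<theta>)) * cos (b * X u x + \<phi>) \<partial>M)
          = (\<integral>y. PY y * (1 + cos (SY a y + \<theta>)) * cos (b * Y u y + \<phi>) \<partial>N)" for b \<phi>
        unfolding integral_1_plus_cos_mult_cos[OF i(1) m(3) X] integral_1_plus_cos_mult_cos[OF i(2) m(4) Y] IH' ..
    qed measurable
    note splitX = integral_1_plus_cos_mult_indicator[OF i(1) m(3) X B]
      and splitY = integral_1_plus_cos_mult_indicator[OF i(2) m(4) Y B]
    have "(\<integral>x. PX x * indicator (B u) (X u x) \<partial>M) = (\<integral>x. PY x * indicator (B u) (Y u x) \<partial>N)"
      using step[of "\<lambda>_. 0" 0] unfolding splitX splitY by (simp add: SX_def SY_def)
    then have "(\<integral>x. PX x * (indicator (B u) (X u x) * cos (SX a x + \<theta>)) \<partial>M)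
        = (\<integral>x. PY x * (indicator (B u) (Y u x) * cos (SY a x + \<theta>)) \<partial>N)"
      using step[of a \<theta>] unfolding splitX splitY by simp
    then show ?case
      using insert by (simp add: PX_def PY_def SX_def SY_def mult_ac)
  qed
qed

text \<open>
  A form of the Cramer--Wold theorem: the law of a family of real variables is determined by
  the laws of its finite linear combinations.
\<close>

proposition distr_eq_of_cos_integrals:
  fixes X :: "'i \<Rightarrow> 'a \<Rightarrow> real" and Y :: "'i \<Rightarrow> 'b \<Rightarrow> real"
  assumes M: "prob_space M" and N: "prob_space N"
    and X[measurable]: "\<And>i. X i \<in> borel_measurable M" and Y[measurable]: "\<And>i. Y i \<in> borel_measurable N"
    and eq: "\<And>J a \<theta>. finite J \<Longrightarrow>
      (\<integral>x. cos ((\<Sum>i\<in>J. a i * X i x) + \<theta>) \<partial>M) = (\<integral>y. cos ((\<Sum>i\<in>J. a i * Y i y) + \<theta>) \<partial>N)"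
  shows "distr M (\<Pi>\<^sub>M i\<in>UNIV. borel) (\<lambda>x i. X i x) = distr N (\<Pi>\<^sub>M i\<in>UNIV. borel) (\<lambda>y i. Y i y)"
proof (rule measure_eqI_PiM_infinite)
  let ?\<Pi> = "\<Pi>\<^sub>M i\<in>UNIV. borel :: real measure"
  interpret M: prob_space M by fact
  interpret N: prob_space N by fact
  have mX[measurable]: "(\<lambda>x i. X i x) \<in> M \<rightarrow>\<^sub>M ?\<Pi>"
    and mY[measurable]: "(\<lambda>y i. Y i y) \<in> N \<rightarrow>\<^sub>M ?\<Pi>"
    by (auto intro!: measurable_PiM_single' simp: space_PiM)
  show "finite_measure (distr M ?\<Pi> (\<lambda>x i. X i x))"
    using M.prob_space_distr[OF mX] by (simp add: prob_space_def)
  fix B :: "'i \<Rightarrow> real set" and J :: "'i set"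
  assume J: "finite J" "\<And>i. i \<in> J \<Longrightarrow> B i \<in> sets borel"
  define B' where "B' i = (if i \<in> J then B i else {})" for i
  have B': "B' i \<in> sets borel" for i using J by (simp add: B'_def)
  let ?S = "{f :: 'i \<Rightarrow> real. \<forall>j\<in>J. f j \<in> B' j}"
  note [measurable] = B'
  have S: "prod_emb UNIV (\<lambda>i. borel) J (Pi\<^sub>E J B) = ?S"
    by (auto simp: prod_emb_def B'_def PiE_def Pi_def)
  have ind: "(\<Prod>j\<in>J. indicator (B' j) (f j)) = (indicator ?S f :: real)" for f
    using J(1) by (auto simp: indicator_def prod_zero_iff)
  have mS: "?S \<in> sets ?\<Pi>"
    unfolding S[symmetric] using J by (intro sets_PiM_I) auto
  have "(\<integral>x. (\<Prod>j\<in>J. indicator (B' j) (X j x)) * cos ((\<Sum>i\<in>J. 0 * X i x) + 0) \<partial>M)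
       = (\<integral>y. (\<Prod>j\<in>J. indicator (B' j) (Y j y)) * cos ((\<Sum>i\<in>J. 0 * Y i y) + 0) \<partial>N)"
    by (rule joint_law_eq_of_cos_integrals) (use M N X Y J eq B' in auto)
  then have "(\<integral>x. indicator ?S (\<lambda>i. X i x) \<partial>M)
       = (\<integral>y. indicator ?S (\<lambda>i. Y i y) \<partial>N :: real)"
    using ind[of "\<lambda>i. X i _"] ind[of "\<lambda>i. Y i _"] by simp
  moreover have "(\<integral>x. indicator ?S (\<lambda>i. X i x) \<partial>M)
      = measure (distr M ?\<Pi> (\<lambda>x i. X i x)) ?S"
    using integral_distr[OF mX, of "indicator ?S :: _ \<Rightarrow> real"] mS by simp
  moreover have "(\<integral>x. indicator ?S (\<lambda>i. Y i x) \<partial>N)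
      = measure (distr N ?\<Pi> (\<lambda>x i. Y i x)) ?S"
    using integral_distr[OF mY, of "indicator ?S :: _ \<Rightarrow> real"] mS by simp
  ultimately show "emeasure (distr M ?\<Pi> (\<lambda>x i. X i x)) (prod_emb UNIV (\<lambda>i. borel) J (Pi\<^sub>E J B))
     = emeasure (distr N ?\<Pi> (\<lambda>y i. Y i y)) (prod_emb UNIV (\<lambda>i. borel) J (Pi\<^sub>E J B))"
    unfolding S using M.prob_space_distr[OF mX] N.prob_space_distr[OF mY]
    by (simp add: finite_measure.emeasure_eq_measure prob_space_def)
qed simp_all

section \<open>Closability of the derivative for the standard normal law\<close>

abbreviation std_gauss :: "real measure" where
  "std_gauss \<equiv> density lborel (\<lambda>x. ennreal (std_normal_density x))"

lemma prob_space_std_gauss: "prob_space std_gauss"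
  by (rule prob_space_normal_density) simp

lemma has_real_derivative_std_normal_density:
  "(std_normal_density has_real_derivative - x * std_normal_density x) (at x)"
  unfolding normal_density_def
  by (rule derivative_eq_intros refl | simp)+

lemma integral_std_gauss:
  assumes "f \<in> borel_measurable borel"
  shows "(\<integral>x. f x \<partial>std_gauss) = (\<integral>x. std_normal_density x * f x \<partial>lborel)"
  using assms by (subst integral_density) auto

text \<open>
  Against Lebesgue measure the integrand is the derivative of \<open>G\<close> times the normal density, and this
  product vanishes at both infinities.
\<close>

lemma integral_std_gauss_derivative:
  fixes G G' :: "real \<Rightarrow> real"
  assumes deriv: "\<And>x. (G has_real_derivative G' x) (at x)"
    and cont: "continuous_on UNIV G'"
    and bG: "\<And>x. \<bar>G x\<bar> \<le> B" and bD: "\<And>x. \<bar>G' x - x * G x\<bar> \<le> B"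
  shows "(\<integral>x. G' x - x * G x \<partial>std_gauss) = 0"
proof -
  interpret prob_space std_gauss by (rule prob_space_std_gauss)
  let ?n = std_normal_density
  have cG: "continuous_on UNIV G"
    using deriv by (meson DERIV_isCont continuous_at_imp_continuous_on)
  have [measurable]: "G \<in> borel_measurable borel" "G' \<in> borel_measurable borel"
    using cG cont by (auto intro: borel_measurable_continuous_onI)
  define F where "F x = ?n x * G x" for x
  define f where "f x = ?n x * (G' x - x * G x)" for x
  have dF: "(F has_real_derivative f x) (at x)" for x
    unfolding F_def[abs_def] f_def
    by (rule derivative_eq_intros has_real_derivative_std_normal_density deriv refl)+ (simp add: algebra_simps)
  have cn: "continuous_on UNIV ?n"
    using has_real_derivative_std_normal_density by (meson DERIV_isCont continuous_at_imp_continuous_on)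
  have cf: "continuous_on UNIV f"
    unfolding f_def by (intro continuous_intros cG cont cn)
  have "integrable std_gauss (\<lambda>x. G' x - x * G x)"
    by (rule integrable_const_bound[where B = B]) (use bD in auto)
  then have int: "integrable lborel f"
    by (subst (asm) integrable_density) (auto simp: f_def[abs_def])
  have lim: "(F \<longlongrightarrow> 0) L" if L: "(?n \<longlongrightarrow> 0) L" for L
  proof (rule Lim_null_comparison)
    show "\<forall>\<^sub>F x in L. norm (F x) \<le> ?n x * B"
      by (intro always_eventually allI) (use bG in \<open>auto simp: F_def abs_mult intro!: mult_left_mono\<close>)
    show "((\<lambda>x. ?n x * B) \<longlongrightarrow> 0) L" by (rule tendsto_mult_left_zero[OF L])
  qed
  have top: "(?n \<longlongrightarrow> 0) at_top" and bot: "(?n \<longlongrightarrow> 0) at_bot"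
    unfolding normal_density_def by real_asymp+
  have "(LBINT x=-\<infinity>..\<infinity>. f x) = 0 - 0"
  proof (rule interval_integral_FTC_integrable)
    show "(F has_vector_derivative f x) (at x)" for x
      using dF by (simp add: has_real_derivative_iff_has_vector_derivative)
    show "isCont f x" for x using cf by (simp add: continuous_on_eq_continuous_at)
    show "set_integrable lborel (einterval (- \<infinity>) \<infinity>) f"
      using int by (simp add: set_integrable_def)
    show "((F \<circ> real_of_ereal) \<longlongrightarrow> 0) (at_right (- \<infinity>))"
      unfolding ereal_tendsto_simps by (rule lim[OF bot])
    show "((F \<circ> real_of_ereal) \<longlongrightarrow> 0) (at_left \<infinity>)"
      unfolding ereal_tendsto_simps by (rule lim[OF top])
  qed simp
  then have "(\<integral>x. f x \<partial>lborel) = 0"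
    by (simp add: interval_lebesgue_integral_def set_lebesgue_integral_def)
  then show ?thesis by (subst integral_std_gauss) (auto simp: f_def)
qed

lemma abs_mult_exp_neg_le_1: "\<bar>x\<bar> * exp (- x\<^sup>2 / 2) \<le> (1 :: real)"
proof -
  have "\<bar>x\<bar> \<le> 1 + x\<^sup>2 / 2"
    using sum_squares_bound[of "\<bar>x\<bar>" 1] by simp
  also have "\<dots> \<le> exp (x\<^sup>2 / 2)" by (rule exp_ge_add_one_self)
  finally have "\<bar>x\<bar> * exp (- x\<^sup>2 / 2) \<le> exp (x\<^sup>2 / 2) * exp (- x\<^sup>2 / 2)"
    by (rule mult_right_mono) simp
  then show ?thesis by (simp add: exp_add[symmetric])
qed

lemma tendsto_integral_mult_bounded:
  fixes u :: "nat \<Rightarrow> 'a \<Rightarrow> real"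
  assumes [measurable]: "\<And>n. u n \<in> borel_measurable M" "\<phi> \<in> borel_measurable M"
    and bound: "\<And>x. \<bar>\<phi> x\<bar> \<le> B" and int: "\<And>n. integrable M (u n)"
    and lim: "(\<lambda>n. \<integral>\<^sup>+x. ennreal \<bar>u n x\<bar> \<partial>M) \<longlonglongrightarrow> 0"
  shows "(\<lambda>n. \<integral>x. u n x * \<phi> x \<partial>M) \<longlonglongrightarrow> 0"
proof (rule Lim_null_comparison)
  have "(\<integral>\<^sup>+x. ennreal \<bar>u n x\<bar> \<partial>M) = ennreal (\<integral>x. \<bar>u n x\<bar> \<partial>M)" for n
    by (rule nn_integral_eq_integral) (use int in auto)
  then have "(\<lambda>n. ennreal (\<integral>x. \<bar>u n x\<bar> \<partial>M)) \<longlonglongrightarrow> ennreal 0" using lim by simp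
  then have "(\<lambda>n. \<integral>x. \<bar>u n x\<bar> \<partial>M) \<longlonglongrightarrow> 0"
    by (subst (asm) tendsto_ennreal_iff) (auto intro!: always_eventually)
  then show "(\<lambda>n. B * (\<integral>x. \<bar>u n x\<bar> \<partial>M)) \<longlonglongrightarrow> 0" by (rule tendsto_mult_right_zero)
  show "\<forall>\<^sub>F n in sequentially. norm (\<integral>x. u n x * \<phi> x \<partial>M) \<le> B * (\<integral>x. \<bar>u n x\<bar> \<partial>M)"
  proof (intro always_eventually allI)
    fix n
    have B: "0 \<le> B" using bound[of undefined] by linarith
    have "norm (\<integral>x. u n x * \<phi> x \<partial>M) \<le> (\<integral>x. norm (u n x * \<phi> x) \<partial>M)" by (rule integral_norm_bound)
    also have "\<dots> \<le> (\<integral>x. B * \<bar>u n x\<bar> \<partial>M)"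
    proof (rule integral_mono')
      show "norm (u n x * \<phi> x) \<le> B * \<bar>u n x\<bar>" for x
        using mult_right_mono[OF bound[of x], of "\<bar>u n x\<bar>"] by (simp add: abs_mult mult.commute)
    qed (use int B in auto)
    finally show "norm (\<integral>x. u n x * \<phi> x \<partial>M) \<le> B * (\<integral>x. \<bar>u n x\<bar> \<partial>M)" by simp
  qed
qed

text \<open>
  The test functions are \<open>\<psi> x = exp (- x\<^sup>2 / 2) * cos (a * x + \<theta>)\<close>. The formal adjoint of the
  derivative for the normal law maps \<open>\<psi>\<close> to \<open>x * \<psi> x - \<psi>' x\<close>; the Gaussian factor in \<open>\<psi>\<close> makes
  this bounded in spite of the factor \<open>x\<close>, so that convergence in \<open>L\<^sup>1\<close> suffices to conclude that
  \<open>z\<close> is orthogonal to \<open>\<psi>\<close>. As \<open>a\<close> and \<open>\<theta>\<close> are arbitrary, the positive and the negative part of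
  \<open>z x * exp (- x\<^sup>2 / 2)\<close> have the same integral over every Borel set, hence coincide and vanish.
\<close>

proposition gaussian_derivative_closable:
  fixes g g' :: "nat \<Rightarrow> real \<Rightarrow> real" and z :: "real \<Rightarrow> real"
  assumes deriv: "\<And>n x. (g n has_real_derivative g' n x) (at x)"
    and cont: "\<And>n. continuous_on UNIV (g' n)"
    and bg: "\<And>n x. \<bar>g n x\<bar> \<le> b n" and bg': "\<And>n x. \<bar>g' n x\<bar> \<le> b n"
    and z[measurable]: "z \<in> borel_measurable borel"
    and lim0: "(\<lambda>n. \<integral>\<^sup>+x. ennreal \<bar>g n x\<bar> \<partial>std_gauss) \<longlonglongrightarrow> 0"
    and lim1: "(\<lambda>n. \<integral>\<^sup>+x. ennreal \<bar>c * g' n x - z x\<bar> \<partial>std_gauss) \<longlonglongrightarrow> 0"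
  shows "AE x in std_gauss. z x = 0"
proof -
  interpret prob_space std_gauss by (rule prob_space_std_gauss)
  have cg: "continuous_on UNIV (g n)" for n
    using deriv by (meson DERIV_isCont continuous_at_imp_continuous_on)
  have [measurable]: "g n \<in> borel_measurable borel" "g' n \<in> borel_measurable borel" for n
    using cg cont by (auto intro: borel_measurable_continuous_onI)
  have ig: "integrable std_gauss (g n)" "integrable std_gauss (g' n)" for n
    by (rule integrable_const_bound[where B = "b n"]; use bg bg' in auto)+
  have iz: "integrable std_gauss z"
  proof -
    have "\<forall>\<^sub>F n in sequentially. (\<integral>\<^sup>+x. ennreal \<bar>c * g' n x - z x\<bar> \<partial>std_gauss) < 1"
      using lim1 by (rule order_tendstoD) simp
    then obtain n where "(\<integral>\<^sup>+x. ennreal \<bar>c * g' n x - z x\<bar> \<partial>std_gauss) < 1"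
      by (auto simp: eventually_sequentially)
    then have "integrable std_gauss (\<lambda>x. c * g' n x - z x)"
      by (intro integrableI_bounded) (auto intro: less_trans)
    from Bochner_Integration.integrable_diff[OF integrable_mult_right[OF ig(2)] this]
    have "integrable std_gauss (\<lambda>x. c * g' n x - (c * g' n x - z x))" .
    moreover have "(\<lambda>x. c * g' n x - (c * g' n x - z x)) = z" by auto
    ultimately show ?thesis by (simp only:)
  qed
  \<comment> \<open>damps the factor \<open>x\<close> of the adjoint derivative\<close>
  define \<rho> where "\<rho> x = exp (- x\<^sup>2 / 2)" for x :: real
  have \<rho>: "0 < \<rho> x" "\<rho> x \<le> 1" for x by (simp_all add: \<rho>_def)
  have d\<rho>: "(\<rho> has_real_derivative - x * \<rho> x) (at x)" for x
    unfolding \<rho>_def[abs_def] by (rule derivative_eq_intros refl | simp)+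
  have c\<rho>: "continuous_on UNIV \<rho>" unfolding \<rho>_def[abs_def] by (intro continuous_intros) auto
  have [measurable]: "\<rho> \<in> borel_measurable borel" using c\<rho> by (rule borel_measurable_continuous_onI)
  have zero: "(\<integral>x. z x * (\<rho> x * cos (a * x + \<theta>)) \<partial>std_gauss) = 0" for a \<theta>
  proof -
    define \<psi> where "\<psi> x = \<rho> x * cos (a * x + \<theta>)" for x
    \<comment> \<open>\<open>\<eta> x = \<psi>' x - x * \<psi> x\<close>, the adjoint derivative of \<open>\<psi>\<close> up to the sign\<close>
    define \<eta> where "\<eta> x = - a * (\<rho> x * sin (a * x + \<theta>)) - 2 * (x * \<rho> x) * cos (a * x + \<theta>)" for x
    have [measurable]: "\<psi> \<in> borel_measurable borel" "\<eta> \<in> borel_measurable borel"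
      unfolding \<psi>_def[abs_def] \<eta>_def[abs_def] by measurable
    have b\<psi>: "\<bar>\<psi> x\<bar> \<le> 1" for x
      using \<rho>[of x] by (auto simp: \<psi>_def abs_mult intro!: mult_le_one)
    have b\<eta>: "\<bar>\<eta> x\<bar> \<le> \<bar>a\<bar> + 2" for x
    proof -
      have "\<bar>\<rho> x * sin (a * x + \<theta>)\<bar> \<le> 1"
        using \<rho>[of x] by (auto simp: abs_mult intro!: mult_le_one)
      then have "\<bar>a * (\<rho> x * sin (a * x + \<theta>))\<bar> \<le> \<bar>a\<bar>"
        unfolding abs_mult[of a] by (intro mult_left_le) auto
      moreover have "\<bar>(x * \<rho> x) * cos (a * x + \<theta>)\<bar> \<le> 1"
        unfolding abs_mult[of "x * \<rho> x"] using abs_mult_exp_neg_le_1[of x]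
        by (intro mult_le_one) (auto simp: \<rho>_def abs_mult)
      ultimately show ?thesis unfolding \<eta>_def mult.assoc[of 2] by (simp add: abs_if split: if_splits)
    qed
    have parts: "(\<integral>x. g' n x * \<psi> x \<partial>std_gauss) = - (\<integral>x. g n x * \<eta> x \<partial>std_gauss)" for n
    proof -
      define G where "G x = g n x * \<psi> x" for x
      define G' where "G' x = g' n x * \<psi> x + g n x * (- x * \<rho> x * cos (a * x + \<theta>) - a * (\<rho> x * sin (a * x + \<theta>)))" for x
      have G: "(G has_real_derivative G' x) (at x)" for x
        unfolding G_def[abs_def] G'_def \<psi>_def
        by (rule derivative_eq_intros deriv d\<rho> refl)+ (simp add: algebra_simps)
      have eq: "G' x - x * G x = g' n x * \<psi> x + g n x * \<eta> x" for x
        by (simp add: G_def G'_def \<eta>_def \<psi>_def algebra_simps)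
      have b0: "0 \<le> b n" using bg[of n 0] by linarith
      have "(\<integral>x. G' x - x * G x \<partial>std_gauss) = 0"
      proof (rule integral_std_gauss_derivative[OF G])
        show "continuous_on UNIV G'"
          unfolding G'_def \<psi>_def by (intro continuous_intros cont cg c\<rho>)
        have *: "\<bar>u * v\<bar> \<le> b n * r" if "\<bar>u\<bar> \<le> b n" "\<bar>v\<bar> \<le> r" for u v r
          unfolding abs_mult using that b0 by (intro mult_mono) auto
        note * = *[OF bg b\<psi>, simplified] *[OF bg' b\<psi>, simplified] *[OF bg b\<eta>]
        have "0 \<le> b n * (\<bar>a\<bar> + 2)" using b0 by simp
        then show "\<bar>G x\<bar> \<le> b n + b n * (\<bar>a\<bar> + 2)" for x
          using *(1)[of x x] unfolding G_def by linarith
        show "\<bar>G' x - x * G x\<bar> \<le> b n + b n * (\<bar>a\<bar> + 2)" for x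
          unfolding eq using *(2,3)[of x x] by linarith
      qed
      moreover have "integrable std_gauss (\<lambda>x. g' n x * \<psi> x)" "integrable std_gauss (\<lambda>x. g n x * \<eta> x)"
        by (rule integrable_mult_bounded[OF ig(2) _ b\<psi>] integrable_mult_bounded[OF ig(1) _ b\<eta>]; simp)+
      ultimately show ?thesis by (simp add: eq)
    qed
    have l1: "(\<lambda>n. \<integral>x. (c * g' n x - z x) * \<psi> x \<partial>std_gauss) \<longlonglongrightarrow> 0"
      by (rule tendsto_integral_mult_bounded[OF _ _ b\<psi> _ lim1]) (use ig iz in auto)
    have l0: "(\<lambda>n. \<integral>x. g n x * \<eta> x \<partial>std_gauss) \<longlonglongrightarrow> 0"
      by (rule tendsto_integral_mult_bounded[OF _ _ b\<eta> _ lim0]) (use ig in auto)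
    have eqn: "(\<integral>x. z x * \<psi> x \<partial>std_gauss)
        = - c * (\<integral>x. g n x * \<eta> x \<partial>std_gauss) - (\<integral>x. (c * g' n x - z x) * \<psi> x \<partial>std_gauss)" for n
    proof -
      have i1: "integrable std_gauss (\<lambda>x. g' n x * \<psi> x)" and i2: "integrable std_gauss (\<lambda>x. z x * \<psi> x)"
        by (rule integrable_mult_bounded[OF ig(2) _ b\<psi>] integrable_mult_bounded[OF iz _ b\<psi>]; simp)+
      have "(\<integral>x. (c * g' n x - z x) * \<psi> x \<partial>std_gauss)
          = (\<integral>x. c * (g' n x * \<psi> x) - z x * \<psi> x \<partial>std_gauss)"
        by (simp add: algebra_simps)
      also have "\<dots> = c * (\<integral>x. g' n x * \<psi> x \<partial>std_gauss) - (\<integral>x. z x * \<psi> x \<partial>std_gauss)"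
        using i1 i2 by simp
      finally show ?thesis using parts[of n] by simp
    qed
    have "(\<lambda>n. - c * (\<integral>x. g n x * \<eta> x \<partial>std_gauss)
        - (\<integral>x. (c * g' n x - z x) * \<psi> x \<partial>std_gauss)) \<longlonglongrightarrow> - c * 0 - 0"
      by (intro tendsto_intros l0 l1)
    then have "(\<lambda>n::nat. \<integral>x. z x * \<psi> x \<partial>std_gauss) \<longlonglongrightarrow> - c * 0 - 0"
      unfolding eqn[symmetric] .
    then show ?thesis by (simp add: LIMSEQ_const_iff \<psi>_def)
  qed
  have \<rho>1: "\<bar>\<rho> x\<bar> \<le> 1" for x using \<rho>[of x] by simp
  have iz': "integrable std_gauss (\<lambda>x. z x * \<rho> x)"
    by (rule integrable_mult_bounded[OF iz _ \<rho>1]) simp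
  have iB: "integrable std_gauss (\<lambda>x. max 0 (s * z x) * \<rho> x * \<phi> x)"
    if "\<phi> \<in> borel_measurable borel" "\<And>x. \<bar>\<phi> x\<bar> \<le> 1" for s \<phi>
    by (rule integrable_mult_bounded[OF integrable_mult_bounded[OF _ _ \<rho>1] _ that(2)])
       (use iz that(1) in auto)
  have split: "max 0 (1 * r) - max 0 ((- 1) * r) = r" for r :: real by (simp add: max_def)
  have "AE x in std_gauss. z x * \<rho> x = 0"
  proof (rule density_zero[OF iz'])
    fix A assume A: "A \<in> sets std_gauss"
    then have A'[measurable]: "A \<in> sets borel" by simp
    have "(\<integral>x. max 0 (1 * z x) * \<rho> x * indicator A x \<partial>std_gauss)
        = (\<integral>x. max 0 ((- 1) * z x) * \<rho> x * indicator A x \<partial>std_gauss)"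
    proof (rule integrals_eq_of_cos_integrals)
      show "0 \<le> max 0 (1 * z x) * \<rho> x" "0 \<le> max 0 ((- 1) * z x) * \<rho> x" for x
        using \<rho>[of x] by auto
      show "integrable std_gauss (\<lambda>x. max 0 (1 * z x) * \<rho> x)"
        "integrable std_gauss (\<lambda>x. max 0 ((- 1) * z x) * \<rho> x)"
        using iB[of "\<lambda>_. 1" 1] iB[of "\<lambda>_. 1" "- 1"] by simp_all
      fix a \<theta>
      have "(\<integral>x. max 0 (1 * z x) * \<rho> x * cos (a * x + \<theta>) \<partial>std_gauss)
          - (\<integral>x. max 0 ((- 1) * z x) * \<rho> x * cos (a * x + \<theta>) \<partial>std_gauss)
          = (\<integral>x. max 0 (1 * z x) * \<rho> x * cos (a * x + \<theta>) - max 0 ((- 1) * z x) * \<rho> x * cos (a * x + \<theta>) \<partial>std_gauss)"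
        by (rule Bochner_Integration.integral_diff[symmetric]) (rule iB; simp)+
      also have "\<dots> = 0"
        unfolding left_diff_distrib[symmetric] split mult.assoc by (rule zero)
      finally show "(\<integral>x. max 0 (1 * z x) * \<rho> x * cos (a * x + \<theta>) \<partial>std_gauss)
          = (\<integral>x. max 0 ((- 1) * z x) * \<rho> x * cos (a * x + \<theta>) \<partial>std_gauss)" by simp
    qed (auto simp: A')
    moreover have "(\<integral>x. max 0 (1 * z x) * \<rho> x * indicator A x \<partial>std_gauss)
          - (\<integral>x. max 0 ((- 1) * z x) * \<rho> x * indicator A x \<partial>std_gauss)
          = (\<integral>x. max 0 (1 * z x) * \<rho> x * indicator A x - max 0 ((- 1) * z x) * \<rho> x * indicator A x \<partial>std_gauss)"
      by (rule Bochner_Integration.integral_diff[symmetric]) (rule iB; simp add: indicator_def)+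
    ultimately show "set_lebesgue_integral std_gauss A (\<lambda>x. z x * \<rho> x) = 0"
      unfolding left_diff_distrib[symmetric] split by (simp add: set_lebesgue_integral_def mult.commute)
  qed
  then show ?thesis
    by eventually_elim (use \<rho> in \<open>auto simp: less_imp_neq[THEN not_sym]\<close>)
qed

section \<open>Paths and smooth cylinder functions\<close>

text \<open>
  The random time \<open>g\<close> is approximated from below by times with values in the multiples of
  \<open>1 / (n + 1)\<close>; countably many values raise no question of joint measurability.
\<close>

lemma borel_measurable_continuous_process:
  fixes X :: "real \<Rightarrow> 'a \<Rightarrow> real"
  assumes X: "\<And>t. X t \<in> borel_measurable N"
    and cont: "\<And>x. x \<in> space N \<Longrightarrow> continuous_on UNIV (\<lambda>t. X t x)"
    and [measurable]: "g \<in> borel_measurable N"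
  shows "(\<lambda>x. X (g x) x) \<in> borel_measurable N"
proof (rule borel_measurable_LIMSEQ_real)
  show "(\<lambda>n. X (of_int \<lfloor>real (Suc n) * g x\<rfloor> / real (Suc n)) x) \<longlonglongrightarrow> X (g x) x" if "x \<in> space N" for x
  proof -
    have "(\<lambda>n. of_int \<lfloor>real (Suc n) * g x\<rfloor> / real (Suc n)) \<longlonglongrightarrow> g x"
    proof (rule tendsto_sandwich)
      show "\<forall>\<^sub>F n in sequentially. g x - 1 / real (Suc n) \<le> of_int \<lfloor>real (Suc n) * g x\<rfloor> / real (Suc n)"
      proof (intro always_eventually allI)
        fix n
        have "real (Suc n) * g x - 1 \<le> of_int \<lfloor>real (Suc n) * g x\<rfloor>" by linarith
        then have "(real (Suc n) * g x - 1) / real (Suc n) \<le> of_int \<lfloor>real (Suc n) * g x\<rfloor> / real (Suc n)"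
          by (rule divide_right_mono) simp
        then show "g x - 1 / real (Suc n) \<le> of_int \<lfloor>real (Suc n) * g x\<rfloor> / real (Suc n)"
          by (simp add: diff_divide_distrib)
      qed
      show "\<forall>\<^sub>F n in sequentially. of_int \<lfloor>real (Suc n) * g x\<rfloor> / real (Suc n) \<le> g x"
        by (intro always_eventually allI) (simp add: divide_le_eq mult.commute)
      show "(\<lambda>n. g x - 1 / real (Suc n)) \<longlonglongrightarrow> g x"
        using tendsto_diff[OF tendsto_const[of "g x"] LIMSEQ_inverse_real_of_nat]
        by (simp add: inverse_eq_divide)
    qed auto
    then show ?thesis
      by (rule continuous_on_tendsto_compose[OF cont[OF that]]) simp_all
  qed
  show "(\<lambda>x. X (of_int \<lfloor>real (Suc n) * g x\<rfloor> / real (Suc n)) x) \<in> borel_measurable N" for n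
    by (rule measurable_compose_countable[where f = "\<lambda>i. X (of_int i / real (Suc n))"])
       (use X in auto)
qed

lemma continuous_on_path:
  assumes "w \<in> paths"
  shows "continuous_on A w"
proof -
  have "continuous_on {..0} w"
  proof (rule continuous_on_eq)
    show "continuous_on {..0} (\<lambda>t. 0 :: real)" by simp
    show "0 = w t" if "t \<in> {..0}" for t
      using assms that by (cases "t = 0") (auto simp: paths_def)
  qed
  then have "continuous_on ({..0} \<union> {0..}) w"
    using assms by (intro continuous_on_closed_Un) (auto simp: paths_def)
  then show ?thesis by (rule continuous_on_subset) auto
qed

lemma paths_add_scale:
  assumes "w \<in> paths" "h \<in> paths"
  shows "(\<lambda>t. w t + c * h t) \<in> paths"
  using assms by (auto simp: paths_def intro!: continuous_intros)

lemma space_path_borel [simp]: "space path_borel = paths"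
  by (simp add: path_borel_def space_measure_of_conv)

text \<open>
  For \<open>t \<ge> 0\<close> the paths with \<open>w t\<close> in an open set form a union of uniform balls over \<open>[0, t]\<close>.
\<close>

lemma borel_measurable_eval [measurable]: "(\<lambda>w. w t) \<in> borel_measurable path_borel"
proof (cases "t < 0")
  case True
  have "(\<lambda>w. 0 :: real) \<in> borel_measurable path_borel" by simp
  then show ?thesis
    by (subst measurable_cong[where g = "\<lambda>w. 0"]) (use True in \<open>auto simp: paths_def\<close>)
next
  case False
  let ?B = "{{v \<in> paths. \<forall>t\<in>{0..r}. \<bar>v t - w t\<bar> < \<epsilon>} |w r \<epsilon>. w \<in> paths \<and> 0 \<le> r \<and> 0 < \<epsilon>}"
  have sets: "sets path_borel = sigma_sets paths {U. openin path_topology U}"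
  proof -
    have "\<Union> ?B \<subseteq> paths" by auto
    then have "topspace path_topology \<subseteq> paths"
      unfolding path_topology_def topology_generated_by_topspace .
    then show ?thesis
      unfolding path_borel_def by (intro sets_measure_of) (use openin_subset in blast)
  qed
  show ?thesis
  proof (rule borel_measurableI)
    fix S :: "real set" assume "open S"
    let ?U = "(\<lambda>w. w t) -` S \<inter> paths"
    have U: "?U = \<Union> {b \<in> ?B. b \<subseteq> ?U}"
    proof (intro subset_antisym subsetI)
      fix w assume w: "w \<in> ?U"
      then obtain \<epsilon> where \<epsilon>: "\<epsilon> > 0" "\<And>y. \<bar>y - w t\<bar> < \<epsilon> \<Longrightarrow> y \<in> S"
        using \<open>open S\<close> unfolding open_dist dist_real_def by auto
      let ?b = "{v \<in> paths. \<forall>s\<in>{0..t}. \<bar>v s - w s\<bar> < \<epsilon>}"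
      have "?b \<subseteq> ?U" using \<epsilon> False by auto
      moreover have "?b \<in> ?B" using w \<epsilon>(1) False by (intro CollectI exI[of _ w] exI[of _ t] exI[of _ \<epsilon>]) auto
      moreover have "w \<in> ?b" using w \<epsilon>(1) by auto
      ultimately show "w \<in> \<Union> {b \<in> ?B. b \<subseteq> ?U}" by blast
    qed auto
    have "openin path_topology (\<Union> {b \<in> ?B. b \<subseteq> ?U})"
      unfolding path_topology_def by (intro openin_Union) (auto intro!: topology_generated_by_Basis)
    then have "openin path_topology ?U" by (subst U)
    then show "(\<lambda>w. w t) -` S \<inter> space path_borel \<in> sets path_borel"
      unfolding sets space_path_borel by (intro sigma_sets.Basic) simp
  qed
qed

lemma mean_value_unit:
  fixes \<phi> \<phi>' :: "real \<Rightarrow> real"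
  assumes "\<And>u. (\<phi> has_real_derivative \<phi>' u) (at u)"
  shows "\<exists>\<theta>. 0 \<le> \<theta> \<and> \<theta> \<le> 1 \<and> \<phi> (a + b) - \<phi> a = b * \<phi>' (a + \<theta> * b)"
proof -
  have "((\<lambda>\<theta>. \<phi> (a + \<theta> * b)) has_real_derivative \<phi>' (a + \<theta> * b) * b) (at \<theta>)" for \<theta>
    by (rule DERIV_chain'[OF _ assms]) (auto intro!: derivative_eq_intros)
  then obtain \<theta> where "0 < \<theta>" "\<theta> < 1" "\<phi> (a + 1 * b) - \<phi> (a + 0 * b) = (1 - 0) * (\<phi>' (a + \<theta> * b) * b)"
    using MVT2[of 0 1 "\<lambda>\<theta>. \<phi> (a + \<theta> * b)" "\<lambda>\<theta>. \<phi>' (a + \<theta> * b) * b"] by auto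
  then show ?thesis by (intro exI[of _ \<theta>]) auto
qed

lemma tendsto_fun_coordinatewise:
  fixes z :: "'b \<Rightarrow> 'i \<Rightarrow> real"
  assumes "\<And>i. ((\<lambda>s. z s i) \<longlongrightarrow> x i) F"
  shows "(z \<longlongrightarrow> x) F"
proof -
  have "limitin (product_topology (\<lambda>i. euclidean) UNIV) z x F"
    unfolding limitin_componentwise using assms by simp
  then show ?thesis by (simp add: euclidean_product_topology)
qed

text \<open>
  The coordinates are moved one after the other, with the mean value theorem applied in each; the
  intermediate points tend to \<open>x\<close>, and the partial derivatives are continuous there.
\<close>

lemma directional_derivative_of_partials:
  fixes g :: "(nat \<Rightarrow> real) \<Rightarrow> real"
  assumes trunc: "\<And>x. g x = g (\<lambda>i. if i < n then x i else 0)"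
    and deriv: "\<And>i x u. i < n \<Longrightarrow> ((\<lambda>u. g (x(i := u))) has_real_derivative D i (x(i := u))) (at u)"
    and cont: "\<And>i. i < n \<Longrightarrow> continuous_on UNIV (D i)"
  shows "((\<lambda>s. g (\<lambda>i. x i + s * y i)) has_real_derivative (\<Sum>i<n. D i (\<lambda>i. x i + s * y i) * y i)) (at s)"
proof -
  have at_0: "((\<lambda>s. g (\<lambda>i. x i + s * y i)) has_real_derivative (\<Sum>i<n. D i x * y i)) (at 0)" for x
  proof -
    \<comment> \<open>the first \<open>k\<close> coordinates have been moved\<close>
    define z where "z k s = (\<lambda>j. if j < k then x j + s * y j else x j)" for k s
    have "\<exists>\<theta>. \<forall>i<n. \<forall>s. 0 \<le> \<theta> i s \<and> \<theta> i s \<le> 1 \<and>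
        g (z (Suc i) s) - g (z i s) = s * y i * D i ((z i s)(i := x i + \<theta> i s * (s * y i)))"
    proof -
      have "\<exists>\<theta>. i < n \<longrightarrow> 0 \<le> \<theta> \<and> \<theta> \<le> 1 \<and>
        g (z (Suc i) s) - g (z i s) = s * y i * D i ((z i s)(i := x i + \<theta> * (s * y i)))" for i s
      proof (cases "i < n")
        case True
        have "(z i s)(i := x i + s * y i) = z (Suc i) s" "(z i s)(i := x i) = z i s"
          by (auto simp: z_def)
        then show ?thesis
          using mean_value_unit[OF deriv[OF True, of "z i s"], of "x i" "s * y i"] by auto
      qed auto
      then show ?thesis by metis
    qed
    then obtain \<theta> where \<theta>: "\<And>i s. i < n \<Longrightarrow> 0 \<le> \<theta> i s \<and> \<theta> i s \<le> 1 \<and>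
        g (z (Suc i) s) - g (z i s) = s * y i * D i ((z i s)(i := x i + \<theta> i s * (s * y i)))"
      by blast
    define \<zeta> where "\<zeta> i s = (z i s)(i := x i + \<theta> i s * (s * y i))" for i s
    have quot: "(g (\<lambda>i. x i + s * y i) - g x) / s = (\<Sum>i<n. D i (\<zeta> i s) * y i)" if "s \<noteq> 0" for s
    proof -
      have "g (z n s) = g (\<lambda>i. x i + s * y i)"
        by (subst (1 2) trunc) (auto simp: z_def intro!: arg_cong[of _ _ g])
      moreover have "z 0 s = x" by (auto simp: z_def)
      ultimately have "g (\<lambda>i. x i + s * y i) - g x = (\<Sum>i<n. g (z (Suc i) s) - g (z i s))"
        unfolding sum_lessThan_telescope[of "\<lambda>k. g (z k s)"] by (simp only:)
      also have "\<dots> = (\<Sum>i<n. s * (D i (\<zeta> i s) * y i))"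
        by (intro sum.cong refl) (use \<theta> in \<open>auto simp: \<zeta>_def\<close>)
      finally show ?thesis using that by (simp add: sum_distrib_left[symmetric])
    qed
    have "((\<lambda>s. \<Sum>i<n. D i (\<zeta> i s) * y i) \<longlongrightarrow> (\<Sum>i<n. D i x * y i)) (at 0)"
    proof (intro tendsto_sum tendsto_mult tendsto_const)
      fix i assume "i \<in> {..<n}"
      then have i: "i < n" by simp
      have "(\<zeta> i \<longlongrightarrow> x) (at 0)"
      proof (rule tendsto_fun_coordinatewise)
        fix j
        have bound: "norm (\<zeta> i s j - x j) \<le> \<bar>s * y j\<bar>" for s
        proof -
          have "\<bar>\<theta> i s * (s * y i)\<bar> \<le> 1 * \<bar>s * y i\<bar>"
            unfolding abs_mult[of "\<theta> i s"] using \<theta>[OF i, of s] by (intro mult_right_mono) auto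
          then show ?thesis by (auto simp: \<zeta>_def z_def)
        qed
        have "((\<lambda>s. \<bar>s * y j\<bar>) \<longlongrightarrow> 0) (at 0)" by (auto intro!: tendsto_eq_intros)
        then have "((\<lambda>s. \<zeta> i s j - x j) \<longlongrightarrow> 0) (at 0)"
          by (rule Lim_null_comparison[rotated]) (intro always_eventually allI bound)
        then show "((\<lambda>s. \<zeta> i s j) \<longlongrightarrow> x j) (at 0)" by (simp add: LIM_zero_iff)
      qed
      then show "((\<lambda>s. D i (\<zeta> i s)) \<longlongrightarrow> D i x) (at 0)"
        by (rule continuous_on_tendsto_compose[OF cont[OF i]]) simp_all
    qed
    then have "((\<lambda>s. (g (\<lambda>i. x i + s * y i) - g x) / s) \<longlongrightarrow> (\<Sum>i<n. D i x * y i)) (at 0)"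
      by (rule Lim_transform_eventually) (auto simp: eventually_at_filter quot)
    then show ?thesis by (simp add: has_field_derivative_iff)
  qed
  have "(\<lambda>u. g (\<lambda>i. x i + (u + s) * y i)) = (\<lambda>u. g (\<lambda>i. (x i + s * y i) + u * y i))"
    by (simp add: algebra_simps)
  then have "((\<lambda>u. g (\<lambda>i. x i + (u + s) * y i)) has_real_derivative
      (\<Sum>i<n. D i (\<lambda>i. x i + s * y i) * y i)) (at 0)"
    using at_0[of "\<lambda>i. x i + s * y i"] by (simp only:)
  then show ?thesis
    using DERIV_shift[of "\<lambda>s. g (\<lambda>i. x i + s * y i)" _ 0 s] by (simp only: add_0)
qed

lemma continuous_on_Euclidean_space_truncate:
  assumes "continuous_map (Euclidean_space n) euclideanreal f"
  shows "continuous_on UNIV (\<lambda>x. f (\<lambda>i. if i < n then x i else 0))"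
proof -
  have "continuous_on UNIV (\<lambda>x::nat \<Rightarrow> real. (\<lambda>i. if i < n then x i else 0))"
  proof (rule continuous_on_coordinatewise_then_product)
    show "continuous_on UNIV (\<lambda>x::nat \<Rightarrow> real. if i < n then x i else 0)" for i
      by (cases "i < n") auto
  qed
  then have "continuous_map euclidean (Euclidean_space n) (\<lambda>x. (\<lambda>i. if i < n then x i else 0))"
    unfolding Euclidean_space_def continuous_map_in_subtopology euclidean_product_topology
    by (auto simp: continuous_map_iff_continuous2)
  from continuous_map_compose[OF this assms] show ?thesis
    by (simp add: comp_def)
qed

text \<open>
  Composition with the truncation to the first \<open>n\<close> coordinates extends a function on \<open>\<real>\<^sup>n\<close> and its
  partial derivatives to functions \<open>g\<close> and \<open>D i\<close> on the space of all sequences, so that from here on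
  continuity refers to an ordinary topological space.
\<close>

lemma Cb_infinityE:
  assumes "f \<in> Cb_infinity n"
  obtains g D B where
    "\<And>x. g x = f (\<lambda>i. if i < n then x i else 0)"
    "continuous_on UNIV g" "\<And>x. \<bar>g x\<bar> \<le> B"
    "\<And>i. i < n \<Longrightarrow> continuous_on UNIV (D i)" "\<And>i x. i < n \<Longrightarrow> \<bar>D i x\<bar> \<le> B"
    "\<And>x y s. ((\<lambda>s. g (\<lambda>i. x i + s * y i)) has_real_derivative
        (\<Sum>i<n. D i (\<lambda>i. x i + s * y i) * y i)) (at s)"
proof -
  define \<pi> where "\<pi> x = (\<lambda>i. if i < n then x i else (0::real))" for x
  define g where "g x = f (\<pi> x)" for x
  define D where "D i x = partial_deriv i f (\<pi> x)" for i x
  have top: "\<pi> x \<in> topspace (Euclidean_space n)" for x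
    by (simp add: \<pi>_def topspace_Euclidean_space)
  have 0: "(\<forall>i<n. \<forall>x\<in>topspace (Euclidean_space n). (\<lambda>s. f (x(i := s))) field_differentiable at (x i))"
    "continuous_map (Euclidean_space n) euclideanreal f" "bounded (f ` topspace (Euclidean_space n))"
    using assms unfolding Cb_infinity_def by (auto dest!: spec[of _ "[]"] simp: Let_def)
  have 1: "continuous_map (Euclidean_space n) euclideanreal (partial_deriv i f)"
    "bounded (partial_deriv i f ` topspace (Euclidean_space n))" if "i < n" for i
    using assms that unfolding Cb_infinity_def by (auto dest!: spec[of _ "[i]"] simp: Let_def)
  have cg: "continuous_on UNIV g"
    using continuous_on_Euclidean_space_truncate[OF 0(2)] by (simp add: g_def[abs_def] \<pi>_def)
  have cD: "continuous_on UNIV (D i)" if "i < n" for i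
    using continuous_on_Euclidean_space_truncate[OF 1(1)[OF that]] by (simp add: D_def[abs_def] \<pi>_def)
  have "\<exists>B. \<forall>x. \<bar>g x\<bar> \<le> B"
    using 0(3) top unfolding bounded_iff g_def by auto
  then obtain B0 where B0: "\<And>x. \<bar>g x\<bar> \<le> B0" by blast
  have "\<forall>i. \<exists>B. i < n \<longrightarrow> (\<forall>x. \<bar>D i x\<bar> \<le> B)"
    using 1(2) top unfolding bounded_iff D_def by (metis image_eqI real_norm_def)
  then obtain B1 where B1: "\<And>i x. i < n \<Longrightarrow> \<bar>D i x\<bar> \<le> B1 i" by metis
  define B where "B = \<bar>B0\<bar> + (\<Sum>i<n. \<bar>B1 i\<bar>)"
  have "\<bar>g x\<bar> \<le> B" for x
    using B0[of x] sum_nonneg[of "{..<n}" "\<lambda>i. \<bar>B1 i\<bar>"] unfolding B_def by linarith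
  moreover have "\<bar>D i x\<bar> \<le> B" if "i < n" for i x
    using B1[OF that, of x] member_le_sum[of i "{..<n}" "\<lambda>i. \<bar>B1 i\<bar>"] that unfolding B_def by auto
  moreover have "((\<lambda>s. g (\<lambda>i. x i + s * y i)) has_real_derivative
        (\<Sum>i<n. D i (\<lambda>i. x i + s * y i) * y i)) (at s)" for x y s
  proof (rule directional_derivative_of_partials)
    show "g x = g (\<lambda>i. if i < n then x i else 0)" for x by (auto simp: g_def \<pi>_def intro!: arg_cong[of _ _ f])
    show "continuous_on UNIV (D i)" if "i < n" for i by (rule cD) fact
    fix i x u assume i: "i < n"
    have upd: "\<pi> (x(i := v)) = (\<pi> x)(i := v)" for v using i by (auto simp: \<pi>_def)
    have "(\<lambda>s. f ((\<pi> (x(i := u)))(i := s))) field_differentiable at (\<pi> (x(i := u)) i)"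
      using 0(1) i top by blast
    then have "((\<lambda>s. f ((\<pi> (x(i := u)))(i := s))) has_real_derivative partial_deriv i f (\<pi> (x(i := u)))) (at (\<pi> (x(i := u)) i))"
      unfolding partial_deriv_def by (simp add: DERIV_deriv_iff_field_differentiable)
    then show "((\<lambda>u. g (x(i := u))) has_real_derivative D i (x(i := u))) (at u)"
      unfolding g_def D_def by (simp add: upd)
  qed
  ultimately show ?thesis using that[of g B D] cg cD by (simp add: g_def \<pi>_def)
qed

section \<open>Centred Gaussian variables\<close>

context prob_space begin

lemma integrable_mult_of_squares:
  fixes X Y :: "'a \<Rightarrow> real"
  assumes "X \<in> borel_measurable M" "Y \<in> borel_measurable M"
    and "integrable M (\<lambda>x. (X x)\<^sup>2)" "integrable M (\<lambda>x. (Y x)\<^sup>2)"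
  shows "integrable M (\<lambda>x. X x * Y x)"
proof (rule Bochner_Integration.integrable_bound)
  show "integrable M (\<lambda>x. (X x)\<^sup>2 + (Y x)\<^sup>2)" using assms by simp
  show "AE x in M. norm (X x * Y x) \<le> norm ((X x)\<^sup>2 + (Y x)\<^sup>2)"
  proof (rule AE_I2)
    fix x
    have "2 * (\<bar>X x\<bar> * \<bar>Y x\<bar>) \<le> (X x)\<^sup>2 + (Y x)\<^sup>2"
      using sum_squares_bound[of "\<bar>X x\<bar>" "\<bar>Y x\<bar>"] by (simp add: mult.assoc)
    moreover have "0 \<le> \<bar>X x\<bar> * \<bar>Y x\<bar>" by simp
    ultimately show "norm (X x * Y x) \<le> norm ((X x)\<^sup>2 + (Y x)\<^sup>2)"
      unfolding real_norm_def abs_mult by linarith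
  qed
qed (use assms in measurable)

lemma integrable_of_square:
  fixes X :: "'a \<Rightarrow> real"
  assumes "X \<in> borel_measurable M" "integrable M (\<lambda>x. (X x)\<^sup>2)"
  shows "integrable M X"
  using integrable_mult_of_squares[of X "\<lambda>_. 1"] assms by simp

lemma integrable_square_add:
  fixes X Y :: "'a \<Rightarrow> real"
  assumes [measurable]: "X \<in> borel_measurable M" "Y \<in> borel_measurable M"
    and "integrable M (\<lambda>x. (X x)\<^sup>2)" "integrable M (\<lambda>x. (Y x)\<^sup>2)"
  shows "integrable M (\<lambda>x. (X x + c * Y x)\<^sup>2)"
proof -
  have "(\<lambda>x. (X x + c * Y x)\<^sup>2) = (\<lambda>x. (X x)\<^sup>2 + (2 * c * (X x * Y x) + c\<^sup>2 * (Y x)\<^sup>2))"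
    by (auto simp: power2_eq_square algebra_simps)
  then show ?thesis
    using assms integrable_mult_of_squares[OF assms] by simp
qed

lemma expectation_Cauchy_Schwarz:
  fixes X Y :: "'a \<Rightarrow> real"
  assumes "X \<in> borel_measurable M" "Y \<in> borel_measurable M"
    and "integrable M (\<lambda>x. (X x)\<^sup>2)" "integrable M (\<lambda>x. (Y x)\<^sup>2)"
  shows "\<bar>expectation (\<lambda>x. X x * Y x)\<bar>
      \<le> sqrt (expectation (\<lambda>x. (X x)\<^sup>2)) * sqrt (expectation (\<lambda>x. (Y x)\<^sup>2))"
proof -
  define a b c where "a = expectation (\<lambda>x. (X x)\<^sup>2)" and "b = expectation (\<lambda>x. X x * Y x)"
    and "c = expectation (\<lambda>x. (Y x)\<^sup>2)"
  have xy: "integrable M (\<lambda>x. X x * Y x)" by (rule integrable_mult_of_squares) fact+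
  have q: "0 \<le> a + 2 * t * b + t\<^sup>2 * c" for t
  proof -
    have "0 \<le> expectation (\<lambda>x. (X x + t * Y x)\<^sup>2)" by simp
    also have "(\<lambda>x. (X x + t * Y x)\<^sup>2) = (\<lambda>x. (X x)\<^sup>2 + 2 * t * (X x * Y x) + t\<^sup>2 * (Y x)\<^sup>2)"
      by (auto simp: power2_eq_square algebra_simps)
    also have "expectation \<dots> = a + 2 * t * b + t\<^sup>2 * c"
      using assms xy by (simp add: a_def b_def c_def)
    finally show ?thesis .
  qed
  have ac: "0 \<le> a" "0 \<le> c" by (simp_all add: a_def c_def)
  have "b\<^sup>2 \<le> a * c"
  proof (cases "c = 0")
    case True
    have "b = 0"
    proof (rule ccontr)
      assume "b \<noteq> 0"
      then show False using q[of "- (a + 1) / (2 * b)"] True ac by (simp add: field_simps)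
    qed
    then show ?thesis using True by simp
  next
    case False
    then have c: "c > 0" using ac by simp
    have "0 \<le> a + 2 * (- b / c) * b + (- b / c)\<^sup>2 * c" by (rule q)
    also have "\<dots> = a - b\<^sup>2 / c" using c by (simp add: field_simps power2_eq_square)
    finally show ?thesis using c by (simp add: field_simps)
  qed
  then have "sqrt (b\<^sup>2) \<le> sqrt (a * c)" by (rule real_sqrt_le_mono)
  then show ?thesis by (simp add: real_sqrt_mult a_def b_def c_def)
qed

text \<open>
  All later uses of Gaussian variables go through the second moment and the characteristic function,
  in real form; stated in this way, the degenerate case is no exception.
\<close>

lemma centred_gaussian_rv:
  assumes g: "gaussian_rv M X" and mean: "expectation X = 0"
  shows "X \<in> borel_measurable M" (is ?A)
    and "integrable M (\<lambda>x. (X x)\<^sup>2)" (is ?B)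
    and "expectation (\<lambda>x. cos (X x)) = exp (- expectation (\<lambda>x. (X x)\<^sup>2) / 2)" (is ?C)
    and "expectation (\<lambda>x. sin (X x)) = 0" (is ?D)
proof -
  have "?A \<and> ?B \<and> ?C \<and> ?D"
    using g unfolding gaussian_rv_def
  proof (elim disjE exE conjE)
    fix \<mu> \<sigma> :: real
    assume \<sigma>: "0 < \<sigma>" and D: "distributed M lborel X (\<lambda>x. ennreal (normal_density \<mu> \<sigma> x))"
    have [simp]: "\<mu> = 0" using normal_distributed_expectation[OF \<sigma> D] mean by simp
    have [measurable]: "X \<in> borel_measurable M" using distributed_measurable[OF D] by simp
    have "has_bochner_integral lborel (\<lambda>x. normal_density 0 \<sigma> x * x\<^sup>2) (\<sigma>\<^sup>2)"
    proof -
      have "fact (2 * 1) / ((2 / \<sigma>\<^sup>2) ^ 1 * fact 1) = \<sigma>\<^sup>2" using \<sigma> by (simp add: fact_2)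
      then show ?thesis
        using normal_moment_even[OF \<sigma>, of 0 1] by (simp only: diff_zero mult_1_right)
    qed
    then have B: ?B
      using distributed_integrable[OF D, of "\<lambda>x. x\<^sup>2"] by (simp add: has_bochner_integral_iff)
    have var: "expectation (\<lambda>x. (X x)\<^sup>2) = \<sigma>\<^sup>2"
      using normal_distributed_variance[OF \<sigma> D] mean by simp
    define Y where "Y x = X x / \<sigma>" for x
    have [measurable]: "Y \<in> borel_measurable M" unfolding Y_def by measurable
    have DY: "distributed M lborel Y std_normal_density"
      using D normal_standard_normal_convert[OF \<sigma>, of X \<mu>] by (simp add: Y_def[abs_def])
    have dY: "distr M borel Y = std_normal_distribution"
    proof -
      have "distr M borel Y = distr M lborel Y" by (rule distr_cong) auto
      then show ?thesis using distributed_distr_eq_density[OF DY] by simp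
    qed
    have X: "X x = \<sigma> * Y x" for x using \<sigma> by (simp add: Y_def)
    have "(CLINT x|M. iexp (X x)) = char std_normal_distribution \<sigma>"
      unfolding char_def dY[symmetric] X by (subst integral_distr) auto
    then have c: "(CLINT x|M. iexp (X x)) = complex_of_real (exp (- \<sigma>\<^sup>2 / 2))"
      by (simp add: char_std_normal_distribution)
    have int: "integrable M (\<lambda>x. iexp (X x))" by (rule integrable_iexp) auto
    have "expectation (\<lambda>x. cos (X x)) = Re (CLINT x|M. iexp (X x))"
      using integral_Re[OF int] by (simp add: Re_exp)
    moreover have "expectation (\<lambda>x. sin (X x)) = Im (CLINT x|M. iexp (X x))"
      using integral_Im[OF int] by (simp add: Im_exp)
    ultimately show ?thesis using B var unfolding c by simp
  next
    fix \<mu> assume X[measurable]: "X \<in> borel_measurable M" and \<mu>: "AE x in M. X x = \<mu>"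
    have "expectation X = expectation (\<lambda>_. \<mu>)" by (rule integral_cong_AE) (use \<mu> in auto)
    then have "\<mu> = 0" using mean prob_space by simp
    then have 0: "AE x in M. X x = 0" using \<mu> by simp
    have "integrable M (\<lambda>x. (X x)\<^sup>2) \<longleftrightarrow> integrable M (\<lambda>x. 0 :: real)"
      by (rule integrable_cong_AE) (use 0 in auto)
    moreover have "expectation (\<lambda>x. (X x)\<^sup>2) = expectation (\<lambda>_. 0)"
      by (rule integral_cong_AE) (use 0 in auto)
    moreover have "expectation (\<lambda>x. cos (X x)) = expectation (\<lambda>_. 1)"
      by (rule integral_cong_AE) (use 0 in auto)
    moreover have "expectation (\<lambda>x. sin (X x)) = expectation (\<lambda>_. 0)"
      by (rule integral_cong_AE) (use 0 in auto)
    ultimately show ?thesis using X prob_space by simp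
  qed
  then show ?A ?B ?C ?D by blast+
qed

text \<open>
  Cosine and sine are Lipschitz functions, so their expectations converge, and so do the second
  moments by the Cauchy--Schwarz inequality.
\<close>

lemma gaussian_L2_limit:
  fixes X :: "'a \<Rightarrow> real" and Y :: "nat \<Rightarrow> 'a \<Rightarrow> real"
  assumes [measurable]: "X \<in> borel_measurable M" "\<And>n. Y n \<in> borel_measurable M"
    and iY: "\<And>n. integrable M (\<lambda>x. (Y n x)\<^sup>2)"
    and iD: "\<And>n. integrable M (\<lambda>x. (Y n x - X x)\<^sup>2)"
    and lim: "(\<lambda>n. expectation (\<lambda>x. (Y n x - X x)\<^sup>2)) \<longlonglongrightarrow> 0"
    and cosY: "\<And>n. expectation (\<lambda>x. cos (Y n x)) = exp (- expectation (\<lambda>x. (Y n x)\<^sup>2) / 2)"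
    and sinY: "\<And>n. expectation (\<lambda>x. sin (Y n x)) = 0"
  shows "integrable M (\<lambda>x. (X x)\<^sup>2)"
    and "expectation (\<lambda>x. cos (X x)) = exp (- expectation (\<lambda>x. (X x)\<^sup>2) / 2)"
    and "expectation (\<lambda>x. sin (X x)) = 0"
proof -
  define e where "e n = expectation (\<lambda>x. (Y n x - X x)\<^sup>2)" for n
  have e0: "e \<longlonglongrightarrow> 0" using lim by (simp add: e_def[abs_def])
  have se0: "(\<lambda>n. sqrt (e n)) \<longlonglongrightarrow> 0" using tendsto_real_sqrt[OF e0] by simp
  have eq: "(X x)\<^sup>2 = (Y n x)\<^sup>2 - 2 * (Y n x * (Y n x - X x)) + (Y n x - X x)\<^sup>2" for n x
    by (simp add: power2_eq_square algebra_simps)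
  have m: "(\<lambda>x. Y n x - X x) \<in> borel_measurable M" for n by measurable
  have iYD: "integrable M (\<lambda>x. Y n x * (Y n x - X x))" for n
    by (rule integrable_mult_of_squares) (use iY iD in auto)
  show iX: "integrable M (\<lambda>x. (X x)\<^sup>2)"
    unfolding eq[of _ 0] using iY[of 0] iD[of 0] iYD[of 0] by auto
  have iDX: "integrable M (\<lambda>x. X x * (Y n x - X x))" for n
    by (rule integrable_mult_of_squares) (use iX iD in auto)
  have EY: "expectation (\<lambda>x. (Y n x)\<^sup>2)
      = expectation (\<lambda>x. (X x)\<^sup>2) + 2 * expectation (\<lambda>x. X x * (Y n x - X x)) + e n" for n
  proof -
    have "expectation (\<lambda>x. (Y n x)\<^sup>2) = expectation (\<lambda>x. (X x)\<^sup>2 + 2 * (X x * (Y n x - X x)) + (Y n x - X x)\<^sup>2)"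
      by (intro Bochner_Integration.integral_cong refl) (simp add: power2_eq_square algebra_simps)
    then show ?thesis using iX iDX[of n] iD[of n] by (simp add: e_def)
  qed
  have "(\<lambda>n. expectation (\<lambda>x. X x * (Y n x - X x))) \<longlonglongrightarrow> 0"
  proof (rule Lim_null_comparison)
    show "\<forall>\<^sub>F n in sequentially. norm (expectation (\<lambda>x. X x * (Y n x - X x)))
        \<le> sqrt (expectation (\<lambda>x. (X x)\<^sup>2)) * sqrt (e n)"
      unfolding e_def real_norm_def
      by (intro always_eventually allI expectation_Cauchy_Schwarz) (use iX iD in auto)
    show "(\<lambda>n. sqrt (expectation (\<lambda>x. (X x)\<^sup>2)) * sqrt (e n)) \<longlonglongrightarrow> 0"
      using tendsto_mult_right_zero[OF se0] .
  qed
  then have EY_lim: "(\<lambda>n. expectation (\<lambda>x. (Y n x)\<^sup>2)) \<longlonglongrightarrow> expectation (\<lambda>x. (X x)\<^sup>2)"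
    unfolding EY using e0 by (auto intro!: tendsto_eq_intros)
  have lip: "(\<lambda>n. expectation (\<lambda>x. \<phi> (Y n x))) \<longlonglongrightarrow> expectation (\<lambda>x. \<phi> (X x))"
    if [measurable]: "\<phi> \<in> borel_measurable borel" and b: "\<And>y. \<bar>\<phi> y\<bar> \<le> 1"
      and l: "\<And>y z. \<bar>\<phi> y - \<phi> z\<bar> \<le> \<bar>y - z\<bar>" for \<phi> :: "real \<Rightarrow> real"
  proof -
    have i: "integrable M (\<lambda>x. \<phi> (Z x))" if [measurable]: "Z \<in> borel_measurable M" for Z
      by (rule integrable_const_bound[where B = 1]) (use b in auto)
    have iabs: "integrable M (\<lambda>x. \<bar>Y n x - X x\<bar>)" for n
      by (rule integrable_abs[OF integrable_of_square[OF m iD]])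
    have "(\<lambda>n. expectation (\<lambda>x. \<phi> (Y n x)) - expectation (\<lambda>x. \<phi> (X x))) \<longlonglongrightarrow> 0"
    proof (rule Lim_null_comparison[OF always_eventually se0], rule allI)
      fix n
      have "\<bar>expectation (\<lambda>x. \<phi> (Y n x)) - expectation (\<lambda>x. \<phi> (X x))\<bar>
          = \<bar>expectation (\<lambda>x. \<phi> (Y n x) - \<phi> (X x))\<bar>"
        using i by simp
      also have "\<dots> \<le> expectation (\<lambda>x. \<bar>\<phi> (Y n x) - \<phi> (X x)\<bar>)"
        by (rule integral_abs_bound)
      also have "\<dots> \<le> expectation (\<lambda>x. \<bar>Y n x - X x\<bar>)"
        by (rule integral_mono) (use i iabs l in auto)
      also have "\<dots> \<le> sqrt (e n)"
        using expectation_Cauchy_Schwarz[of "\<lambda>x. \<bar>Y n x - X x\<bar>" "\<lambda>_. 1"] iD[of n] prob_space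
        by (simp add: e_def)
      finally show "norm (expectation (\<lambda>x. \<phi> (Y n x)) - expectation (\<lambda>x. \<phi> (X x))) \<le> sqrt (e n)"
        by simp
    qed
    then show ?thesis by (simp add: LIM_zero_iff)
  qed
  have cos_lip: "\<bar>cos y - cos z\<bar> \<le> \<bar>y - z\<bar>" for y z :: real
  proof -
    obtain \<theta> where "cos (z + (y - z)) - cos z = (y - z) * - sin (z + \<theta> * (y - z))"
      using mean_value_unit[of cos "\<lambda>u. - sin u" z "y - z"] DERIV_cos by auto
    then show ?thesis
      using mult_left_le[of "\<bar>sin (z + \<theta> * (y - z))\<bar>" "\<bar>y - z\<bar>"] by (simp add: abs_mult)
  qed
  have sin_lip: "\<bar>sin y - sin z\<bar> \<le> \<bar>y - z\<bar>" for y z :: real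
    using cos_lip[of "pi / 2 - y" "pi / 2 - z"] by (simp add: cos_diff)
  have "(\<lambda>n. expectation (\<lambda>x. cos (Y n x))) \<longlonglongrightarrow> expectation (\<lambda>x. cos (X x))"
    by (rule lip) (use cos_lip in auto)
  moreover have "(\<lambda>n. expectation (\<lambda>x. cos (Y n x))) \<longlonglongrightarrow> exp (- expectation (\<lambda>x. (X x)\<^sup>2) / 2)"
    unfolding cosY by (intro tendsto_intros EY_lim) simp
  ultimately show "expectation (\<lambda>x. cos (X x)) = exp (- expectation (\<lambda>x. (X x)\<^sup>2) / 2)"
    by (rule LIMSEQ_unique)
  have "(\<lambda>n. expectation (\<lambda>x. sin (Y n x))) \<longlonglongrightarrow> expectation (\<lambda>x. sin (X x))"
    by (rule lip) (use sin_lip in auto)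
  then show "expectation (\<lambda>x. sin (X x)) = 0"
    unfolding sinY by (simp add: LIMSEQ_const_iff)
qed

end

section \<open>The Gaussian space of fractional Brownian motion and Cameron--Martin functions\<close>

locale fractional_brownian_motion =
  fixes H :: real and P :: "(real \<Rightarrow> real) measure"
  assumes law: "fbm_law H P" and H: "1 / 2 < H" "H < 1"
begin

sublocale prob_space P
  using law by (simp add: fbm_law_def)

lemma sets_P [measurable_cong]: "sets P = sets path_borel"
  using law by (simp add: fbm_law_def)

lemma space_P [simp]: "space P = paths"
  using sets_eq_imp_space_eq[OF sets_P] by simp

lemma eval_measurable [measurable]: "(\<lambda>w. w t) \<in> borel_measurable P"
  by measurable

definition eval_span :: "((real \<Rightarrow> real) \<Rightarrow> real) set" where
  "eval_span = {Y. \<exists>J a. finite J \<and> J \<subseteq> {0..} \<and> Y = (\<lambda>w. \<Sum>t\<in>J. a t * w t)}"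

lemma eval_span_eval: "0 \<le> t \<Longrightarrow> (\<lambda>w. a * w t) \<in> eval_span"
  unfolding eval_span_def by (intro CollectI exI[of _ "{t}"] exI[of _ "\<lambda>_. a"]) auto

lemma eval_span_add:
  assumes "X \<in> eval_span" "Y \<in> eval_span"
  shows "(\<lambda>w. X w + c * Y w) \<in> eval_span"
proof -
  obtain J a K b where *: "finite J" "J \<subseteq> {0..}" "X = (\<lambda>w. \<Sum>t\<in>J. a t * w t)"
     "finite K" "K \<subseteq> {0..}" "Y = (\<lambda>w. \<Sum>t\<in>K. b t * w t)"
    using assms unfolding eval_span_def by auto
  define d where "d t = (if t \<in> J then a t else 0) + c * (if t \<in> K then b t else 0)" for t
  have "(\<lambda>w. X w + c * Y w) = (\<lambda>w. \<Sum>t\<in>J \<union> K. d t * w t)"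
  proof
    fix w
    have "X w = (\<Sum>t\<in>J \<union> K. (if t \<in> J then a t else 0) * w t)"
      unfolding *(3) using *(1,4) by (intro sum.mono_neutral_cong_left) auto
    moreover have "Y w = (\<Sum>t\<in>J \<union> K. (if t \<in> K then b t else 0) * w t)"
      unfolding *(6) using *(1,4) by (intro sum.mono_neutral_cong_left) auto
    ultimately show "X w + c * Y w = (\<Sum>t\<in>J \<union> K. d t * w t)"
      by (simp add: d_def sum_distrib_left distrib_right sum.distrib mult.assoc)
  qed
  then show ?thesis
    unfolding eval_span_def using * by (intro CollectI exI[of _ "J \<union> K"] exI[of _ d]) auto
qed

lemma eval_span_gaussian: "Y \<in> eval_span \<Longrightarrow> gaussian_rv P Y"
  using law unfolding fbm_law_def gaussian_process_def eval_span_def by auto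

lemma eval_square_integrable: "0 \<le> t \<Longrightarrow> integrable P (\<lambda>w. (w t)\<^sup>2)"
  using centred_gaussian_rv(2)[of "\<lambda>w. w t"] eval_span_gaussian[OF eval_span_eval[of t 1]] law
  by (simp add: fbm_law_def)

lemma expectation_eval_mult: "0 \<le> t \<Longrightarrow> 0 \<le> s \<Longrightarrow> expectation (\<lambda>w. w t * w s) = fbm_cov H t s"
  using law by (simp add: fbm_law_def)

lemma eval_span_expectation: "Y \<in> eval_span \<Longrightarrow> expectation Y = 0"
proof -
  assume "Y \<in> eval_span"
  then obtain J a where *: "finite J" "J \<subseteq> {0..}" "Y = (\<lambda>w. \<Sum>t\<in>J. a t * w t)"
    unfolding eval_span_def by auto
  have "expectation Y = (\<Sum>t\<in>J. expectation (\<lambda>w. a t * w t))"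
    unfolding *(3) using * eval_square_integrable
    by (intro Bochner_Integration.integral_sum integrable_mult_right
          integrable_of_square[OF eval_measurable eval_square_integrable]) auto
  then show ?thesis
    using law * by (auto simp: fbm_law_def intro!: sum.neutral)
qed

lemma
  assumes "Y \<in> eval_span"
  shows eval_span_measurable: "Y \<in> borel_measurable P"
    and eval_span_square_integrable: "integrable P (\<lambda>w. (Y w)\<^sup>2)"
    and eval_span_cos: "expectation (\<lambda>w. cos (Y w)) = exp (- expectation (\<lambda>w. (Y w)\<^sup>2) / 2)"
    and eval_span_sin: "expectation (\<lambda>w. sin (Y w)) = 0"
  using centred_gaussian_rv[OF eval_span_gaussian eval_span_expectation, OF assms assms] by blast+

lemma expectation_lin_eval:
  assumes "finite J" "J \<subseteq> {0..}" "0 \<le> x"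
  shows "expectation (\<lambda>w. (\<Sum>t\<in>J. a t * w t) * w x) = (\<Sum>t\<in>J. a t * fbm_cov H t x)"
proof -
  have "expectation (\<lambda>w. (\<Sum>t\<in>J. a t * w t) * w x) = expectation (\<lambda>w. \<Sum>t\<in>J. a t * (w t * w x))"
    by (simp add: sum_distrib_right mult.assoc)
  also have "\<dots> = (\<Sum>t\<in>J. a t * expectation (\<lambda>w. w t * w x))"
    using assms eval_square_integrable
    by (subst Bochner_Integration.integral_sum) (auto intro!: integrable_mult_of_squares integrable_mult_right)
  finally show ?thesis using assms expectation_eval_mult by (auto intro!: sum.cong)
qed

lemma expectation_lin_square:
  assumes "finite J" "J \<subseteq> {0..}"
  shows "expectation (\<lambda>w. (\<Sum>t\<in>J. a t * w t)\<^sup>2) = (\<Sum>t\<in>J. \<Sum>s\<in>J. a t * a s * fbm_cov H t s)"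
proof -
  have Y: "(\<lambda>w. \<Sum>t\<in>J. a t * w t) \<in> eval_span" using assms by (auto simp: eval_span_def)
  have "expectation (\<lambda>w. (\<Sum>t\<in>J. a t * w t)\<^sup>2) = expectation (\<lambda>w. \<Sum>s\<in>J. a s * ((\<Sum>t\<in>J. a t * w t) * w s))"
    by (simp add: sum_distrib_left power2_eq_square mult_ac)
  also have "\<dots> = (\<Sum>s\<in>J. a s * expectation (\<lambda>w. (\<Sum>t\<in>J. a t * w t) * w s))"
    using assms eval_square_integrable eval_span_square_integrable[OF Y] eval_span_measurable[OF Y]
    by (subst Bochner_Integration.integral_sum) (auto intro!: integrable_mult_of_squares integrable_mult_right)
  also have "\<dots> = (\<Sum>s\<in>J. \<Sum>t\<in>J. a t * a s * fbm_cov H t s)"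
  proof (intro sum.cong refl)
    fix s assume "s \<in> J"
    then have "0 \<le> s" using assms by auto
    show "a s * expectation (\<lambda>w. (\<Sum>t\<in>J. a t * w t) * w s) = (\<Sum>t\<in>J. a t * a s * fbm_cov H t s)"
      unfolding expectation_lin_eval[OF assms \<open>0 \<le> s\<close>] by (simp add: sum_distrib_left mult_ac)
  qed
  also have "\<dots> = (\<Sum>t\<in>J. \<Sum>s\<in>J. a t * a s * fbm_cov H t s)" by (rule sum.swap)
  finally show ?thesis .
qed

lemma fbm_cov_diag: "0 \<le> t \<Longrightarrow> fbm_cov H t t = t powr (2 * H)"
  by (simp add: fbm_cov_def)

lemma expectation_increment_square:
  assumes "0 \<le> t" "0 \<le> s"
  shows "expectation (\<lambda>w. (w t - w s)\<^sup>2) = \<bar>t - s\<bar> powr (2 * H)"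
proof -
  have "expectation (\<lambda>w. (w t - w s)\<^sup>2) = expectation (\<lambda>w. w t * w t + (w s * w s - 2 * (w t * w s)))"
    by (simp add: power2_eq_square algebra_simps)
  also have "\<dots> = fbm_cov H t t + (fbm_cov H s s - 2 * fbm_cov H t s)"
    using integrable_mult_of_squares[of "\<lambda>w. w t" "\<lambda>w. w s"] eval_square_integrable assms
    by (simp add: expectation_eval_mult flip: power2_eq_square)
       (simp add: expectation_eval_mult power2_eq_square)
  finally show ?thesis using assms by (simp add: fbm_cov_diag) (simp add: fbm_cov_def field_simps)
qed

text \<open>
  The first Wiener chaos.
\<close>

definition L2_closure :: "((real \<Rightarrow> real) \<Rightarrow> real) set" where
  "L2_closure = {X \<in> borel_measurable P. \<exists>Y. (\<forall>n. Y n \<in> eval_span \<and> integrable P (\<lambda>w. (Y n w - X w)\<^sup>2)) \<and>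
     (\<lambda>n. expectation (\<lambda>w. (Y n w - X w)\<^sup>2)) \<longlonglongrightarrow> 0}"

lemma
  assumes "X \<in> L2_closure"
  shows L2_closure_measurable: "X \<in> borel_measurable P"
    and L2_closure_square_integrable: "integrable P (\<lambda>w. (X w)\<^sup>2)"
    and L2_closure_cos: "expectation (\<lambda>w. cos (X w)) = exp (- expectation (\<lambda>w. (X w)\<^sup>2) / 2)"
    and L2_closure_sin: "expectation (\<lambda>w. sin (X w)) = 0"
proof -
  show 1: "X \<in> borel_measurable P" using assms by (simp add: L2_closure_def)
  obtain Y where Y: "\<And>n. Y n \<in> eval_span" "\<And>n. integrable P (\<lambda>w. (Y n w - X w)\<^sup>2)"
    "(\<lambda>n. expectation (\<lambda>w. (Y n w - X w)\<^sup>2)) \<longlonglongrightarrow> 0"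
    using assms unfolding L2_closure_def by blast
  note * = gaussian_L2_limit[OF 1 eval_span_measurable[OF Y(1)] eval_span_square_integrable[OF Y(1)] Y(2,3)
      eval_span_cos[OF Y(1)] eval_span_sin[OF Y(1)]]
  show "integrable P (\<lambda>w. (X w)\<^sup>2)" "expectation (\<lambda>w. cos (X w)) = exp (- expectation (\<lambda>w. (X w)\<^sup>2) / 2)"
    "expectation (\<lambda>w. sin (X w)) = 0"
    using * by blast+
qed

lemma eval_span_add_L2_closure:
  assumes "Z \<in> eval_span" "X \<in> L2_closure"
  shows "(\<lambda>w. Z w + c * X w) \<in> L2_closure"
proof -
  obtain Y where Y: "\<And>n. Y n \<in> eval_span" "\<And>n. integrable P (\<lambda>w. (Y n w - X w)\<^sup>2)"
    "(\<lambda>n. expectation (\<lambda>w. (Y n w - X w)\<^sup>2)) \<longlonglongrightarrow> 0"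
    using assms unfolding L2_closure_def by blast
  have eq: "(Z w + c * Y n w - (Z w + c * X w))\<^sup>2 = c\<^sup>2 * (Y n w - X w)\<^sup>2" for n w
    by (simp add: power2_eq_square algebra_simps)
  have "(\<lambda>n. c\<^sup>2 * expectation (\<lambda>w. (Y n w - X w)\<^sup>2)) \<longlonglongrightarrow> 0"
    using tendsto_mult_right_zero[OF Y(3)] .
  moreover have "(\<lambda>w. Z w + c * X w) \<in> borel_measurable P"
    using eval_span_measurable[OF assms(1)] L2_closure_measurable[OF assms(2)] by measurable
  ultimately show ?thesis
    unfolding L2_closure_def using eval_span_add[OF assms(1) Y(1)] Y(2)
    by (intro CollectI conjI exI[of _ "\<lambda>n w. Z w + c * Y n w"]) (simp_all only: eq simp_thms integrable_mult_right Bochner_Integration.integral_mult_right_zero)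
qed

text \<open>
  As in the Riesz--Fischer theorem, a subsequence converges almost surely, and Fatou's lemma turns the
  Cauchy property into convergence to this almost sure limit.
\<close>

lemma L2_closure_complete:
  assumes Y: "\<And>n. Y n \<in> eval_span"
    and cauchy: "\<And>\<epsilon>. 0 < \<epsilon> \<Longrightarrow> \<exists>N. \<forall>m\<ge>N. \<forall>n\<ge>N. sqrt (expectation (\<lambda>w. (Y m w - Y n w)\<^sup>2)) < \<epsilon>"
  shows "\<exists>X\<in>L2_closure. (\<forall>n. integrable P (\<lambda>w. (Y n w - X w)\<^sup>2)) \<and>
     (\<lambda>n. expectation (\<lambda>w. (Y n w - X w)\<^sup>2)) \<longlonglongrightarrow> 0"
proof -
  note [measurable] = eval_span_measurable[OF Y]
  have diff_lin: "(\<lambda>w. Y m w - Y n w) \<in> eval_span" for m n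
    using eval_span_add[OF Y[of m] Y[of n], of "- 1"] by simp
  have sq: "integrable P (\<lambda>w. (Y m w - Y n w)\<^sup>2)" for m n
    by (rule eval_span_square_integrable[OF diff_lin])
  have L1: "\<exists>N. \<forall>i\<ge>N. \<forall>j\<ge>N. expectation (\<lambda>w. norm (Y i w - Y j w)) < e" if "0 < e" for e
  proof -
    have "expectation (\<lambda>w. \<bar>Y i w - Y j w\<bar>) \<le> sqrt (expectation (\<lambda>w. (Y i w - Y j w)\<^sup>2))" for i j
      using expectation_Cauchy_Schwarz[of "\<lambda>w. \<bar>Y i w - Y j w\<bar>" "\<lambda>_. 1"] sq[of i j] prob_space by simp
    then show ?thesis using cauchy[OF that] unfolding real_norm_def by (meson le_less_trans)
  qed
  obtain r where r: "strict_mono r" "AE w in P. Cauchy (\<lambda>i. Y (r i) w)"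
    using cauchy_L1_AE_cauchy_subseq[OF integrable_of_square[OF eval_span_measurable[OF Y] eval_span_square_integrable[OF Y]] L1]
    by blast
  define X where "X w = lim (\<lambda>i. Y (r i) w)" for w
  have [measurable]: "X \<in> borel_measurable P"
    unfolding X_def[abs_def] by measurable
  have X: "AE w in P. (\<lambda>i. Y (r i) w) \<longlonglongrightarrow> X w"
    using r(2) by eventually_elim (simp add: X_def Cauchy_convergent_iff convergent_LIMSEQ_iff)
  have fatou: "(\<integral>\<^sup>+w. ennreal ((Y n w - X w)\<^sup>2) \<partial>P) \<le> ennreal (\<epsilon>\<^sup>2)"
    if N: "\<forall>m\<ge>N. \<forall>n\<ge>N. sqrt (expectation (\<lambda>w. (Y m w - Y n w)\<^sup>2)) < \<epsilon>" and n: "N \<le> n" for n N \<epsilon>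
  proof -
    have "(\<integral>\<^sup>+w. ennreal ((Y n w - X w)\<^sup>2) \<partial>P)
        = (\<integral>\<^sup>+w. liminf (\<lambda>i. ennreal ((Y n w - Y (r i) w)\<^sup>2)) \<partial>P)"
    proof (rule nn_integral_cong_AE)
      show "AE w in P. ennreal ((Y n w - X w)\<^sup>2) = liminf (\<lambda>i. ennreal ((Y n w - Y (r i) w)\<^sup>2))"
        using X
      proof eventually_elim
        case (elim w)
        then have "(\<lambda>i. ennreal ((Y n w - Y (r i) w)\<^sup>2)) \<longlonglongrightarrow> ennreal ((Y n w - X w)\<^sup>2)"
          by (intro tendsto_intros)
        then show ?case by (rule lim_imp_Liminf[symmetric, OF sequentially_bot])
      qed
    qed
    also have "\<dots> \<le> liminf (\<lambda>i. \<integral>\<^sup>+w. ennreal ((Y n w - Y (r i) w)\<^sup>2) \<partial>P)"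
      by (rule nn_integral_liminf) measurable
    also have "\<dots> \<le> liminf (\<lambda>i. ennreal (\<epsilon>\<^sup>2))"
    proof (rule Liminf_mono)
      show "\<forall>\<^sub>F i in sequentially. (\<integral>\<^sup>+w. ennreal ((Y n w - Y (r i) w)\<^sup>2) \<partial>P) \<le> ennreal (\<epsilon>\<^sup>2)"
        using eventually_ge_at_top[of N]
      proof eventually_elim
        case (elim i)
        then have "N \<le> r i" using seq_suble[OF r(1), of i] by linarith
        then have s: "sqrt (expectation (\<lambda>w. (Y n w - Y (r i) w)\<^sup>2)) < \<epsilon>" using N n by blast
        have "expectation (\<lambda>w. (Y n w - Y (r i) w)\<^sup>2) \<le> \<epsilon>\<^sup>2"
          using s power_mono[OF less_imp_le[OF s], of 2] by simp
        then show ?case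
          by (subst nn_integral_eq_integral[OF sq]) (auto intro: ennreal_leI)
      qed
    qed
    finally show ?thesis by (simp add: Liminf_const)
  qed
  have iN: "integrable P (\<lambda>w. (Y n w - X w)\<^sup>2)" if "\<forall>m\<ge>N. \<forall>n\<ge>N. sqrt (expectation (\<lambda>w. (Y m w - Y n w)\<^sup>2)) < \<epsilon>" "N \<le> n" for n N \<epsilon>
  proof (rule integrableI_nonneg)
    show "(\<integral>\<^sup>+w. ennreal ((Y n w - X w)\<^sup>2) \<partial>P) < \<infinity>"
      by (rule le_less_trans[OF fatou[OF that]]) simp
  qed auto
  have int: "integrable P (\<lambda>w. (Y n w - X w)\<^sup>2)" for n
  proof -
    obtain N where N: "\<forall>m\<ge>N. \<forall>n\<ge>N. sqrt (expectation (\<lambda>w. (Y m w - Y n w)\<^sup>2)) < 1"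
      using cauchy[of 1] by auto
    have "integrable P (\<lambda>w. ((Y n w - Y N w) + 1 * (Y N w - X w))\<^sup>2)"
      by (rule integrable_square_add) (use sq iN[OF N order_refl] in auto)
    then show ?thesis by simp
  qed
  have lim: "(\<lambda>n. expectation (\<lambda>w. (Y n w - X w)\<^sup>2)) \<longlonglongrightarrow> 0"
  proof (rule LIMSEQ_I)
    fix e :: real assume e: "0 < e"
    define \<epsilon> where "\<epsilon> = sqrt (e / 2)"
    have "\<epsilon> > 0" using e by (simp add: \<epsilon>_def)
    then obtain N where N: "\<forall>m\<ge>N. \<forall>n\<ge>N. sqrt (expectation (\<lambda>w. (Y m w - Y n w)\<^sup>2)) < \<epsilon>"
      using cauchy by blast
    have "norm (expectation (\<lambda>w. (Y n w - X w)\<^sup>2) - 0) < e" if "N \<le> n" for n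
    proof -
      have "ennreal (expectation (\<lambda>w. (Y n w - X w)\<^sup>2)) \<le> ennreal (\<epsilon>\<^sup>2)"
        using fatou[OF N that] by (subst (asm) nn_integral_eq_integral[OF int]) auto
      then have "expectation (\<lambda>w. (Y n w - X w)\<^sup>2) \<le> \<epsilon>\<^sup>2" by (simp add: ennreal_le_iff)
      then show ?thesis using e by (simp add: \<epsilon>_def)
    qed
    then show "\<exists>N. \<forall>n\<ge>N. norm (expectation (\<lambda>w. (Y n w - X w)\<^sup>2) - 0) < e" by blast
  qed
  show ?thesis
  proof (intro bexI[of _ X] conjI allI int lim)
    show "X \<in> L2_closure" unfolding L2_closure_def using Y int lim by auto
  qed
qed

text \<open>
  The norm on the coefficient families is the \<open>L\<^sup>2\<close> norm of the corresponding combinations of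
  evaluations. So a Cauchy sequence of coefficient families defines a limit \<open>\<xi>\<close> in the first chaos,
  and the representation passes to the limit from the span, where it holds because the kernel is the
  covariance of the evaluations.
\<close>

lemma cameron_martin_representation:
  assumes "h \<in> cameron_martin H"
  shows "\<exists>\<xi>\<in>L2_closure. (\<forall>t\<ge>0. h t = expectation (\<lambda>w. \<xi> w * w t)) \<and> (\<forall>t<0. h t = 0)"
proof -
  obtain c where c: "\<And>n. c n \<in> fin_coeffs"
     and cauchy: "\<And>\<epsilon>. \<epsilon> > 0 \<Longrightarrow> \<exists>N. \<forall>m\<ge>N. \<forall>n\<ge>N. span_norm H (\<lambda>t. c m t - c n t) < \<epsilon>"
     and lim: "\<And>x. (\<lambda>n. span_fun H (c n) x) \<longlonglongrightarrow> h x"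
    using assms unfolding cameron_martin_def by blast
  define J where "J n = {t. c n t \<noteq> 0}" for n
  have J: "finite (J n)" "J n \<subseteq> {0..}" for n using c[of n] by (auto simp: fin_coeffs_def J_def)
  define Y where "Y n w = (\<Sum>t\<in>J n. c n t * w t)" for n and w :: "real \<Rightarrow> real"
  have Y: "Y n \<in> eval_span" for n
    unfolding eval_span_def Y_def[abs_def] using J by blast
  have norm: "sqrt (expectation (\<lambda>w. (Y m w - Y n w)\<^sup>2)) = span_norm H (\<lambda>t. c m t - c n t)" for m n
  proof -
    define K where "K = {t. c m t - c n t \<noteq> 0}"
    have K: "K \<subseteq> J m \<union> J n" "finite K" "K \<subseteq> {0..}"
    proof -
      show sub: "K \<subseteq> J m \<union> J n" by (auto simp: K_def J_def)
      show "finite K" "K \<subseteq> {0..}" using finite_subset[OF sub] sub J[of m] J[of n] by auto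
    qed
    have "Y m w - Y n w = (\<Sum>t\<in>K. (c m t - c n t) * w t)" for w
    proof -
      have "Y m w = (\<Sum>t\<in>J m \<union> J n. c m t * w t)" "Y n w = (\<Sum>t\<in>J m \<union> J n. c n t * w t)"
        unfolding Y_def using J by (auto intro!: sum.mono_neutral_left simp: J_def)
      then have "Y m w - Y n w = (\<Sum>t\<in>J m \<union> J n. (c m t - c n t) * w t)"
        by (simp add: sum_subtractf left_diff_distrib)
      also have "\<dots> = (\<Sum>t\<in>K. (c m t - c n t) * w t)"
        using K J by (intro sum.mono_neutral_right) (auto simp: K_def)
      finally show ?thesis .
    qed
    then show ?thesis
      unfolding span_norm_def span_inner_def
      using expectation_lin_square[OF K(2,3), of "\<lambda>t. c m t - c n t"] by (simp add: K_def)
  qed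
  have "\<exists>X\<in>L2_closure. (\<forall>n. integrable P (\<lambda>w. (Y n w - X w)\<^sup>2)) \<and>
     (\<lambda>n. expectation (\<lambda>w. (Y n w - X w)\<^sup>2)) \<longlonglongrightarrow> 0"
    by (rule L2_closure_complete[OF Y]) (simp only: norm cauchy)
  then obtain \<xi> where \<xi>: "\<xi> \<in> L2_closure" "\<And>n. integrable P (\<lambda>w. (Y n w - \<xi> w)\<^sup>2)"
     "(\<lambda>n. expectation (\<lambda>w. (Y n w - \<xi> w)\<^sup>2)) \<longlonglongrightarrow> 0" by blast
  note [measurable] = L2_closure_measurable[OF \<xi>(1)] eval_span_measurable[OF Y]
  have "h t = expectation (\<lambda>w. \<xi> w * w t)" if t: "0 \<le> t" for t
  proof (rule LIMSEQ_unique[OF lim])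
    have sf: "span_fun H (c n) t = expectation (\<lambda>w. Y n w * w t)" for n
      unfolding span_fun_def Y_def using t J[of n] by (simp add: expectation_lin_eval) (simp add: J_def)
    have i: "integrable P (\<lambda>w. (Y n w - \<xi> w) * w t)" for n
      by (rule integrable_mult_of_squares) (use \<xi>(2) eval_square_integrable[OF t] in auto)
    have i2: "integrable P (\<lambda>w. \<xi> w * w t)"
      by (rule integrable_mult_of_squares)
         (use L2_closure_square_integrable[OF \<xi>(1)] eval_square_integrable[OF t] in auto)
    have eq: "expectation (\<lambda>w. Y n w * w t) = expectation (\<lambda>w. (Y n w - \<xi> w) * w t) + expectation (\<lambda>w. \<xi> w * w t)" for n
      using Bochner_Integration.integral_add[OF i[of n] i2] by (simp add: algebra_simps)
    have "(\<lambda>n. expectation (\<lambda>w. (Y n w - \<xi> w) * w t)) \<longlonglongrightarrow> 0"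
    proof (rule Lim_null_comparison[OF always_eventually], rule allI)
      show "norm (expectation (\<lambda>w. (Y n w - \<xi> w) * w t))
          \<le> sqrt (expectation (\<lambda>w. (Y n w - \<xi> w)\<^sup>2)) * sqrt (expectation (\<lambda>w. (w t)\<^sup>2))" for n
        unfolding real_norm_def
        by (rule expectation_Cauchy_Schwarz) (use \<xi>(2) eval_square_integrable[OF t] in auto)
      show "(\<lambda>n. sqrt (expectation (\<lambda>w. (Y n w - \<xi> w)\<^sup>2)) * sqrt (expectation (\<lambda>w. (w t)\<^sup>2))) \<longlonglongrightarrow> 0"
        using tendsto_real_sqrt[OF \<xi>(3)] by (intro tendsto_mult_left_zero) simp
    qed
    from tendsto_add[OF this tendsto_const]
    show "(\<lambda>n. span_fun H (c n) t) \<longlonglongrightarrow> expectation (\<lambda>w. \<xi> w * w t)"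
      unfolding sf eq by simp
  qed
  moreover have "h t = 0" if "t < 0" for t
    using lim[of t] that by (simp add: span_fun_def LIMSEQ_const_iff)
  ultimately show ?thesis using \<xi>(1) by blast
qed

text \<open>
  Both follow from the Cauchy--Schwarz inequality applied to \<open>\<xi>\<close> and an increment of the path.
\<close>

lemma
  assumes \<xi>: "\<xi> \<in> L2_closure"
    and h: "\<And>t. 0 \<le> t \<Longrightarrow> h t = expectation (\<lambda>w. \<xi> w * w t)" "\<And>t. t < 0 \<Longrightarrow> h t = 0"
  shows representation_bound: "0 \<le> t \<Longrightarrow> \<bar>h t\<bar> \<le> sqrt (expectation (\<lambda>w. (\<xi> w)\<^sup>2)) * t powr H"
    and representation_path: "h \<in> paths"
proof -
  define K where "K = sqrt (expectation (\<lambda>w. (\<xi> w)\<^sup>2))"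
  note m[measurable] = L2_closure_measurable[OF \<xi>]
  note i = L2_closure_square_integrable[OF \<xi>]
  have half: "sqrt (x powr (2 * H)) = x powr H" for x
    using powr_half_sqrt[of "x powr (2 * H)"] by (simp add: powr_powr)
  have inc: "\<bar>h t - h s\<bar> \<le> K * \<bar>t - s\<bar> powr H" if "0 \<le> t" "0 \<le> s" for t s
  proof -
    have "integrable P (\<lambda>w. \<xi> w * w u)" if "0 \<le> u" for u
      by (rule integrable_mult_of_squares) (use i eval_square_integrable[OF that] in auto)
    then have "h t - h s = expectation (\<lambda>w. \<xi> w * (w t - w s))"
      using that by (simp add: h right_diff_distrib)
    also have "\<bar>\<dots>\<bar> \<le> K * sqrt (expectation (\<lambda>w. (w t - w s)\<^sup>2))"
      unfolding K_def
      by (rule expectation_Cauchy_Schwarz)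
         (use i integrable_square_add[of "\<lambda>w. w t" "\<lambda>w. w s" "- 1"] eval_square_integrable that in auto)
    finally show ?thesis using that by (simp add: expectation_increment_square half)
  qed
  have w0: "AE w in P. w 0 = 0" by (rule AE_I2) (simp add: paths_def)
  have h0: "h 0 = 0"
  proof -
    have "expectation (\<lambda>w. \<xi> w * w 0) = expectation (\<lambda>w. 0)"
      by (rule integral_cong_AE) (use w0 in auto)
    then show ?thesis by (simp add: h)
  qed
  show "\<bar>h t\<bar> \<le> sqrt (expectation (\<lambda>w. (\<xi> w)\<^sup>2)) * t powr H" if "0 \<le> t"
    using inc[OF that, of 0] that h0 by (simp add: K_def)
  have "continuous_on {0..} h"
  unfolding continuous_on
  proof
    fix s :: real assume s: "s \<in> {0..}"
    have "((\<lambda>t. h t - h s) \<longlongrightarrow> 0) (at s within {0..})"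
    proof (rule Lim_null_comparison)
      show "\<forall>\<^sub>F t in at s within {0..}. norm (h t - h s) \<le> K * \<bar>t - s\<bar> powr H"
        unfolding eventually_at_filter using inc s by (intro always_eventually) auto
      have "((\<lambda>t. K * \<bar>t - s\<bar> powr H) \<longlongrightarrow> K * \<bar>s - s\<bar> powr H) (at s within {0..})"
        by (intro tendsto_intros tendsto_powr') (use H in auto)
      then show "((\<lambda>t. K * \<bar>t - s\<bar> powr H) \<longlongrightarrow> 0) (at s within {0..})" by simp
    qed
    then show "(h \<longlongrightarrow> h s) (at s within {0..})" by (simp add: LIM_zero_iff)
  qed
  then show "h \<in> paths" using h0 h(2) by (auto simp: paths_def)
qed

end

section \<open>The small-scale law of large numbers\<close>

lemma sum_geometric_distance_le:
  fixes r :: real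
  assumes "0 \<le> r" "r < 1"
  shows "(\<Sum>m<N. \<Sum>n<N. r ^ (if m \<le> n then n - m else m - n)) \<le> real N * (2 / (1 - r))"
proof -
  have s: "summable (\<lambda>k. r ^ k)" using assms by (intro summable_geometric) auto
  have part: "(\<Sum>k\<in>A. r ^ k) \<le> 1 / (1 - r)" if "finite A" for A
    using sum_le_suminf[OF s that] assms suminf_geometric[of r] by simp
  have "(\<Sum>n<N. r ^ (if m \<le> n then n - m else m - n)) \<le> 2 / (1 - r)" for m
  proof -
    let ?A = "{..<N} \<inter> {n. m \<le> n}" and ?B = "{..<N} \<inter> - {n. m \<le> n}"
    have "(\<Sum>n<N. r ^ (if m \<le> n then n - m else m - n))
        = (\<Sum>n<N. if m \<le> n then r ^ (n - m) else r ^ (m - n))"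
      by (intro sum.cong) auto
    also have "\<dots> = (\<Sum>n\<in>?A. r ^ (n - m)) + (\<Sum>n\<in>?B. r ^ (m - n))"
      by (rule sum.If_cases) simp
    also have "(\<Sum>n\<in>?A. r ^ (n - m)) = (\<Sum>k\<in>(\<lambda>n. n - m) ` ?A. r ^ k)"
      by (subst sum.reindex) (auto simp: inj_on_def)
    also have "(\<Sum>n\<in>?B. r ^ (m - n)) = (\<Sum>k\<in>(\<lambda>n. m - n) ` ?B. r ^ k)"
      by (subst sum.reindex) (auto simp: inj_on_def)
    also have "(\<Sum>k\<in>(\<lambda>n. n - m) ` ?A. r ^ k) + \<dots> \<le> 1 / (1 - r) + 1 / (1 - r)"
      by (intro add_mono part) auto
    finally show ?thesis by simp
  qed
  then have "(\<Sum>m<N. \<Sum>n<N. r ^ (if m \<le> n then n - m else m - n)) \<le> (\<Sum>m<N. 2 / (1 - r))"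
    by (intro sum_mono)
  then show ?thesis by simp
qed

lemma fbm_cov_nonneg:
  assumes "0 < H" "0 \<le> t" "0 \<le> s"
  shows "0 \<le> fbm_cov H t s"
proof -
  have "\<bar>t - s\<bar> powr (2 * H) \<le> max t s powr (2 * H)"
    using assms by (intro powr_mono2) auto
  also have "\<dots> \<le> t powr (2 * H) + s powr (2 * H)" by (simp add: max_def)
  finally show ?thesis by (simp add: fbm_cov_def)
qed

lemma fbm_cov_scale:
  assumes "0 \<le> u" "0 \<le> t" "0 \<le> s"
  shows "fbm_cov H (u * t) (u * s) = u powr (2 * H) * fbm_cov H t s"
proof -
  have "\<bar>u * t - u * s\<bar> = u * \<bar>t - s\<bar>"
    using assms by (simp add: abs_mult flip: right_diff_distrib)
  then show ?thesis using assms by (simp add: fbm_cov_def powr_mult algebra_simps)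
qed

text \<open>
  A bound of order \<open>x\<close> is what matters: the standard deviation at time \<open>x\<close> is \<open>x powr H\<close>, so that for
  \<open>H < 1\<close> the correlation with the value at time \<open>1\<close> tends to zero.
\<close>

lemma fbm_cov_1_le:
  assumes "1 / 2 < H" "H < 1" "0 < x" "x \<le> 1"
  shows "fbm_cov H 1 x \<le> 3 / 2 * x"
proof -
  have "x powr (2 * H) \<le> x powr 1" using assms by (intro powr_mono') auto
  then have 1: "x powr (2 * H) \<le> x" using assms by simp
  have "(1 - x) powr 2 \<le> (1 - x) powr (2 * H)" using assms by (intro powr_mono') auto
  then have "(1 - x)\<^sup>2 \<le> (1 - x) powr (2 * H)" using assms by (cases "x = 1") (auto simp: powr_numeral)
  moreover have "1 - 2 * x \<le> (1 - x)\<^sup>2" by (simp add: power2_eq_square algebra_simps)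
  ultimately show ?thesis using 1 assms by (simp add: fbm_cov_def)
qed

text \<open>
  The left-hand side is the covariance of the cosines of two centred Gaussian variables that have
  variance \<open>v\<close> and covariance \<open>c\<close>.
\<close>

lemma exp_cosh_bound:
  assumes "0 \<le> c" "c \<le> (v::real)"
  shows "(exp (- (v + c)) + exp (- (v - c))) / 2 - exp (- v) \<le> c"
proof -
  have "exp (- (v + c)) \<le> exp (- (v - c))" using assms by simp
  then have "(exp (- (v + c)) + exp (- (v - c))) / 2 - exp (- v) \<le> exp (- (v - c)) - exp (- v)" by simp
  also have "\<dots> = exp (- (v - c)) * (1 - exp (- c))"
    by (simp add: right_diff_distrib flip: exp_add)
  also have "\<dots> \<le> 1 * c"
    using exp_ge_add_one_self[of "- c"] assms by (intro mult_mono) auto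
  finally show ?thesis by simp
qed

context fractional_brownian_motion
begin

text \<open>
  By self-similarity all these variables have the variance \<open>s powr (2 * H)\<close>.
\<close>

definition rescaled :: "real \<Rightarrow> nat \<Rightarrow> (real \<Rightarrow> real) \<Rightarrow> real" where
  "rescaled s n w = 2 powr (real n * H) * w (s / 2 ^ n)"

definition cos_mean :: "real \<Rightarrow> nat \<Rightarrow> (real \<Rightarrow> real) \<Rightarrow> real" where
  "cos_mean s N w = (\<Sum>n<N. cos (rescaled s n w)) / real N"

lemma rescaled_measurable [measurable]: "rescaled s n \<in> borel_measurable P"
  unfolding rescaled_def[abs_def] by measurable

lemma rescaled_cov:
  assumes "0 \<le> s"
  shows "expectation (\<lambda>w. rescaled s m w * rescaled s n w)
     = 2 powr (real m * H) * 2 powr (real n * H) * fbm_cov H (s / 2 ^ m) (s / 2 ^ n)"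
proof -
  have "expectation (\<lambda>w. rescaled s m w * rescaled s n w)
     = expectation (\<lambda>w. (2 powr (real m * H) * 2 powr (real n * H)) * (w (s / 2 ^ m) * w (s / 2 ^ n)))"
    by (simp add: rescaled_def mult_ac)
  then show ?thesis using assms by (simp add: expectation_eval_mult)
qed

lemma rescaled_cov_add:
  assumes "0 \<le> s"
  shows "expectation (\<lambda>w. rescaled s m w * rescaled s (m + d) w)
     = s powr (2 * H) * (2 powr (real d * H) * fbm_cov H 1 (1 / 2 ^ d))"
proof -
  define u where "u = s / 2 ^ m"
  have u: "s / 2 ^ m = u * 1" "s / 2 ^ (m + d) = u * (1 / 2 ^ d)" "0 \<le> u"
    using assms by (simp_all add: u_def power_add)
  have "s powr (2 * H) = (2 ^ m * u) powr (2 * H)" by (simp add: u_def)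
  also have "\<dots> = 2 powr (real m * H) * 2 powr (real m * H) * u powr (2 * H)"
    using u(3) by (simp add: powr_mult powr_powr powr_realpow[symmetric] flip: powr_add) (simp add: algebra_simps)
  finally have s: "s powr (2 * H) = 2 powr (real m * H) * 2 powr (real m * H) * u powr (2 * H)" .
  have p: "2 powr (real (m + d) * H) = 2 powr (real m * H) * 2 powr (real d * H)"
    by (simp add: distrib_right powr_add)
  have "fbm_cov H (u * 1) (u * (1 / 2 ^ d)) = u powr (2 * H) * fbm_cov H 1 (1 / 2 ^ d)"
    by (rule fbm_cov_scale) (use u(3) in auto)
  then show ?thesis
    unfolding rescaled_cov[OF assms] u(1,2) s p by simp
qed

lemma rescaled_variance:
  assumes "0 \<le> s"
  shows "expectation (\<lambda>w. (rescaled s m w)\<^sup>2) = s powr (2 * H)"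
  using rescaled_cov_add[OF assms, of m 0] by (simp add: power2_eq_square fbm_cov_diag)

lemma rescaled_lin: "0 \<le> s \<Longrightarrow> rescaled s n \<in> eval_span"
  unfolding rescaled_def[abs_def] by (rule eval_span_eval) simp

text \<open>
  The last bound decays geometrically in the distance of the scales because \<open>H < 1\<close>.
\<close>

lemma rescaled_cov_bounds:
  assumes s: "0 \<le> s"
  defines "c \<equiv> (\<lambda>m n. expectation (\<lambda>w. rescaled s m w * rescaled s n w))"
  shows "0 \<le> c m n" and "c m n \<le> s powr (2 * H)"
    and "c m n \<le> 3 / 2 * s powr (2 * H) * (2 powr (H - 1)) ^ (if m \<le> n then n - m else m - n)"
proof -
  show "0 \<le> c m n"
    unfolding c_def rescaled_cov[OF s] using s H by (intro mult_nonneg_nonneg fbm_cov_nonneg) auto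
  have "c m n \<le> sqrt (expectation (\<lambda>w. (rescaled s m w)\<^sup>2)) * sqrt (expectation (\<lambda>w. (rescaled s n w)\<^sup>2))"
    unfolding c_def
    using expectation_Cauchy_Schwarz[of "rescaled s m" "rescaled s n"] eval_span_square_integrable[OF rescaled_lin[OF s]]
    by (simp add: abs_le_iff)
  then show "c m n \<le> s powr (2 * H)"
    by (simp add: rescaled_variance[OF s])
  have bound: "c k (k + d) \<le> 3 / 2 * s powr (2 * H) * (2 powr (H - 1)) ^ d" for k d
  proof -
    have "c k (k + d) = s powr (2 * H) * (2 powr (real d * H) * fbm_cov H 1 (1 / 2 ^ d))"
      unfolding c_def by (rule rescaled_cov_add[OF s])
    also have "\<dots> \<le> s powr (2 * H) * (2 powr (real d * H) * (3 / 2 * (1 / 2 ^ d)))"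
      using H by (intro mult_left_mono fbm_cov_1_le) auto
    also have "2 powr (real d * H) * (3 / 2 * (1 / 2 ^ d)) = 3 / 2 * (2 powr (H - 1)) ^ d"
    proof -
      have "(2 powr (H - 1)) ^ d = (2 powr H) ^ d / 2 ^ d" by (simp add: powr_diff power_divide)
      also have "(2 powr H) ^ d = 2 powr (real d * H)"
        by (subst powr_realpow[symmetric]) (simp_all add: powr_powr mult.commute)
      finally show ?thesis by simp
    qed
    finally show ?thesis by (simp add: mult_ac)
  qed
  show "c m n \<le> 3 / 2 * s powr (2 * H) * (2 powr (H - 1)) ^ (if m \<le> n then n - m else m - n)"
  proof (cases "m \<le> n")
    case True
    then show ?thesis using bound[of m "n - m"] by simp
  next
    case False
    moreover have "c m n = c n m" by (simp add: c_def mult.commute)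
    ultimately show ?thesis using bound[of n "m - n"] by simp
  qed
qed

lemma cos_rescaled_cov:
  assumes s: "0 \<le> s"
  shows "expectation (\<lambda>w. (cos (rescaled s m w) - exp (- (s powr (2 * H)) / 2)) * (cos (rescaled s n w) - exp (- (s powr (2 * H)) / 2)))
    \<le> 3 / 2 * s powr (2 * H) * (2 powr (H - 1)) ^ (if m \<le> n then n - m else m - n)"
proof -
  define v where "v = s powr (2 * H)"
  define e where "e = exp (- v / 2)"
  define c where "c = expectation (\<lambda>w. rescaled s m w * rescaled s n w)"
  have ee: "e * e = exp (- v)" by (simp add: e_def flip: exp_add)
  have i: "integrable P (\<lambda>w. cos (X w))" if [measurable]: "X \<in> borel_measurable P" for X :: "_ \<Rightarrow> real"
    by (rule integrable_const_bound[where B = 1]) auto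
  have i2: "integrable P (\<lambda>w. cos (rescaled s m w) * cos (rescaled s n w))"
    by (rule integrable_const_bound[where B = 1]) (auto simp: abs_mult intro!: mult_le_one)
  have E: "expectation (\<lambda>w. cos (rescaled s k w)) = e" for k
    using eval_span_cos[OF rescaled_lin[OF s]] by (simp add: rescaled_variance[OF s] e_def v_def)
  have sq: "expectation (\<lambda>w. (rescaled s m w + \<delta> * rescaled s n w)\<^sup>2) = 2 * (v + \<delta> * c)" if "\<delta>\<^sup>2 = 1" for \<delta>
  proof -
    have eq: "(rescaled s m w + \<delta> * rescaled s n w)\<^sup>2
        = (rescaled s m w)\<^sup>2 + (rescaled s n w)\<^sup>2 + 2 * \<delta> * (rescaled s m w * rescaled s n w)" for w
    proof -
      have "(rescaled s m w + \<delta> * rescaled s n w)\<^sup>2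
        = (rescaled s m w)\<^sup>2 + \<delta>\<^sup>2 * (rescaled s n w)\<^sup>2 + 2 * \<delta> * (rescaled s m w * rescaled s n w)"
        by (simp add: power2_eq_square algebra_simps)
      then show ?thesis using that by simp
    qed
    have "integrable P (\<lambda>w. rescaled s m w * rescaled s n w)"
      by (rule integrable_mult_of_squares) (use eval_span_square_integrable[OF rescaled_lin[OF s]] in auto)
    then show ?thesis
      unfolding eq using eval_span_square_integrable[OF rescaled_lin[OF s]]
      by (simp add: rescaled_variance[OF s] v_def c_def)
  qed
  have cosE: "expectation (\<lambda>w. cos (rescaled s m w + \<delta> * rescaled s n w)) = exp (- (v + \<delta> * c))" if "\<delta>\<^sup>2 = 1" for \<delta>
    using eval_span_cos[OF eval_span_add[OF rescaled_lin[OF s] rescaled_lin[OF s], of m \<delta> n]]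
    unfolding sq[OF that] by simp
  have "expectation (\<lambda>w. cos (rescaled s m w) * cos (rescaled s n w))
      = expectation (\<lambda>w. (cos (rescaled s m w + (- 1) * rescaled s n w) + cos (rescaled s m w + 1 * rescaled s n w)) / 2)"
    by (simp add: cos_times_cos)
  also have "\<dots> = (exp (- (v + c)) + exp (- (v - c))) / 2"
    using cosE[of 1] cosE[of "- 1"] i[of "\<lambda>w. rescaled s m w + rescaled s n w"] i[of "\<lambda>w. rescaled s m w - rescaled s n w"]
    by simp
  finally have cc: "expectation (\<lambda>w. cos (rescaled s m w) * cos (rescaled s n w)) = (exp (- (v + c)) + exp (- (v - c))) / 2" .
  have "expectation (\<lambda>w. (cos (rescaled s m w) - e) * (cos (rescaled s n w) - e))
      = expectation (\<lambda>w. cos (rescaled s m w) * cos (rescaled s n w)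
          - e * cos (rescaled s m w) - e * cos (rescaled s n w) + e * e)"
    by (intro Bochner_Integration.integral_cong refl) (simp add: algebra_simps)
  also have "\<dots> = (exp (- (v + c)) + exp (- (v - c))) / 2 - exp (- v)"
    using i i2 prob_space by (simp add: E cc ee)
  also have "\<dots> \<le> c"
    using rescaled_cov_bounds[OF s, of m n] by (intro exp_cosh_bound) (auto simp: c_def v_def)
  also have "\<dots> \<le> 3 / 2 * s powr (2 * H) * (2 powr (H - 1)) ^ (if m \<le> n then n - m else m - n)"
    unfolding c_def by (rule rescaled_cov_bounds(3)[OF s])
  finally show ?thesis by (simp only: e_def v_def)
qed

text \<open>
  A weak law of large numbers for weakly correlated variables. Cosines are averaged instead of squares
  because their covariances follow from the characteristic functions, without fourth moments.
\<close>

lemma cos_mean_L2_error: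
  assumes s: "0 \<le> s" and N: "0 < N"
  shows "expectation (\<lambda>w. (cos_mean s N w - exp (- (s powr (2 * H)) / 2))\<^sup>2)
     \<le> (3 / (1 - 2 powr (H - 1))) * s powr (2 * H) / real N"
proof -
  define e where "e = exp (- (s powr (2 * H)) / 2)"
  define r where "r = 2 powr (H - 1)"
  have r: "0 \<le> r" "r < 1" using H by (auto simp: r_def powr_less_one)
  have eq: "(cos_mean s N w - e)\<^sup>2
      = (\<Sum>m<N. \<Sum>n<N. (cos (rescaled s m w) - e) * (cos (rescaled s n w) - e)) / (real N)\<^sup>2" for w
  proof -
    have "cos_mean s N w - e = (\<Sum>n<N. cos (rescaled s n w) - e) / real N"
      using N by (simp add: cos_mean_def sum_subtractf diff_divide_distrib)
    then show ?thesis by (simp add: power_divide power2_eq_square sum_product)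
  qed
  have b: "\<bar>cos x - e\<bar> \<le> 2" for x
  proof -
    have "0 \<le> e" "e \<le> 1" by (simp_all add: e_def)
    then show ?thesis using abs_cos_le_one[of x] by linarith
  qed
  have i: "integrable P (\<lambda>w. (cos (rescaled s m w) - e) * (cos (rescaled s n w) - e))" for m n
  proof (rule integrable_const_bound[where B = "2 * 2"])
    show "AE w in P. norm ((cos (rescaled s m w) - e) * (cos (rescaled s n w) - e)) \<le> 2 * 2"
      unfolding real_norm_def abs_mult by (intro AE_I2 mult_mono b) auto
  qed measurable
  have "expectation (\<lambda>w. (cos_mean s N w - e)\<^sup>2)
      = (\<Sum>m<N. \<Sum>n<N. expectation (\<lambda>w. (cos (rescaled s m w) - e) * (cos (rescaled s n w) - e))) / (real N)\<^sup>2"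
    unfolding eq using i by simp
  also have "\<dots> \<le> (\<Sum>m<N. \<Sum>n<N. 3 / 2 * s powr (2 * H) * r ^ (if m \<le> n then n - m else m - n)) / (real N)\<^sup>2"
    unfolding e_def r_def by (intro divide_right_mono sum_mono cos_rescaled_cov s) simp
  also have "\<dots> = 3 / 2 * s powr (2 * H) * (\<Sum>m<N. \<Sum>n<N. r ^ (if m \<le> n then n - m else m - n)) / (real N)\<^sup>2"
    by (simp only: sum_distrib_left)
  also have "\<dots> \<le> 3 / 2 * s powr (2 * H) * (real N * (2 / (1 - r))) / (real N)\<^sup>2"
    using r by (intro divide_right_mono mult_left_mono sum_geometric_distance_le) auto
  also have "\<dots> = (3 / (1 - r)) * s powr (2 * H) / real N"
    using N by (simp add: power2_eq_square)
  finally show ?thesis by (simp only: e_def r_def)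
qed

end

section \<open>The derivative as an element of \<open>L\<^sup>p\<close>\<close>

lemma time_scale_powr:
  assumes "0 < H" "0 \<le> \<tau>" "0 \<le> t"
  shows "(t * time_scale H \<tau>) powr (2 * H) = t powr (2 * H) * \<tau>"
    and "(t * time_scale H \<tau>) powr H = t powr H * \<tau> powr (1 / 2)"
  using assms by (simp_all add: time_scale_def powr_mult powr_powr)

lemma time_scale_nonneg [simp]: "0 \<le> time_scale H \<tau>"
  by (simp add: time_scale_def)

lemma space_ggbm_sigma [simp]: "space (ggbm_sigma H T) = paths \<times> {0..}"
  by (simp add: ggbm_sigma_def space_measure_of_conv)

lemma ggbm_sigma_generators:
  "{ggbm H t -` B \<inter> (paths \<times> {0..}) |t B. t \<in> {0..T} \<and> B \<in> sets borel} \<subseteq> Pow (paths \<times> {0..})"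
  by auto

lemma measurable_into_ggbm_sigma:
  assumes "f \<in> space N \<rightarrow> paths \<times> {0..}"
    and "\<And>t. t \<in> {0..T} \<Longrightarrow> (\<lambda>x. ggbm H t (f x)) \<in> borel_measurable N"
  shows "f \<in> N \<rightarrow>\<^sub>M ggbm_sigma H T"
  unfolding ggbm_sigma_def
proof (rule measurable_measure_of[OF ggbm_sigma_generators assms(1)])
  fix y assume "y \<in> {ggbm H t -` B \<inter> (paths \<times> {0..}) |t B. t \<in> {0..T} \<and> B \<in> sets borel}"
  then obtain t B where y: "y = ggbm H t -` B \<inter> (paths \<times> {0..})" and t: "t \<in> {0..T}" and B: "B \<in> sets borel"
    by blast
  have "f -` y \<inter> space N = (\<lambda>x. ggbm H t (f x)) -` B \<inter> space N"
    using assms(1) by (auto simp: y)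
  also have "\<dots> \<in> sets N" using assms(2)[OF t] B by (rule measurable_sets)
  finally show "f -` y \<inter> space N \<in> sets N" .
qed

lemma ggbm_measurable_ggbm_sigma:
  assumes "t \<in> {0..T}"
  shows "ggbm H t \<in> borel_measurable (ggbm_sigma H T)"
proof (rule measurableI)
  fix B :: "real set" assume "B \<in> sets borel"
  then show "ggbm H t -` B \<inter> space (ggbm_sigma H T) \<in> sets (ggbm_sigma H T)"
    unfolding space_ggbm_sigma
    unfolding ggbm_sigma_def sets_measure_of[OF ggbm_sigma_generators]
    using assms by (intro sigma_sets.Basic) auto
qed simp

lemma borel_measurable_continuous_coordinates:
  fixes g :: "(nat \<Rightarrow> real) \<Rightarrow> real"
  assumes "continuous_on UNIV g" "\<And>i. X i \<in> borel_measurable N"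
  shows "(\<lambda>x. g (\<lambda>i. X i x)) \<in> borel_measurable N"
proof (rule measurable_compose[OF _ borel_measurable_continuous_onI[OF assms(1)]])
  show "(\<lambda>x i. X i x) \<in> borel_measurable N"
    by (rule measurable_coordinatewise_then_product) (rule assms(2))
qed

text \<open>
  The values of \<open>t i\<close> for \<open>i \<ge> n\<close> do not influence \<open>g\<close>; they are set to \<open>T\<close> so that every coordinate
  is a value of the process at an admissible time.
\<close>

lemma smooth_cylinderE:
  assumes "F \<in> smooth_cylinder H T" and T: "0 < T"
  obtains n t g D B where
    "\<And>i::nat. 0 < t i \<and> t i \<le> T"
    "continuous_on UNIV g" "\<And>x. \<bar>g x\<bar> \<le> B"
    "\<And>i. i < n \<Longrightarrow> continuous_on UNIV (D i)" "\<And>i x. i < n \<Longrightarrow> \<bar>D i x\<bar> \<le> B"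
    "\<And>w \<tau>. w \<in> paths \<Longrightarrow> 0 \<le> \<tau> \<Longrightarrow> F (w, \<tau>) = g (\<lambda>i. ggbm H (t i) (w, \<tau>))"
    "\<And>h w \<tau> x. h \<in> paths \<Longrightarrow> w \<in> paths \<Longrightarrow> 0 \<le> \<tau> \<Longrightarrow>
       ((\<lambda>x. F (\<lambda>s. w s + x * h s, \<tau>)) has_real_derivative
         (\<Sum>i<n. D i (\<lambda>i. ggbm H (t i) (\<lambda>s. w s + x * h s, \<tau>)) * h (t i * time_scale H \<tau>))) (at x)"
    "\<And>h w \<tau>. h \<in> paths \<Longrightarrow> w \<in> paths \<Longrightarrow> 0 \<le> \<tau> \<Longrightarrow>
       path_deriv h F (w, \<tau>) = (\<Sum>i<n. D i (\<lambda>i. ggbm H (t i) (w, \<tau>)) * h (t i * time_scale H \<tau>))"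
proof -
  obtain n t f where t: "\<forall>i<n. 0 < t i \<and> t i \<le> T" and f: "f \<in> Cb_infinity n"
    and F: "\<forall>w\<in>paths. \<forall>\<tau>\<ge>0. F (w, \<tau>) = f (\<lambda>i. if i < n then w (t i * time_scale H \<tau>) else 0)"
    using assms unfolding smooth_cylinder_def by blast
  obtain g D B where g: "\<And>x. g x = f (\<lambda>i. if i < n then x i else 0)"
    "continuous_on UNIV g" "\<And>x. \<bar>g x\<bar> \<le> B"
    "\<And>i. i < n \<Longrightarrow> continuous_on UNIV (D i)" "\<And>i x. i < n \<Longrightarrow> \<bar>D i x\<bar> \<le> B"
    "\<And>x y s. ((\<lambda>s. g (\<lambda>i. x i + s * y i)) has_real_derivative
        (\<Sum>i<n. D i (\<lambda>i. x i + s * y i) * y i)) (at s)"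
    by (rule Cb_infinityE[OF f]) (rule that)
  define t' where "t' i = (if i < n then t i else T)" for i
  have Fg: "F (w, \<tau>) = g (\<lambda>i. ggbm H (t' i) (w, \<tau>))" if "w \<in> paths" "0 \<le> \<tau>" for w \<tau>
    using F that unfolding g(1) by (auto simp: ggbm_def t'_def intro!: arg_cong[of _ _ f])
  have der: "((\<lambda>x. F (\<lambda>s. w s + x * h s, \<tau>)) has_real_derivative
         (\<Sum>i<n. D i (\<lambda>i. ggbm H (t' i) (\<lambda>s. w s + x * h s, \<tau>)) * h (t' i * time_scale H \<tau>))) (at x)"
    if "h \<in> paths" "w \<in> paths" "0 \<le> \<tau>" for h w \<tau> x
    using g(6)[of "\<lambda>i. w (t' i * time_scale H \<tau>)" "\<lambda>i. h (t' i * time_scale H \<tau>)" x]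
    by (simp add: Fg paths_add_scale that) (simp add: ggbm_def)
  have pd: "path_deriv h F (w, \<tau>) = (\<Sum>i<n. D i (\<lambda>i. ggbm H (t' i) (w, \<tau>)) * h (t' i * time_scale H \<tau>))"
    if "h \<in> paths" "w \<in> paths" "0 \<le> \<tau>" for h w \<tau>
  proof -
    have "((\<lambda>x. (F (\<lambda>s. w s + x * h s, \<tau>) - F (w, \<tau>)) / x) \<longlongrightarrow>
        (\<Sum>i<n. D i (\<lambda>i. ggbm H (t' i) (w, \<tau>)) * h (t' i * time_scale H \<tau>))) (at 0)"
      using der[OF that, of 0] by (simp add: has_field_derivative_iff)
    then show ?thesis
      unfolding path_deriv_def by (simp add: tendsto_Lim)
  qed
  show thesis
    by (rule that[of t' g B n D]) (use t T g Fg der pd in \<open>auto simp: t'_def\<close>)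
qed

lemma sum_path_bound:
  assumes "\<And>i. i < n \<Longrightarrow> \<bar>a i\<bar> \<le> B" "0 \<le> B"
  shows "\<bar>\<Sum>i<n. a i * b i\<bar> \<le> (\<Sum>i<n. B * \<bar>b i :: real\<bar>)"
proof -
  have "\<bar>\<Sum>i<n. a i * b i\<bar> \<le> (\<Sum>i<n. \<bar>a i * b i\<bar>)" by (rule sum_abs)
  also have "\<dots> \<le> (\<Sum>i<n. B * \<bar>b i\<bar>)"
    unfolding abs_mult using assms by (intro sum_mono mult_right_mono) auto
  finally show ?thesis .
qed

locale generalized_grey_motion = fractional_brownian_motion H P for H P +
  fixes \<beta> T :: real and PY :: "real measure"
  assumes \<beta>: "0 < \<beta>" and time: "time_law \<beta> PY" and T: "0 < T"
begin

abbreviation "M \<equiv> P \<Otimes>\<^sub>M PY"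

sublocale Y: prob_space PY by (rule prob_space_time_law[OF time])

sublocale PY: pair_prob_space P PY ..

lemma space_PY [simp]: "space PY = {0..}"
  by (rule space_time_law[OF time])

lemma space_M [simp]: "space M = paths \<times> {0..}"
  by (simp add: space_pair_measure)

lemma time_measurable [measurable]: "(\<lambda>\<tau>. \<tau>) \<in> borel_measurable PY"
proof -
  have "(\<lambda>\<tau>. \<tau>) \<in> borel_measurable (restrict_space borel {0::real..})"
    by (rule measurable_restrict_space1) simp
  then show ?thesis using measurable_cong_sets[OF sets_time_law[OF time] refl] by blast
qed

lemma snd_measurable: "snd \<in> borel_measurable M"
  using measurable_compose[OF measurable_snd time_measurable] by simp

lemma path_process_measurable:
  assumes "g \<in> borel_measurable M"
  shows "(\<lambda>x. fst x (g x)) \<in> borel_measurable M"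
proof (rule borel_measurable_continuous_process[OF _ _ assms, where X = "\<lambda>s x. fst x s"])
  show "(\<lambda>x. fst x t) \<in> borel_measurable M" for t
    using measurable_compose[OF measurable_fst eval_measurable] .
qed (auto intro: continuous_on_path)

lemma ggbm_measurable: "ggbm H t \<in> borel_measurable M"
proof -
  have "ggbm H t = (\<lambda>x. fst x (t * time_scale H (snd x)))" by (auto simp: ggbm_def)
  moreover have "(\<lambda>x. t * time_scale H (snd x)) \<in> borel_measurable M"
    unfolding time_scale_def using snd_measurable by measurable
  ultimately show ?thesis using path_process_measurable by simp
qed

lemma measurable_ggbm_sigma_imp: "f \<in> borel_measurable (ggbm_sigma H T) \<Longrightarrow> f \<in> borel_measurable M"
proof (rule measurable_compose[of "\<lambda>x. x" M])
  show "(\<lambda>x. x) \<in> M \<rightarrow>\<^sub>M ggbm_sigma H T"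
    by (rule measurable_into_ggbm_sigma) (use ggbm_measurable in auto)
qed

lemma integrable_of_time:
  fixes f :: "real \<Rightarrow> real"
  assumes f: "integrable PY f"
  shows "integrable M (\<lambda>x. f (snd x))"
proof (rule integrableI_bounded)
  have [measurable]: "f \<in> borel_measurable PY" using f by simp
  show "(\<lambda>x. f (snd x)) \<in> borel_measurable M" by measurable
  have "(\<integral>\<^sup>+x. ennreal (norm (f (snd x))) \<partial>M) = (\<integral>\<^sup>+\<tau>. \<integral>\<^sup>+w. ennreal (norm (f (snd (w, \<tau>)))) \<partial>P \<partial>PY)"
    by (rule PY.nn_integral_snd[symmetric]) measurable
  also have "\<dots> = (\<integral>\<^sup>+\<tau>. ennreal (norm (f \<tau>)) \<partial>PY)"
    by (simp add: emeasure_space_1 del: space_P)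
  also have "\<dots> < \<infinity>" using f by (simp add: integrable_iff_bounded)
  finally show "(\<integral>\<^sup>+x. ennreal (norm (f (snd x))) \<partial>M) < \<infinity>" .
qed

text \<open>
  For fixed \<open>\<tau>\<close> the values of the process are those of the path on \<open>[0, s]\<close> with
  \<open>s = T * time_scale H \<tau>\<close>, and \<open>s powr (2 * H)\<close> is \<open>T powr (2 * H) * \<tau>\<close>. The law of large numbers
  at small scales therefore produces \<open>exp (- (T powr (2 * H) * \<tau>) / 2)\<close>, with an error whose
  expectation over \<open>\<tau>\<close> is of order \<open>1 / N\<close> since \<open>\<tau>\<close> is integrable; a subsequence converges almost
  surely, and \<open>\<tau>\<close> is read off from the limit.
\<close>

lemma time_recoverable: "\<exists>G\<in>borel_measurable (ggbm_sigma H T). AE x in M. G x = snd x"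
proof -
  define V where "V N x = (\<Sum>n<N. cos (2 powr (real n * H) * ggbm H (T / 2 ^ n) x)) / real N" for N x
  define e where "e x = exp (- (T powr (2 * H) * snd x) / 2)" for x :: "(real \<Rightarrow> real) \<times> real"
  have VA[measurable]: "V N \<in> borel_measurable (ggbm_sigma H T)" for N
  proof -
    have [measurable]: "ggbm H (T / 2 ^ n) \<in> borel_measurable (ggbm_sigma H T)" for n
      using T by (intro ggbm_measurable_ggbm_sigma) (auto simp: divide_le_eq)
    show ?thesis unfolding V_def[abs_def] by measurable
  qed
  have [measurable]: "V N \<in> borel_measurable M" for N
    using VA by (rule measurable_ggbm_sigma_imp)
  have [measurable]: "e \<in> borel_measurable M"
    unfolding e_def[abs_def] using snd_measurable by measurable
  have V: "V N (w, \<tau>) = cos_mean (T * time_scale H \<tau>) N w" for N w \<tau>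
    by (simp add: V_def cos_mean_def rescaled_def ggbm_def)
  define K where "K = 3 / (1 - 2 powr (H - 1)) * T powr (2 * H)"
  have err: "expectation (\<lambda>w. (V N (w, \<tau>) - e (w, \<tau>))\<^sup>2) \<le> K * \<tau> / real N" if "0 < N" "0 \<le> \<tau>" for N \<tau>
    using cos_mean_L2_error[of "T * time_scale H \<tau>" N] that T H
    by (simp add: V e_def time_scale_powr K_def mult.assoc)
  have Vb: "\<bar>V N x\<bar> \<le> 1" for N x
  proof -
    have "\<bar>\<Sum>n<N. cos (2 powr (real n * H) * ggbm H (T / 2 ^ n) x)\<bar> \<le> (\<Sum>n<N. 1)"
      by (rule order_trans[OF sum_abs sum_mono]) simp
    then show ?thesis by (cases "N = 0") (auto simp: V_def divide_le_eq_1)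
  qed
  have eb: "0 \<le> e x" "snd x \<ge> 0 \<Longrightarrow> e x \<le> 1" for x by (simp_all add: e_def)
  have int: "integrable M (\<lambda>x. (V N x - e x)\<^sup>2)" for N
  proof (rule PY.integrable_const_bound[where B = "2\<^sup>2"])
    show "AE x in M. norm ((V N x - e x)\<^sup>2) \<le> 2\<^sup>2"
    proof (rule AE_I2)
      fix x assume "x \<in> space M"
      then have "snd x \<ge> 0" by auto
      then have "\<bar>V N x - e x\<bar> \<le> 2" using Vb[of N x] eb[of x] by linarith
      then show "norm ((V N x - e x)\<^sup>2) \<le> 2\<^sup>2" using abs_le_square_iff[of "V N x - e x" 2] by simp
    qed
  qed measurable
  have tau: "integrable PY (\<lambda>\<tau>. \<tau>)" using integrable_time_law_power[OF \<beta> time, of 1] by simp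
  have le: "(\<integral>x. (V N x - e x)\<^sup>2 \<partial>M) \<le> K * (\<integral>\<tau>. \<tau> \<partial>PY) / real N" if N: "0 < N" for N
  proof -
    have "(\<integral>x. (V N x - e x)\<^sup>2 \<partial>M) = (\<integral>\<tau>. expectation (\<lambda>w. (V N (w, \<tau>) - e (w, \<tau>))\<^sup>2) \<partial>PY)"
      using PY.integral_snd[of "\<lambda>w \<tau>. (V N (w, \<tau>) - e (w, \<tau>))\<^sup>2"] int by (simp add: case_prod_unfold)
    also have "\<dots> \<le> (\<integral>\<tau>. K * \<tau> / real N \<partial>PY)"
    proof (rule integral_mono)
      show "integrable PY (\<lambda>\<tau>. expectation (\<lambda>w. (V N (w, \<tau>) - e (w, \<tau>))\<^sup>2))"
        using PY.integrable_snd[of "\<lambda>w \<tau>. (V N (w, \<tau>) - e (w, \<tau>))\<^sup>2"] int by (simp add: case_prod_unfold)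
      show "integrable PY (\<lambda>\<tau>. K * \<tau> / real N)" using tau by simp
    qed (use err N in auto)
    finally show ?thesis using tau by simp
  qed
  have lim: "(\<lambda>N. \<integral>x. norm ((V N x - e x)\<^sup>2) \<partial>M) \<longlonglongrightarrow> 0"
  proof (rule tendsto_sandwich)
    show "\<forall>\<^sub>F N in sequentially. 0 \<le> (\<integral>x. norm ((V N x - e x)\<^sup>2) \<partial>M)" by simp
    show "\<forall>\<^sub>F N in sequentially. (\<integral>x. norm ((V N x - e x)\<^sup>2) \<partial>M) \<le> K * (\<integral>\<tau>. \<tau> \<partial>PY) / real N"
      using eventually_gt_at_top[of 0] by eventually_elim (use le in simp)
    show "(\<lambda>N. K * (\<integral>\<tau>. \<tau> \<partial>PY) / real N) \<longlonglongrightarrow> 0"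
      by (rule lim_const_over_n)
  qed simp
  obtain r :: "nat \<Rightarrow> nat" where r: "AE x in M. (\<lambda>j. (V (r j) x - e x)\<^sup>2) \<longlonglongrightarrow> 0"
    using tendsto_L1_AE_subseq[OF int lim] by blast
  define G where "G x = - 2 * ln (lim (\<lambda>j. V (r j) x)) / T powr (2 * H)" for x
  have "G \<in> borel_measurable (ggbm_sigma H T)"
    unfolding G_def[abs_def] by measurable
  moreover have "AE x in M. G x = snd x"
    using r
  proof eventually_elim
    case (elim x)
    have "(\<lambda>j. \<bar>V (r j) x - e x\<bar>) \<longlonglongrightarrow> 0" using tendsto_real_sqrt[OF elim] by simp
    then have "(\<lambda>j. V (r j) x) \<longlonglongrightarrow> e x" by (simp add: tendsto_rabs_zero_iff LIM_zero_iff)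
    then have "lim (\<lambda>j. V (r j) x) = e x" by (rule limI)
    then show ?case using T by (simp add: G_def e_def)
  qed
  ultimately show ?thesis by blast
qed

lemma smooth_cylinder_Lp:
  assumes F: "F \<in> smooth_cylinder H T" and q: "0 \<le> q"
  shows "F \<in> Lp_space M (ggbm_sigma H T) q"
proof -
  obtain t g B where *: "\<And>i::nat. 0 < t i \<and> t i \<le> T"
    "continuous_on UNIV g" "\<And>x. \<bar>g x\<bar> \<le> B"
    "\<And>w \<tau>. w \<in> paths \<Longrightarrow> 0 \<le> \<tau> \<Longrightarrow> F (w, \<tau>) = g (\<lambda>i. ggbm H (t i) (w, \<tau>))"
    by (rule smooth_cylinderE[OF F T]) (rule that)
  define F' where "F' x = g (\<lambda>i. ggbm H (t i) x)" for x
  have A: "F' \<in> borel_measurable (ggbm_sigma H T)"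
    unfolding F'_def[abs_def]
    by (rule borel_measurable_continuous_coordinates[OF *(2) ggbm_measurable_ggbm_sigma]) (use *(1) in \<open>auto intro: less_imp_le\<close>)
  have eq: "F x = F' x" if "x \<in> space M" for x
    using that *(4) by (auto simp: F'_def)
  have m[measurable]: "F \<in> borel_measurable M"
    using measurable_ggbm_sigma_imp[OF A] by (subst measurable_cong[OF eq])
  have "integrable M (\<lambda>x. \<bar>F x\<bar> powr q)"
  proof (rule PY.integrable_const_bound[where B = "B powr q"])
    show "AE x in M. norm (\<bar>F x\<bar> powr q) \<le> B powr q"
      by (rule AE_I2) (use q *(3) in \<open>auto simp: eq F'_def intro!: powr_mono2\<close>)
  qed measurable
  then show ?thesis
    unfolding Lp_space_def using m A eq by (auto intro!: bexI[of _ F'] AE_I2)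
qed

text \<open>
  In the measurable version the time in the argument of \<open>h\<close> is replaced by the one recovered from the
  process. The bound on \<open>h\<close> at \<open>t * time_scale H \<tau>\<close> is a multiple of \<open>\<tau> powr (1 / 2)\<close>, hence the
  moments of the random time control the norm.
\<close>

lemma path_deriv_Lp:
  assumes F: "F \<in> smooth_cylinder H T" and p: "0 \<le> p"
    and h: "h \<in> paths" and bound: "\<And>s. 0 \<le> s \<Longrightarrow> \<bar>h s\<bar> \<le> K * s powr H"
  shows "path_deriv h F \<in> Lp_space M (ggbm_sigma H T) p"
proof -
  obtain n t g D B where *: "\<And>i::nat. 0 < t i \<and> t i \<le> T"
    "\<And>x. \<bar>g x\<bar> \<le> B"
    "\<And>i. i < n \<Longrightarrow> continuous_on UNIV (D i)" "\<And>i x. i < n \<Longrightarrow> \<bar>D i x\<bar> \<le> B"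
    "\<And>h w \<tau>. h \<in> paths \<Longrightarrow> w \<in> paths \<Longrightarrow> 0 \<le> \<tau> \<Longrightarrow>
       path_deriv h F (w, \<tau>) = (\<Sum>i<n. D i (\<lambda>i. ggbm H (t i) (w, \<tau>)) * h (t i * time_scale H \<tau>))"
    by (rule smooth_cylinderE[OF F T]) (rule that)
  have B: "0 \<le> B" using *(2)[of undefined] by linarith
  have hm[measurable]: "h \<in> borel_measurable borel"
    using continuous_on_path[OF h] by (rule borel_measurable_continuous_onI)
  define E where "E u x = (\<Sum>i<n. D i (\<lambda>i. ggbm H (t i) x) * h (t i * time_scale H (u x)))" for u x
  \<comment> \<open>\<open>E snd\<close> is the derivative; \<open>E G\<close> is its version in terms of the process alone\<close>
  have mE: "E u \<in> borel_measurable N" if [measurable]: "u \<in> borel_measurable N" and X: "\<And>i. ggbm H (t i) \<in> borel_measurable N" for u N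
  proof -
    have [measurable]: "(\<lambda>x. D i (\<lambda>i. ggbm H (t i) x)) \<in> borel_measurable N" if "i < n" for i
      by (rule borel_measurable_continuous_coordinates[OF *(3)[OF that] X])
    show ?thesis
      unfolding E_def[abs_def] time_scale_def by (rule borel_measurable_sum) (auto, measurable)
  qed
  obtain G where G: "G \<in> borel_measurable (ggbm_sigma H T)" "AE x in M. G x = snd x"
    using time_recoverable by blast
  have A: "E G \<in> borel_measurable (ggbm_sigma H T)"
    by (rule mE[OF G(1) ggbm_measurable_ggbm_sigma]) (use *(1) in \<open>auto intro: less_imp_le\<close>)
  have eq: "path_deriv h F x = E snd x" if "x \<in> space M" for x
    using that *(5)[OF h] by (auto simp: E_def)
  have m[measurable]: "path_deriv h F \<in> borel_measurable M"
    using mE[OF snd_measurable ggbm_measurable] by (subst measurable_cong[OF eq])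
  have AE: "AE x in M. path_deriv h F x = E G x"
    using G(2) AE_space by eventually_elim (simp add: eq E_def)
  define C where "C = (\<Sum>i<n. B * (K * t i powr H))"
  have K: "0 \<le> K" using bound[of 1] by simp
  have C: "0 \<le> C" unfolding C_def using B K by (intro sum_nonneg mult_nonneg_nonneg) auto
  have bd: "\<bar>path_deriv h F x\<bar> \<le> C * snd x powr (1 / 2)" if x: "x \<in> space M" for x
  proof -
    have "\<bar>path_deriv h F x\<bar> \<le> (\<Sum>i<n. B * \<bar>h (t i * time_scale H (snd x))\<bar>)"
      unfolding eq[OF x] E_def by (rule sum_path_bound) (use *(4) B in auto)
    also have "\<dots> \<le> (\<Sum>i<n. B * (K * (t i powr H * snd x powr (1 / 2))))"
    proof (intro sum_mono mult_left_mono B)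
      fix i
      have "\<bar>h (t i * time_scale H (snd x))\<bar> \<le> K * (t i * time_scale H (snd x)) powr H"
        using *(1)[of i] by (intro bound mult_nonneg_nonneg) auto
      then show "\<bar>h (t i * time_scale H (snd x))\<bar> \<le> K * (t i powr H * snd x powr (1 / 2))"
        using *(1)[of i] x H by (subst (asm) time_scale_powr(2)) auto
    qed
    also have "\<dots> = C * snd x powr (1 / 2)"
      by (simp add: C_def sum_distrib_right mult.assoc)
    finally show ?thesis .
  qed
  \<comment> \<open>an integer moment that dominates the one of order \<open>p / 2\<close>\<close>
  define k where "k = nat \<lceil>p / 2\<rceil>"
  have pk: "p / 2 \<le> real k" unfolding k_def by (rule real_nat_ceiling_ge)
  have "integrable PY (\<lambda>\<tau>. C powr p * (1 + \<tau> ^ k))"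
    using integrable_time_law_power[OF \<beta> time, of k] by simp
  then have "integrable M (\<lambda>x. C powr p * (1 + snd x ^ k))"
    by (rule integrable_of_time)
  then have "integrable M (\<lambda>x. \<bar>path_deriv h F x\<bar> powr p)"
  proof (rule Bochner_Integration.integrable_bound)
    show "AE x in M. norm (\<bar>path_deriv h F x\<bar> powr p) \<le> norm (C powr p * (1 + snd x ^ k))"
    proof (rule AE_I2)
      fix x assume x: "x \<in> space M"
      then have \<tau>: "0 \<le> snd x" by auto
      have "\<bar>path_deriv h F x\<bar> powr p \<le> (C * snd x powr (1 / 2)) powr p"
        using bd[OF x] p by (intro powr_mono2) auto
      also have "\<dots> = C powr p * snd x powr (p / 2)"
        using C by (simp add: powr_mult powr_powr)
      also have "snd x powr (p / 2) \<le> 1 + snd x ^ k"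
      proof (cases "snd x \<le> 1")
        case True
        then have "snd x powr (p / 2) \<le> 1 powr (p / 2)" using p \<tau> by (intro powr_mono2) auto
        then show ?thesis using \<tau> by (simp add: add_increasing2)
      next
        case False
        then have "snd x powr (p / 2) \<le> snd x powr (real k)" using pk by (intro powr_mono) auto
        then show ?thesis using False by (simp add: powr_realpow)
      qed
      finally show "norm (\<bar>path_deriv h F x\<bar> powr p) \<le> norm (C powr p * (1 + snd x ^ k))"
        using \<tau> by (simp add: mult_left_mono)
    qed
  qed measurable
  then show ?thesis
    unfolding Lp_space_def using m A AE by blast
qed

end

section \<open>Resampling the Gaussian component in a Cameron--Martin direction\<close>

text \<open>
  The \<open>\<sigma>\<close>-algebra generated by the evaluations: laws on it are determined by their finite-dimensional
  marginals, and it suffices for all functions of finitely many values of the path.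
\<close>

definition eval_algebra :: "(real \<Rightarrow> real) measure" where
  "eval_algebra = restrict_space (\<Pi>\<^sub>M t\<in>UNIV. borel) paths"

lemma space_eval_algebra [simp]: "space eval_algebra = paths"
  by (simp add: eval_algebra_def space_restrict_space space_PiM)

lemma eval_measurable_eval_algebra [measurable]: "(\<lambda>w. w t) \<in> borel_measurable eval_algebra"
  unfolding eval_algebra_def
  by (rule measurable_restrict_space1) (rule measurable_component_singleton, simp)

lemma measurable_into_PiM_UNIV:
  assumes "\<And>t. (\<lambda>x. f x t) \<in> borel_measurable N"
  shows "f \<in> N \<rightarrow>\<^sub>M (\<Pi>\<^sub>M t\<in>UNIV. borel)"
  by (rule measurable_PiM_single') (use assms in \<open>auto simp: space_PiM\<close>)

lemma measurable_into_eval_algebra: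
  assumes "f \<in> space N \<rightarrow> paths" "\<And>t. (\<lambda>x. f x t) \<in> borel_measurable N"
  shows "f \<in> N \<rightarrow>\<^sub>M eval_algebra"
  unfolding eval_algebra_def
  by (rule measurable_restrict_space2[OF assms(1) measurable_into_PiM_UNIV[OF assms(2)]])

lemma distr_eval_algebra_eqI:
  assumes f: "f \<in> N \<rightarrow>\<^sub>M eval_algebra" and g: "g \<in> L \<rightarrow>\<^sub>M eval_algebra"
    and eq: "distr N (\<Pi>\<^sub>M t\<in>UNIV. borel) f = distr L (\<Pi>\<^sub>M t\<in>UNIV. borel) g"
  shows "distr N eval_algebra f = distr L eval_algebra g"
proof (rule measure_eqI)
  let ?\<Pi> = "\<Pi>\<^sub>M t\<in>UNIV. borel :: real measure"
  fix A assume "A \<in> sets (distr N eval_algebra f)"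
  then obtain A' where A': "A' \<in> sets ?\<Pi>" "A = A' \<inter> paths" and A: "A \<in> sets eval_algebra"
    by (auto simp: eval_algebra_def sets_restrict_space)
  have "f \<in> N \<rightarrow>\<^sub>M ?\<Pi>" "g \<in> L \<rightarrow>\<^sub>M ?\<Pi>"
    by (rule measurable_into_PiM_UNIV measurable_compose[OF _ eval_measurable_eval_algebra] f g)+
  then have "emeasure N (f -` A' \<inter> space N) = emeasure L (g -` A' \<inter> space L)"
    using arg_cong[OF eq, of "\<lambda>m. emeasure m A'"] A'(1) by (simp add: emeasure_distr)
  moreover have "f -` A' \<inter> space N = f -` A \<inter> space N" "g -` A' \<inter> space L = g -` A \<inter> space L"
    using measurable_space[OF f] measurable_space[OF g] by (auto simp: A'(2))
  ultimately show "emeasure (distr N eval_algebra f) A = emeasure (distr L eval_algebra g) A"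
    using A f g by (simp add: emeasure_distr)
qed simp

lemma std_gauss_cos_sin:
  "(\<integral>x. cos (x * c) \<partial>std_gauss) = exp (- c\<^sup>2 / 2)" "(\<integral>x. sin (x * c) \<partial>std_gauss) = 0"
proof -
  have r: "real_distribution std_gauss"
    using real_dist_normal_dist by simp
  have c: "char std_gauss c = complex_of_real (exp (- c\<^sup>2 / 2))"
    by (simp add: char_std_normal_distribution)
  show "(\<integral>x. cos (x * c) \<partial>std_gauss) = exp (- c\<^sup>2 / 2)"
    using char_eq_cos_integrals(1)[OF r, of c] unfolding c by (simp add: mult.commute)
  show "(\<integral>x. sin (x * c) \<partial>std_gauss) = 0"
    using char_eq_cos_integrals(2)[OF r, of c] unfolding c by (simp add: cos_diff mult.commute)
qed

context fractional_brownian_motion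
begin

context
  fixes \<xi> k
  assumes \<xi>: "\<xi> \<in> L2_closure" and unit: "expectation (\<lambda>w. (\<xi> w)\<^sup>2) = 1"
    and k: "\<And>t. 0 \<le> t \<Longrightarrow> k t = expectation (\<lambda>w. \<xi> w * w t)" "\<And>t. t < 0 \<Longrightarrow> k t = 0"
begin

text \<open>
  In the linear combination \<open>\<Sum>t\<in>J. a t * w t\<close>, let \<open>c\<close> be the covariance with \<open>\<xi>\<close>. Subtracting
  \<open>\<xi> w * k\<close> from the path lowers the variance of the combination by \<open>c\<^sup>2\<close>, and the independent
  Gaussian component adds \<open>c\<^sup>2\<close> again.
\<close>

lemma resampled_cos:
  assumes "finite J"
  shows "(\<integral>w. cos ((\<Sum>t\<in>J. a t * w t) + \<theta>) \<partial>P)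
    = (\<integral>y. cos ((\<Sum>t\<in>J. a t * (fst y t + (snd y - \<xi> (fst y)) * k t)) + \<theta>) \<partial>(P \<Otimes>\<^sub>M std_gauss))"
proof -
  interpret S: prob_space std_gauss by (rule prob_space_std_gauss)
  interpret PS: pair_prob_space P std_gauss ..
  note [measurable] = L2_closure_measurable[OF \<xi>]
  define J' where "J' = J \<inter> {0..}"
  define Y where "Y w = (\<Sum>t\<in>J'. a t * w t)" for w
  define c where "c = (\<Sum>t\<in>J'. a t * k t)"
  have J': "finite J'" "J' \<subseteq> {0..}" using assms by (auto simp: J'_def)
  have Y: "Y \<in> eval_span" unfolding eval_span_def Y_def[abs_def] using J' by blast
  note [measurable] = eval_span_measurable[OF Y]
  have sumw: "(\<Sum>t\<in>J. a t * w t) = Y w" if "w \<in> paths" for w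
  proof -
    have "w t = 0" if "\<not> 0 \<le> t" for t using \<open>w \<in> paths\<close> that by (simp add: paths_def)
    then show ?thesis
      unfolding Y_def J'_def using assms by (intro sum.mono_neutral_right) auto
  qed
  have sumk: "(\<Sum>t\<in>J. a t * k t) = c"
  proof -
    have "k t = 0" if "\<not> 0 \<le> t" for t using k(2) that by simp
    then show ?thesis
      unfolding c_def J'_def using assms by (intro sum.mono_neutral_right) auto
  qed
  \<comment> \<open>the part of \<open>Y\<close> that is uncorrelated with \<open>\<xi>\<close>\<close>
  define A where "A w = Y w + (- c) * \<xi> w" for w
  have A: "A \<in> L2_closure" unfolding A_def[abs_def] by (rule eval_span_add_L2_closure[OF Y \<xi>])
  note [measurable] = L2_closure_measurable[OF A]
  have iY\<xi>: "integrable P (\<lambda>w. \<xi> w * w t)" if "0 \<le> t" for t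
    by (rule integrable_mult_of_squares)
       (use L2_closure_square_integrable[OF \<xi>] eval_square_integrable[OF that] in auto)
  have EY\<xi>: "expectation (\<lambda>w. Y w * \<xi> w) = c"
  proof -
    have "expectation (\<lambda>w. Y w * \<xi> w) = expectation (\<lambda>w. \<Sum>t\<in>J'. a t * (\<xi> w * w t))"
      by (simp add: Y_def sum_distrib_left mult_ac)
    also have "\<dots> = (\<Sum>t\<in>J'. a t * expectation (\<lambda>w. \<xi> w * w t))"
      using J' iY\<xi> by (subst Bochner_Integration.integral_sum) auto
    also have "\<dots> = c" unfolding c_def using J' k(1) by (intro sum.cong) auto
    finally show ?thesis .
  qed
  have EA: "expectation (\<lambda>w. (A w)\<^sup>2) = expectation (\<lambda>w. (Y w)\<^sup>2) - c\<^sup>2"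
  proof -
    have "integrable P (\<lambda>w. Y w * \<xi> w)"
      by (rule integrable_mult_of_squares)
         (use L2_closure_square_integrable[OF \<xi>] eval_span_square_integrable[OF Y] in auto)
    moreover have "(\<lambda>w. (A w)\<^sup>2) = (\<lambda>w. (Y w)\<^sup>2 - 2 * c * (Y w * \<xi> w) + c\<^sup>2 * (\<xi> w)\<^sup>2)"
      by (auto simp: A_def power2_eq_square algebra_simps)
    ultimately show ?thesis
      using L2_closure_square_integrable[OF \<xi>] eval_span_square_integrable[OF Y] unit EY\<xi>
      by (simp add: power2_eq_square)
  qed
  have i: "integrable N (\<lambda>x. cos (f x))" "integrable N (\<lambda>x. sin (f x))"
    if "prob_space N" and [measurable]: "f \<in> borel_measurable N" for N and f :: "'b \<Rightarrow> real"
  proof -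
    interpret N: prob_space N by fact
    show "integrable N (\<lambda>x. cos (f x))" "integrable N (\<lambda>x. sin (f x))"
      by (rule N.integrable_const_bound[where B = 1]; auto)+
  qed
  have "(\<integral>w. cos ((\<Sum>t\<in>J. a t * w t) + \<theta>) \<partial>P) = (\<integral>w. cos (Y w) * cos \<theta> - sin (Y w) * sin \<theta> \<partial>P)"
    by (intro Bochner_Integration.integral_cong refl) (simp add: sumw cos_add)
  also have "\<dots> = exp (- expectation (\<lambda>w. (Y w)\<^sup>2) / 2) * cos \<theta>"
    using i[OF prob_space_axioms, of Y] by (simp add: eval_span_cos[OF Y] eval_span_sin[OF Y])
  finally have lhs: "(\<integral>w. cos ((\<Sum>t\<in>J. a t * w t) + \<theta>) \<partial>P) = exp (- expectation (\<lambda>w. (Y w)\<^sup>2) / 2) * cos \<theta>" .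
  have "(\<integral>y. cos ((\<Sum>t\<in>J. a t * (fst y t + (snd y - \<xi> (fst y)) * k t)) + \<theta>) \<partial>(P \<Otimes>\<^sub>M std_gauss))
      = (\<integral>y. cos (A (fst y) + \<theta> + snd y * c) \<partial>(P \<Otimes>\<^sub>M std_gauss))"
  proof (intro Bochner_Integration.integral_cong refl)
    fix y assume "y \<in> space (P \<Otimes>\<^sub>M std_gauss)"
    then have y: "fst y \<in> paths" by (auto simp: space_pair_measure)
    have eq: "(\<Sum>t\<in>J. a t * (fst y t + (snd y - \<xi> (fst y)) * k t))
        = (\<Sum>t\<in>J. a t * fst y t) + (snd y - \<xi> (fst y)) * (\<Sum>t\<in>J. a t * k t)"
      by (simp add: distrib_left sum.distrib sum_distrib_left mult_ac)
    show "cos ((\<Sum>t\<in>J. a t * (fst y t + (snd y - \<xi> (fst y)) * k t)) + \<theta>)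
        = cos (A (fst y) + \<theta> + snd y * c)"
      unfolding eq sumw[OF y] sumk by (simp add: A_def algebra_simps)
  qed
  also have "\<dots> = (\<integral>w. (\<integral>x. cos (A w + \<theta> + x * c) \<partial>std_gauss) \<partial>P)"
  proof -
    have "integrable (P \<Otimes>\<^sub>M std_gauss) (\<lambda>y. cos (A (fst y) + \<theta> + snd y * c))"
      by (rule i(1)) (unfold_locales, measurable)
    then show ?thesis
      using PS.integral_fst'[of "\<lambda>y. cos (A (fst y) + \<theta> + snd y * c)"] by simp
  qed
  also have "\<dots> = (\<integral>w. cos (A w + \<theta>) * exp (- c\<^sup>2 / 2) \<partial>P)"
  proof (intro Bochner_Integration.integral_cong refl)
    fix w
    have "(\<integral>x. cos (A w + \<theta> + x * c) \<partial>std_gauss)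
        = (\<integral>x. cos (A w + \<theta>) * cos (x * c) - sin (A w + \<theta>) * sin (x * c) \<partial>std_gauss)"
      by (simp only: cos_add[of "A w + \<theta>"])
    also have "\<dots> = cos (A w + \<theta>) * exp (- c\<^sup>2 / 2)"
      using i[OF prob_space_std_gauss, of "\<lambda>x. x * c"] by (simp add: std_gauss_cos_sin)
    finally show "(\<integral>x. cos (A w + \<theta> + x * c) \<partial>std_gauss) = cos (A w + \<theta>) * exp (- c\<^sup>2 / 2)" .
  qed
  also have "\<dots> = (\<integral>w. (cos (A w) * cos \<theta> - sin (A w) * sin \<theta>) \<partial>P) * exp (- c\<^sup>2 / 2)"
    by (simp add: cos_add)
  also have "\<dots> = exp (- expectation (\<lambda>w. (A w)\<^sup>2) / 2) * cos \<theta> * exp (- c\<^sup>2 / 2)"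
    using i[OF prob_space_axioms, of A] by (simp add: L2_closure_cos[OF A] L2_closure_sin[OF A])
  also have "\<dots> = exp (- expectation (\<lambda>w. (Y w)\<^sup>2) / 2) * cos \<theta>"
    by (simp add: EA add_divide_distrib diff_divide_distrib flip: exp_add)
  finally show ?thesis using lhs by simp
qed

lemma resampled_path: "w \<in> paths \<Longrightarrow> (\<lambda>t. w t + (x - \<xi> w) * k t) \<in> paths"
  by (rule paths_add_scale[OF _ representation_path[OF \<xi> k]])

lemma resampled_measurable:
  "(\<lambda>y t. fst y t + (snd y - \<xi> (fst y)) * k t) \<in> P \<Otimes>\<^sub>M std_gauss \<rightarrow>\<^sub>M eval_algebra"
proof (rule measurable_into_eval_algebra)
  note [measurable] = L2_closure_measurable[OF \<xi>]
  show "(\<lambda>y. fst y t + (snd y - \<xi> (fst y)) * k t) \<in> borel_measurable (P \<Otimes>\<^sub>M std_gauss)" for t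
  proof -
    have [measurable]: "(\<lambda>y. fst y t) \<in> borel_measurable (P \<Otimes>\<^sub>M std_gauss)"
      using measurable_compose[OF measurable_fst eval_measurable] .
    show ?thesis by measurable
  qed
qed (auto simp: space_pair_measure intro: resampled_path)

text \<open>
  The law of fractional Brownian motion is invariant under the replacement of the component \<open>\<xi> w * k\<close>
  of the path by an independent copy.
\<close>

lemma nn_integral_resample:
  assumes G[measurable]: "G \<in> borel_measurable eval_algebra"
  shows "(\<integral>\<^sup>+w. G w \<partial>P) = (\<integral>\<^sup>+w. \<integral>\<^sup>+x. G (\<lambda>t. w t + (x - \<xi> w) * k t) \<partial>std_gauss \<partial>P)"
proof -
  interpret S: prob_space std_gauss by (rule prob_space_std_gauss)
  interpret PS: pair_prob_space P std_gauss ..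
  let ?\<Phi> = "\<lambda>y t. fst y t + (snd y - \<xi> (fst y)) * k t"
  have id: "(\<lambda>w. w) \<in> P \<rightarrow>\<^sub>M eval_algebra"
    by (rule measurable_into_eval_algebra) auto
  have "distr P (\<Pi>\<^sub>M t\<in>UNIV. borel) (\<lambda>w t. w t) = distr (P \<Otimes>\<^sub>M std_gauss) (\<Pi>\<^sub>M t\<in>UNIV. borel) ?\<Phi>"
  proof (rule distr_eq_of_cos_integrals)
    show "(\<lambda>y. ?\<Phi> y t) \<in> borel_measurable (P \<Otimes>\<^sub>M std_gauss)" for t
      by (rule measurable_compose[OF resampled_measurable eval_measurable_eval_algebra])
  qed (auto simp: resampled_cos intro: prob_space_axioms PS.prob_space_axioms)
  then have "distr P eval_algebra (\<lambda>w. w) = distr (P \<Otimes>\<^sub>M std_gauss) eval_algebra ?\<Phi>"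
    by (rule distr_eval_algebra_eqI[OF id resampled_measurable])
  then have "integral\<^sup>N (distr P eval_algebra (\<lambda>w. w)) G = integral\<^sup>N (distr (P \<Otimes>\<^sub>M std_gauss) eval_algebra ?\<Phi>) G"
    by simp
  then have "(\<integral>\<^sup>+w. G w \<partial>P) = (\<integral>\<^sup>+y. G (?\<Phi> y) \<partial>(P \<Otimes>\<^sub>M std_gauss))"
    by (subst (asm) (1 2) nn_integral_distr) (auto intro: id resampled_measurable)
  also have "\<dots> = (\<integral>\<^sup>+w. \<integral>\<^sup>+x. G (?\<Phi> (w, x)) \<partial>std_gauss \<partial>P)"
    by (rule S.nn_integral_fst[symmetric]) (rule measurable_compose[OF resampled_measurable G])
  finally show ?thesis by simp
qed

end

end

section \<open>Closability of the directional derivative\<close>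

text \<open>
  Pointwise, \<open>x \<le> \<epsilon> + \<epsilon> powr (1 - q) * x powr q\<close> for \<open>x \<ge> 0\<close>.
\<close>

lemma (in prob_space) L1_convergence_of_Lp:
  assumes q: "1 \<le> q" and [measurable]: "\<And>n. u n \<in> borel_measurable M"
    and lim: "(\<lambda>n. \<integral>\<^sup>+x. ennreal (\<bar>u n x :: real\<bar> powr q) \<partial>M) \<longlonglongrightarrow> 0"
  shows "(\<lambda>n. \<integral>\<^sup>+x. ennreal \<bar>u n x\<bar> \<partial>M) \<longlonglongrightarrow> 0"
proof (rule order_tendstoI)
  fix a :: ennreal assume "0 < a"
  then obtain c where c: "0 < c" "c < a" using dense by blast
  then obtain r where r: "c = ennreal r" "0 < r"
    by (cases c) (auto simp: top_unique)
  define \<epsilon> where "\<epsilon> = r / 2"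
  have \<epsilon>: "0 < \<epsilon>" using r by (simp add: \<epsilon>_def)
  have pw: "x \<le> \<epsilon> + \<epsilon> powr (1 - q) * x powr q" if "0 \<le> x" for x
  proof (cases "x \<le> \<epsilon>")
    case True
    then show ?thesis by (simp add: add_increasing2)
  next
    case False
    then have x: "0 < x" "\<epsilon> \<le> x" using \<epsilon> by auto
    have "x = x powr (1 - q) * x powr q" using x by (simp flip: powr_add)
    also have "\<dots> \<le> \<epsilon> powr (1 - q) * x powr q"
      using x \<epsilon> q by (intro mult_right_mono powr_mono2') auto
    finally show ?thesis using \<epsilon> by simp
  qed
  have "\<forall>\<^sub>F n in sequentially. (\<integral>\<^sup>+x. ennreal (\<bar>u n x\<bar> powr q) \<partial>M) < ennreal (\<epsilon> powr q)"
    using lim by (rule order_tendstoD) (use \<epsilon> in simp)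
  then show "\<forall>\<^sub>F n in sequentially. (\<integral>\<^sup>+x. ennreal \<bar>u n x\<bar> \<partial>M) < a"
  proof eventually_elim
    case (elim n)
    have "(\<integral>\<^sup>+x. ennreal \<bar>u n x\<bar> \<partial>M)
        \<le> (\<integral>\<^sup>+x. ennreal \<epsilon> + ennreal (\<epsilon> powr (1 - q)) * ennreal (\<bar>u n x\<bar> powr q) \<partial>M)"
      using pw \<epsilon> by (intro nn_integral_mono) (simp flip: ennreal_mult ennreal_plus)
    also have "\<dots> = ennreal \<epsilon> + ennreal (\<epsilon> powr (1 - q)) * (\<integral>\<^sup>+x. ennreal (\<bar>u n x\<bar> powr q) \<partial>M)"
      by (simp add: nn_integral_add nn_integral_cmult emeasure_space_1)
    also have "\<dots> \<le> ennreal \<epsilon> + ennreal (\<epsilon> powr (1 - q)) * ennreal (\<epsilon> powr q)"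
      using elim by (intro add_left_mono mult_left_mono) auto
    also have "\<dots> = ennreal r"
      using \<epsilon> by (simp add: \<epsilon>_def flip: ennreal_mult ennreal_plus powr_add)
    finally show ?case using c r by simp
  qed
qed simp

lemma ennreal_null_subsequence:
  assumes "(a :: nat \<Rightarrow> ennreal) \<longlonglongrightarrow> 0"
  shows "\<exists>r. \<forall>j. a (r j) \<le> ennreal ((1 / 2) ^ j)"
proof (rule choice, rule allI)
  fix j
  have "\<forall>\<^sub>F n in sequentially. a n < ennreal ((1 / 2) ^ j)"
    using assms by (rule order_tendstoD) simp
  then show "\<exists>n. a n \<le> ennreal ((1 / 2) ^ j)"
    by (auto simp: eventually_sequentially intro: less_imp_le)
qed

lemma ennreal_suminf_finite_imp_null:
  fixes f :: "nat \<Rightarrow> ennreal"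
  assumes "(\<Sum>j. f j) \<noteq> \<infinity>"
  shows "f \<longlonglongrightarrow> 0"
proof -
  have "f j \<noteq> \<infinity>" for j
    using assms sum_le_suminf[of f "{j}"] by (auto simp: top_unique summableI)
  then have f: "f j = ennreal (enn2real (f j))" for j by (simp add: less_top)
  have "(\<Sum>j. ennreal (enn2real (f j))) \<noteq> \<top>" using assms f by simp
  then have "summable (\<lambda>j. enn2real (f j))" by (intro summable_suminf_not_top) auto
  then have "(\<lambda>j. ennreal (enn2real (f j))) \<longlonglongrightarrow> ennreal 0"
    by (intro tendsto_ennrealI summable_LIMSEQ_zero)
  then show ?thesis using f by simp
qed

context generalized_grey_motion
begin

lemma slice_measurable:
  assumes "0 \<le> \<tau>" "f \<in> borel_measurable (ggbm_sigma H T)"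
  shows "(\<lambda>w. f (w, \<tau>)) \<in> borel_measurable eval_algebra"
proof (rule measurable_compose[OF _ assms(2)])
  show "(\<lambda>w. (w, \<tau>)) \<in> eval_algebra \<rightarrow>\<^sub>M ggbm_sigma H T"
    by (rule measurable_into_ggbm_sigma) (use assms(1) in \<open>auto simp: ggbm_def\<close>)
qed

text \<open>
  For a fixed time the derivative of a cylinder function is bounded, which in general fails jointly
  in the path and the time, and along each line in the direction \<open>k\<close> it is an ordinary continuous
  derivative.
\<close>

lemma smooth_cylinder_slice:
  assumes F: "F \<in> smooth_cylinder H T" and k: "k \<in> paths" and \<tau>: "0 \<le> \<tau>"
  obtains b where
    "\<And>w. w \<in> paths \<Longrightarrow> \<bar>F (w, \<tau>)\<bar> \<le> b" "\<And>w. w \<in> paths \<Longrightarrow> \<bar>path_deriv k F (w, \<tau>)\<bar> \<le> b"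
    "\<And>w x. w \<in> paths \<Longrightarrow> ((\<lambda>x. F (\<lambda>s. w s + x * k s, \<tau>)) has_real_derivative
        path_deriv k F (\<lambda>s. w s + x * k s, \<tau>)) (at x)"
    "\<And>w. w \<in> paths \<Longrightarrow> continuous_on UNIV (\<lambda>x. path_deriv k F (\<lambda>s. w s + x * k s, \<tau>))"
    "(\<lambda>w. F (w, \<tau>)) \<in> borel_measurable eval_algebra"
    "(\<lambda>w. path_deriv k F (w, \<tau>)) \<in> borel_measurable eval_algebra"
    "\<And>w c h. w \<in> paths \<Longrightarrow> h = (\<lambda>s. c * k s) \<Longrightarrow> path_deriv h F (w, \<tau>) = c * path_deriv k F (w, \<tau>)"
proof -
  obtain n t g D B where *: "\<And>i::nat. 0 < t i \<and> t i \<le> T"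
    "continuous_on UNIV g" "\<And>x. \<bar>g x\<bar> \<le> B"
    "\<And>i. i < n \<Longrightarrow> continuous_on UNIV (D i)" "\<And>i x. i < n \<Longrightarrow> \<bar>D i x\<bar> \<le> B"
    "\<And>w \<tau>. w \<in> paths \<Longrightarrow> 0 \<le> \<tau> \<Longrightarrow> F (w, \<tau>) = g (\<lambda>i. ggbm H (t i) (w, \<tau>))"
    "\<And>h w \<tau> x. h \<in> paths \<Longrightarrow> w \<in> paths \<Longrightarrow> 0 \<le> \<tau> \<Longrightarrow>
       ((\<lambda>x. F (\<lambda>s. w s + x * h s, \<tau>)) has_real_derivative
         (\<Sum>i<n. D i (\<lambda>i. ggbm H (t i) (\<lambda>s. w s + x * h s, \<tau>)) * h (t i * time_scale H \<tau>))) (at x)"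
    "\<And>h w \<tau>. h \<in> paths \<Longrightarrow> w \<in> paths \<Longrightarrow> 0 \<le> \<tau> \<Longrightarrow>
       path_deriv h F (w, \<tau>) = (\<Sum>i<n. D i (\<lambda>i. ggbm H (t i) (w, \<tau>)) * h (t i * time_scale H \<tau>))"
    by (rule smooth_cylinderE[OF F T]) (rule that)
  have B: "0 \<le> B" using *(3)[of undefined] by linarith
  define b where "b = B + (\<Sum>i<n. B * \<bar>k (t i * time_scale H \<tau>)\<bar>)"
  have s: "0 \<le> (\<Sum>i<n. B * \<bar>k (t i * time_scale H \<tau>)\<bar>)" using B by (intro sum_nonneg) auto
  show thesis
  proof (rule that[of b])
    fix w assume w: "w \<in> paths"
    show "\<bar>F (w, \<tau>)\<bar> \<le> b" using *(3) s unfolding *(6)[OF w \<tau>] b_def by (simp add: add_increasing2)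
    have "\<bar>path_deriv k F (w, \<tau>)\<bar> \<le> (\<Sum>i<n. B * \<bar>k (t i * time_scale H \<tau>)\<bar>)"
      unfolding *(8)[OF k w \<tau>] by (rule sum_path_bound) (use *(5) B in auto)
    then show "\<bar>path_deriv k F (w, \<tau>)\<bar> \<le> b" using B by (simp add: b_def)
    show "((\<lambda>x. F (\<lambda>s. w s + x * k s, \<tau>)) has_real_derivative
        path_deriv k F (\<lambda>s. w s + x * k s, \<tau>)) (at x)" for x
      using *(7)[OF k w \<tau>, of x] by (simp add: *(8)[OF k paths_add_scale[OF w k] \<tau>])
    have "continuous_on UNIV (\<lambda>x. D i (\<lambda>i. ggbm H (t i) (\<lambda>s. w s + x * k s, \<tau>)))" if "i < n" for i
      unfolding ggbm_def prod.case
      by (rule continuous_on_compose2[OF *(4)[OF that]])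
         (auto intro!: continuous_on_coordinatewise_then_product continuous_intros)
    then show "continuous_on UNIV (\<lambda>x. path_deriv k F (\<lambda>s. w s + x * k s, \<tau>))"
      by (simp add: *(8)[OF k paths_add_scale[OF w k] \<tau>]) (intro continuous_intros, auto)
    show "path_deriv h F (w, \<tau>) = c * path_deriv k F (w, \<tau>)" if h: "h = (\<lambda>s. c * k s)" for c h
    proof -
      have "h \<in> paths" using k unfolding h paths_def by (auto intro!: continuous_intros)
      then show ?thesis
        by (simp add: *(8)[OF _ w \<tau>] k) (simp add: h sum_distrib_left mult_ac)
    qed
  next
    have ev: "(\<lambda>w. ggbm H s (w, \<tau>)) \<in> borel_measurable eval_algebra" for s
      by (simp add: ggbm_def)
    have "(\<lambda>w. g (\<lambda>i. ggbm H (t i) (w, \<tau>))) \<in> borel_measurable eval_algebra"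
      by (rule borel_measurable_continuous_coordinates[OF *(2) ev])
    then show "(\<lambda>w. F (w, \<tau>)) \<in> borel_measurable eval_algebra"
      by (subst measurable_cong[OF *(6)]) (use \<tau> in auto)
    have "(\<lambda>w. \<Sum>i<n. D i (\<lambda>i. ggbm H (t i) (w, \<tau>)) * k (t i * time_scale H \<tau>)) \<in> borel_measurable eval_algebra"
      by (intro borel_measurable_sum borel_measurable_times borel_measurable_const
            borel_measurable_continuous_coordinates[OF *(4) ev]) auto
    then show "(\<lambda>w. path_deriv k F (w, \<tau>)) \<in> borel_measurable eval_algebra"
      by (subst measurable_cong[OF *(8)[OF k]]) (use \<tau> in auto)
  qed
qed

text \<open>
  The summability carries over to almost every line in the direction \<open>k\<close>, and on each such line the
  closability for the normal law applies. The variable \<open>\<xi>\<close> has to be normalised for the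
  resampling, hence the factor \<open>c\<close> between \<open>h\<close> and \<open>k\<close>.
\<close>

lemma derivative_limit_slice:
  fixes F :: "nat \<Rightarrow> (real \<Rightarrow> real) \<times> real \<Rightarrow> real"
  assumes F: "\<And>n. F n \<in> smooth_cylinder H T"
    and \<xi>: "\<xi> \<in> L2_closure" and unit: "expectation (\<lambda>w. (\<xi> w)\<^sup>2) = 1"
    and k: "\<And>t. 0 \<le> t \<Longrightarrow> k t = expectation (\<lambda>w. \<xi> w * w t)" "\<And>t. t < 0 \<Longrightarrow> k t = 0"
    and h: "h = (\<lambda>s. c * k s)" and \<tau>: "0 \<le> \<tau>"
    and Z[measurable]: "Z \<in> borel_measurable eval_algebra"
    and fin: "(\<integral>\<^sup>+w. (\<Sum>j. ennreal \<bar>F j (w, \<tau>)\<bar> + ennreal \<bar>path_deriv h (F j) (w, \<tau>) - Z w\<bar>) \<partial>P) \<noteq> \<infinity>"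
  shows "(\<integral>\<^sup>+w. ennreal \<bar>Z w\<bar> \<partial>P) = 0"
proof -
  interpret S: prob_space std_gauss by (rule prob_space_std_gauss)
  have kp: "k \<in> paths" by (rule representation_path[OF \<xi> k])
  note * = smooth_cylinder_slice[OF F kp \<tau>]
  have m_slice[measurable]: "(\<lambda>w. F j (w, \<tau>)) \<in> borel_measurable eval_algebra"
    "(\<lambda>w. path_deriv k (F j) (w, \<tau>)) \<in> borel_measurable eval_algebra" for j
    by (rule *; assumption)+
  have hk: "path_deriv h (F j) (w, \<tau>) = c * path_deriv k (F j) (w, \<tau>)" if "w \<in> paths" for j w
    by (rule *[of j]) (use that h in blast)
  define S where "S w = (\<Sum>j. ennreal \<bar>F j (w, \<tau>)\<bar> + ennreal \<bar>c * path_deriv k (F j) (w, \<tau>) - Z w\<bar>)" for w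
  have S[measurable]: "S \<in> borel_measurable eval_algebra"
    unfolding S_def[abs_def] by measurable
  let ?\<Phi> = "\<lambda>w x t. w t + (x - \<xi> w) * k t"
  have \<Phi>: "?\<Phi> w \<in> borel \<rightarrow>\<^sub>M eval_algebra" if "w \<in> paths" for w
    by (rule measurable_into_eval_algebra) (use resampled_path[OF \<xi> unit k that] in auto)
  note resample = nn_integral_resample[OF \<xi> unit k]
  have "(\<integral>\<^sup>+w. S w \<partial>P) \<noteq> \<infinity>"
    using fin by (subst nn_integral_cong[where v = "\<lambda>w. \<Sum>j. ennreal \<bar>F j (w, \<tau>)\<bar> + ennreal \<bar>path_deriv h (F j) (w, \<tau>) - Z w\<bar>"])
      (auto simp: S_def hk)
  then have fin': "(\<integral>\<^sup>+w. \<integral>\<^sup>+x. S (?\<Phi> w x) \<partial>std_gauss \<partial>P) \<noteq> \<infinity>"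
    by (subst (asm) resample) auto
  have joint: "(\<lambda>w. \<integral>\<^sup>+x. G (?\<Phi> w x) \<partial>std_gauss) \<in> borel_measurable P"
    if "G \<in> borel_measurable eval_algebra" for G :: "_ \<Rightarrow> ennreal"
    using S.borel_measurable_nn_integral_fst[OF measurable_compose[OF resampled_measurable[OF \<xi> unit k] that]] by simp
  have "AE w in P. (\<integral>\<^sup>+x. S (?\<Phi> w x) \<partial>std_gauss) \<noteq> \<infinity>"
    by (rule nn_integral_PInf_AE[OF joint[OF S] fin'])
  then have "AE w in P. (\<integral>\<^sup>+x. ennreal \<bar>Z (?\<Phi> w x)\<bar> \<partial>std_gauss) = 0"
    using AE_space
  proof eventually_elim
    case (elim w)
    then have w: "w \<in> paths" by simp
    define v where "v = (\<lambda>t. w t + (- \<xi> w) * k t)"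
    have v: "v \<in> paths" unfolding v_def by (rule paths_add_scale[OF w kp])
    have \<Phi>v: "?\<Phi> w x = (\<lambda>t. v t + x * k t)" for x
      by (auto simp: v_def algebra_simps)
    have vx: "(\<lambda>t. v t + x * k t) \<in> paths" for x by (rule paths_add_scale[OF v kp])
    have vm: "(\<lambda>x t. v t + x * k t) \<in> borel \<rightarrow>\<^sub>M eval_algebra"
      using \<Phi>[OF w] unfolding \<Phi>v .
    define g where "g j x = F j (\<lambda>t. v t + x * k t, \<tau>)" for j x
    define g' where "g' j x = path_deriv k (F j) (\<lambda>t. v t + x * k t, \<tau>)" for j x
    define z where "z x = Z (\<lambda>t. v t + x * k t)" for x
    have m[measurable]: "g j \<in> borel_measurable borel" "g' j \<in> borel_measurable borel" "z \<in> borel_measurable borel" for j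
      unfolding g_def[abs_def] g'_def[abs_def] z_def[abs_def]
      by (rule measurable_compose[OF vm m_slice(1)] measurable_compose[OF vm m_slice(2)]
            measurable_compose[OF vm Z])+
    have "\<exists>b. (\<forall>x. \<bar>g j x\<bar> \<le> b) \<and> (\<forall>x. \<bar>g' j x\<bar> \<le> b)" for j
      by (rule *[of j]) (unfold g_def g'_def, use vx in blast)
    then obtain b where b: "\<And>j x. \<bar>g j x\<bar> \<le> b j" "\<And>j x. \<bar>g' j x\<bar> \<le> b j" by metis
    have d: "(g j has_real_derivative g' j x) (at x)" for j x
      unfolding g_def[abs_def] g'_def by (rule *[of j]) (use v in blast)
    have ct: "continuous_on UNIV (g' j)" for j
      unfolding g'_def[abs_def] by (rule *[of j]) (use v in blast)
    have "(\<integral>\<^sup>+x. S (?\<Phi> w x) \<partial>std_gauss)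
        = (\<integral>\<^sup>+x. (\<Sum>j. ennreal \<bar>g j x\<bar> + ennreal \<bar>c * g' j x - z x\<bar>) \<partial>std_gauss)"
      unfolding S_def \<Phi>v g_def g'_def z_def ..
    also have "\<dots> = (\<Sum>j. \<integral>\<^sup>+x. ennreal \<bar>g j x\<bar> + ennreal \<bar>c * g' j x - z x\<bar> \<partial>std_gauss)"
    proof (rule nn_integral_suminf)
      have "(\<lambda>x. ennreal \<bar>g j x\<bar> + ennreal \<bar>c * g' j x - z x\<bar>) \<in> borel_measurable borel" for j
        by (intro borel_measurable_add measurable_compose[OF _ measurable_ennreal] borel_measurable_abs
              borel_measurable_diff borel_measurable_times borel_measurable_const m)
      then show "(\<lambda>x. ennreal \<bar>g j x\<bar> + ennreal \<bar>c * g' j x - z x\<bar>) \<in> borel_measurable std_gauss" for j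
        by simp
    qed
    finally have "(\<Sum>j. \<integral>\<^sup>+x. ennreal \<bar>g j x\<bar> + ennreal \<bar>c * g' j x - z x\<bar> \<partial>std_gauss) \<noteq> \<infinity>"
      using elim(1) by simp
    then have lim: "(\<lambda>j. \<integral>\<^sup>+x. ennreal \<bar>g j x\<bar> + ennreal \<bar>c * g' j x - z x\<bar> \<partial>std_gauss) \<longlonglongrightarrow> 0"
      by (rule ennreal_suminf_finite_imp_null)
    have "AE x in std_gauss. z x = 0"
    proof (rule gaussian_derivative_closable[OF d ct b m(3)])
      show "(\<lambda>j. \<integral>\<^sup>+x. ennreal \<bar>g j x\<bar> \<partial>std_gauss) \<longlonglongrightarrow> 0"
        by (rule tendsto_sandwich[OF _ _ tendsto_const lim]) (auto intro!: always_eventually nn_integral_mono)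
      show "(\<lambda>j. \<integral>\<^sup>+x. ennreal \<bar>c * g' j x - z x\<bar> \<partial>std_gauss) \<longlonglongrightarrow> 0"
        by (rule tendsto_sandwich[OF _ _ tendsto_const lim]) (auto intro!: always_eventually nn_integral_mono)
    qed
    then have "AE x in std_gauss. ennreal \<bar>z x\<bar> = 0" by eventually_elim simp
    then have "(\<integral>\<^sup>+x. ennreal \<bar>z x\<bar> \<partial>std_gauss) = 0"
      by (subst nn_integral_0_iff_AE) auto
    then show ?case unfolding \<Phi>v z_def .
  qed
  then have "(\<integral>\<^sup>+w. \<integral>\<^sup>+x. ennreal \<bar>Z (?\<Phi> w x)\<bar> \<partial>std_gauss \<partial>P) = 0"
    by (subst nn_integral_0_iff_AE) (auto intro!: joint[of "\<lambda>w. ennreal \<bar>Z w\<bar>"])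
  then show ?thesis
    by (subst resample[of "\<lambda>w. ennreal \<bar>Z w\<bar>"]) auto
qed

text \<open>
  Choosing a subsequence with summable \<open>L\<^sup>1\<close> distances, rather than one that converges almost surely,
  makes a single finite integral control the convergence on all slices.
\<close>

lemma derivative_limit_zero:
  fixes F :: "nat \<Rightarrow> (real \<Rightarrow> real) \<times> real \<Rightarrow> real"
  assumes F: "\<And>n. F n \<in> smooth_cylinder H T"
    and \<xi>: "\<xi> \<in> L2_closure"
    and h: "\<And>t. 0 \<le> t \<Longrightarrow> h t = expectation (\<lambda>w. \<xi> w * w t)" "\<And>t. t < 0 \<Longrightarrow> h t = 0"
    and Z: "Z \<in> borel_measurable (ggbm_sigma H T)"
    and m[measurable]: "\<And>n. F n \<in> borel_measurable M" "\<And>n. path_deriv h (F n) \<in> borel_measurable M"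
    and lim0: "(\<lambda>n. \<integral>\<^sup>+x. ennreal \<bar>F n x\<bar> \<partial>M) \<longlonglongrightarrow> 0"
    and lim1: "(\<lambda>n. \<integral>\<^sup>+x. ennreal \<bar>path_deriv h (F n) x - Z x\<bar> \<partial>M) \<longlonglongrightarrow> 0"
  shows "AE x in M. Z x = 0"
proof -
  have ZM[measurable]: "Z \<in> borel_measurable M" by (rule measurable_ggbm_sigma_imp[OF Z])
  note [measurable] = L2_closure_measurable[OF \<xi>]
  have hp: "h \<in> paths" by (rule representation_path[OF \<xi> h])
  define \<sigma> where "\<sigma> = sqrt (expectation (\<lambda>w. (\<xi> w)\<^sup>2))"
  have "(\<integral>\<^sup>+x. ennreal \<bar>Z x\<bar> \<partial>M) = 0"
  proof (cases "\<sigma> = 0")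
    \<comment> \<open>no Gaussian component to resample, but then the direction is zero\<close>
    case True
    have "h t = 0" for t
      using representation_bound[OF \<xi> h, of t] h(2)[of t] True by (cases "0 \<le> t") (auto simp: \<sigma>_def)
    then have h0: "h = (\<lambda>s. 0 * h s)" by auto
    have "path_deriv h (F n) x = 0" if "x \<in> space M" for n x
    proof -
      obtain w \<tau> where x: "x = (w, \<tau>)" "w \<in> paths" "0 \<le> \<tau>" using \<open>x \<in> space M\<close> by auto
      have "path_deriv h (F n) (w, \<tau>) = 0 * path_deriv h (F n) (w, \<tau>)"
        by (rule smooth_cylinder_slice[OF F[of n] hp x(3)]) (use x(2) h0 in blast)
      then show ?thesis using x by simp
    qed
    then have "(\<integral>\<^sup>+x. ennreal \<bar>path_deriv h (F n) x - Z x\<bar> \<partial>M) = (\<integral>\<^sup>+x. ennreal \<bar>Z x\<bar> \<partial>M)" for n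
      by (intro nn_integral_cong) simp
    then show ?thesis using lim1 by (simp add: LIMSEQ_const_iff)
  next
    case False
    define \<zeta> where "\<zeta> w = \<xi> w / \<sigma>" for w
    define k where "k t = h t / \<sigma>" for t
    have "(\<lambda>w. 0 * w 0 + (1 / \<sigma>) * \<xi> w) \<in> L2_closure"
      by (rule eval_span_add_L2_closure[OF eval_span_eval \<xi>]) simp
    then have \<zeta>: "\<zeta> \<in> L2_closure" by (simp add: \<zeta>_def[abs_def])
    have "\<sigma>\<^sup>2 = expectation (\<lambda>w. (\<xi> w)\<^sup>2)" by (simp add: \<sigma>_def)
    then have unit: "expectation (\<lambda>w. (\<zeta> w)\<^sup>2) = 1"
      using False by (simp add: \<zeta>_def power_divide) (metis False power_not_zero)
    have k: "k t = expectation (\<lambda>w. \<zeta> w * w t)" if "0 \<le> t" for t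
      using that by (simp add: k_def \<zeta>_def h)
    have k0: "k t = 0" if "t < 0" for t using that by (simp add: k_def h)
    have hk: "h = (\<lambda>s. \<sigma> * k s)" using False by (auto simp: k_def)
    define a where "a n = (\<integral>\<^sup>+x. ennreal \<bar>F n x\<bar> + ennreal \<bar>path_deriv h (F n) x - Z x\<bar> \<partial>M)" for n
    have a: "a = (\<lambda>n. (\<integral>\<^sup>+x. ennreal \<bar>F n x\<bar> \<partial>M) + (\<integral>\<^sup>+x. ennreal \<bar>path_deriv h (F n) x - Z x\<bar> \<partial>M))"
      unfolding a_def[abs_def] by (intro ext nn_integral_add) measurable
    have "a \<longlonglongrightarrow> 0" unfolding a using tendsto_add[OF lim0 lim1] by simp
    then obtain r where r: "\<And>j. a (r j) \<le> ennreal ((1 / 2) ^ j)"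
      using ennreal_null_subsequence by blast
    define S where "S x = (\<Sum>j. ennreal \<bar>F (r j) x\<bar> + ennreal \<bar>path_deriv h (F (r j)) x - Z x\<bar>)" for x
    have Sm[measurable]: "S \<in> borel_measurable M" unfolding S_def[abs_def] by measurable
    have "(\<integral>\<^sup>+x. S x \<partial>M) = (\<Sum>j. a (r j))"
      unfolding S_def a_def by (rule nn_integral_suminf) measurable
    also have "\<dots> \<le> (\<Sum>j. ennreal ((1 / 2) ^ j))" by (intro suminf_le r summableI)
    also have "\<dots> = ennreal (\<Sum>j. (1 / 2) ^ j)" by (rule suminf_ennreal2) (auto intro: summable_geometric)
    finally have "(\<integral>\<^sup>+x. S x \<partial>M) \<noteq> \<infinity>" by (auto simp: top_unique)
    then have fin: "(\<integral>\<^sup>+\<tau>. \<integral>\<^sup>+w. S (w, \<tau>) \<partial>P \<partial>PY) \<noteq> \<infinity>"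
      using PY.nn_integral_snd[OF Sm] by simp
    have meas: "(\<lambda>\<tau>. \<integral>\<^sup>+w. G (w, \<tau>) \<partial>P) \<in> borel_measurable PY" if "G \<in> borel_measurable M" for G :: "_ \<Rightarrow> ennreal"
      using borel_measurable_nn_integral_fst[OF measurable_compose[OF measurable_pair_swap' that]] by simp
    have "AE \<tau> in PY. (\<integral>\<^sup>+w. S (w, \<tau>) \<partial>P) \<noteq> \<infinity>"
      by (rule nn_integral_PInf_AE[OF meas[OF Sm] fin])
    then have "AE \<tau> in PY. (\<integral>\<^sup>+w. ennreal \<bar>Z (w, \<tau>)\<bar> \<partial>P) = 0"
      using AE_space
    proof eventually_elim
      case (elim \<tau>)
      then have \<tau>: "0 \<le> \<tau>" by simp
      show ?case
        by (rule derivative_limit_slice[OF F[of "r _"] \<zeta> unit k k0 hk \<tau> slice_measurable[OF \<tau> Z]])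
           (use elim(1) in \<open>auto simp: S_def\<close>)
    qed
    then have "(\<integral>\<^sup>+\<tau>. \<integral>\<^sup>+w. ennreal \<bar>Z (w, \<tau>)\<bar> \<partial>P \<partial>PY) = 0"
      by (subst nn_integral_0_iff_AE) (auto intro!: meas[of "\<lambda>x. ennreal \<bar>Z x\<bar>"])
    then show ?thesis using PY.nn_integral_snd[of "\<lambda>x. ennreal \<bar>Z x\<bar>"] by simp
  qed
  then show ?thesis by (subst (asm) nn_integral_0_iff_AE) auto
qed

end

theorem theorem4p9:
  fixes \<beta> H T p q :: real
    and PH :: "(real \<Rightarrow> real) measure"
    and PY :: "real measure"
    and h :: "real \<Rightarrow> real"
  assumes "0 < \<beta>" and "\<beta> < 1"
    and "1 / 2 < H" and "H < 1"
    and "0 < T"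
    and "fbm_law H PH"
    and "time_law \<beta> PY"
    and "1 \<le> p" and "1 \<le> q"
    and "h \<in> cameron_martin H"
  shows "closable_Lq_Lp (PH \<Otimes>\<^sub>M PY) (ggbm_sigma H T) q p
           (smooth_cylinder H T) (path_deriv h)"
proof -
  interpret generalized_grey_motion H PH \<beta> T PY
    by unfold_locales (use assms in auto)
  obtain \<xi> where \<xi>: "\<xi> \<in> L2_closure"
    and h: "\<And>t. 0 \<le> t \<Longrightarrow> h t = expectation (\<lambda>w. \<xi> w * w t)" "\<And>t. t < 0 \<Longrightarrow> h t = 0"
    using cameron_martin_representation[OF assms(10)] by blast
  have F_Lq: "F \<in> Lp_space M (ggbm_sigma H T) q" if "F \<in> smooth_cylinder H T" for F
    by (rule smooth_cylinder_Lp[OF that]) (use assms in simp)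
  have DF_Lp: "path_deriv h F \<in> Lp_space M (ggbm_sigma H T) p" if "F \<in> smooth_cylinder H T" for F
    by (rule path_deriv_Lp[OF that _ representation_path[OF \<xi> h] representation_bound[OF \<xi> h]])
       (use assms in simp_all)
  have "AE x in M. Z x = 0"
    if F: "\<And>n::nat. F n \<in> smooth_cylinder H T" and Z: "Z \<in> Lp_space M (ggbm_sigma H T) p"
      and lim0: "Lp_tendsto M q F (\<lambda>x. 0)" and lim1: "Lp_tendsto M p (\<lambda>n. path_deriv h (F n)) Z" for F Z
  proof -
    have m[measurable]: "F n \<in> borel_measurable M" "path_deriv h (F n) \<in> borel_measurable M"
      "Z \<in> borel_measurable M" for n
      using F_Lq[OF F[of n]] DF_Lp[OF F[of n]] Z by (simp_all add: Lp_space_def)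
    obtain Z' where Z': "Z' \<in> borel_measurable (ggbm_sigma H T)" "AE x in M. Z x = Z' x"
      using Z by (auto simp: Lp_space_def)
    have l0: "(\<lambda>n. \<integral>\<^sup>+x. ennreal \<bar>F n x\<bar> \<partial>M) \<longlonglongrightarrow> 0"
      by (rule PY.L1_convergence_of_Lp[OF assms(9)]) (use lim0 in \<open>auto simp: Lp_tendsto_def\<close>)
    have "(\<lambda>n. \<integral>\<^sup>+x. ennreal \<bar>path_deriv h (F n) x - Z x\<bar> \<partial>M) \<longlonglongrightarrow> 0"
      by (rule PY.L1_convergence_of_Lp[OF assms(8)]) (use lim1 in \<open>auto simp: Lp_tendsto_def\<close>)
    moreover have "(\<integral>\<^sup>+x. ennreal \<bar>path_deriv h (F n) x - Z x\<bar> \<partial>M)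
        = (\<integral>\<^sup>+x. ennreal \<bar>path_deriv h (F n) x - Z' x\<bar> \<partial>M)" for n
      by (rule nn_integral_cong_AE) (use Z'(2) in auto)
    ultimately have l1: "(\<lambda>n. \<integral>\<^sup>+x. ennreal \<bar>path_deriv h (F n) x - Z' x\<bar> \<partial>M) \<longlonglongrightarrow> 0" by simp
    have "AE x in M. Z' x = 0"
      by (rule derivative_limit_zero[OF F \<xi> h Z'(1) m(1,2) l0 l1])
    with Z'(2) show ?thesis by eventually_elim simp
  qed
  then show ?thesis
    unfolding closable_Lq_Lp_def using F_Lq DF_Lp by blast
qed

end
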